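(* Let $(\mathcal X,\mathcal B,m,T)$ be an ergodic and aperiodic probability preserving system. For every $\alpha\in(0,1)$, every $\sigma>0$ and every $\beta\in[-1,1]$ there exists a measurable function $f:\mathcal X\to\mathbb R$ such that the process $\mathbb W_n(f)(t):=n^{-1/\alpha}S_{\lfloor nt\rfloor}(f)$, $0\le t\le 1$, converges in distribution, as a random element of $D[0,1]$ with the Skorokhod $J_1$ topology, to an $S_\alpha(\sigma,\beta,0)$ Lévy motion.
   Context: A probability preserving system $(\mathcal X,\mathcal B,m,T)$ consists of a standard probability space $(\mathcal X,\mathcal B,m)$ and a measurable map $T:\mathcal X\to\mathcal X$ with $m\circ T^{-1}=m$; it is ergodic if every $T$-invariant set is null or co-null, and aperiodic if the set of periodic points is null. For $h:\mathcal X\to\mathbb R$, $S_n(h):=\sum_{j=0}^{n-1}h\circ T^j$ (with $S_0(h)=0$). A random variable is $S_\alpha(\sigma,\beta,\mu)$ ($0<\alpha<2$, $\sigma>0$, $\beta\in[-1,1]$, $\mu\in\mathbb R$) if its characteristic function is $\exp\{-\sigma^\alpha|\theta|^\alpha(1-i\beta\,\mathrm{sign}(\theta)\tan(\pi\alpha/2))+i\mu\theta\}$ for $\alpha\ne1$, and $\exp\{-\sigma|\theta|(1+i\beta\frac{2}{\pi}\mathrm{sign}(\theta)\ln|\theta|)+i\mu\theta\}$ for $\alpha=1$. $D[0,1]$ is the space of right-continuous functions with left limits on $[0,1]$. An $S_\alpha(\sigma,\beta,0)$ Lévy motion is a process $(\mathbb W_t)_{t\in[0,1]}$ with paths in $D[0,1]$,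 $\mathbb W_0=0$, independent increments, and $\mathbb W_t-\mathbb W_s\sim S_\alpha(\sigma(t-s)^{1/\alpha},\beta,0)$ for $0\le s<t\le1$. *)

theory Defs
  imports "HOL-Probability.Probability"
begin

text \<open>Standard Borel structure: the measurable space is Borel-isomorphic to a Borel subset
of the real line (Kuratowski), i.e. (X,B) is a standard Borel space.\<close>
definition standard_borel_space :: "'a measure \<Rightarrow> bool" where
  "standard_borel_space M \<longleftrightarrow>
     (\<exists>B (\<phi>::'a \<Rightarrow> real). B \<in> sets borel \<and> bij_betw \<phi> (space M) B \<and>
        \<phi> \<in> M \<rightarrow>\<^sub>M borel \<and> (\<forall>A\<in>sets M. \<phi> ` A \<in> sets borel))"

definition prob_preserving_system :: "'a measure \<Rightarrow> ('a \<Rightarrow> 'a) \<Rightarrow> bool" where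
  "prob_preserving_system M T \<longleftrightarrow>
     prob_space M \<and> standard_borel_space M \<and> T \<in> M \<rightarrow>\<^sub>M M \<and> distr M M T = M"

definition ergodic :: "'a measure \<Rightarrow> ('a \<Rightarrow> 'a) \<Rightarrow> bool" where
  "ergodic M T \<longleftrightarrow>
     (\<forall>A\<in>sets M. T -` A \<inter> space M = A \<longrightarrow> measure M A = 0 \<or> measure M A = 1)"

definition aperiodic :: "'a measure \<Rightarrow> ('a \<Rightarrow> 'a) \<Rightarrow> bool" where
  "aperiodic M T \<longleftrightarrow> (AE x in M. \<forall>n::nat. n > 0 \<longrightarrow> (T ^^ n) x \<noteq> x)"

definition birkhoff_sum :: "('a \<Rightarrow> 'a) \<Rightarrow> ('a \<Rightarrow> real) \<Rightarrow> nat \<Rightarrow> 'a \<Rightarrow> real" where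
  "birkhoff_sum T h n x = (\<Sum>j<n. h ((T ^^ j) x))"

definition partial_sum_process ::
    "real \<Rightarrow> ('a \<Rightarrow> 'a) \<Rightarrow> ('a \<Rightarrow> real) \<Rightarrow> nat \<Rightarrow> 'a \<Rightarrow> real \<Rightarrow> real" where
  "partial_sum_process \<alpha> T f n x t =
     real n powr (- 1 / \<alpha>) * birkhoff_sum T f (nat \<lfloor>real n * t\<rfloor>) x"

definition stable_char :: "real \<Rightarrow> real \<Rightarrow> real \<Rightarrow> real \<Rightarrow> real \<Rightarrow> complex" where
  "stable_char \<alpha> \<sigma> \<beta> \<mu> \<theta> =
    (if \<alpha> \<noteq> 1 then
       exp (- complex_of_real (\<sigma> powr \<alpha> * \<bar>\<theta>\<bar> powr \<alpha>)
              * (1 - \<i> * complex_of_real (\<beta> * sgn \<theta> * tan (pi * \<alpha> / 2)))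
            + \<i> * complex_of_real (\<mu> * \<theta>))
     else
       exp (- complex_of_real (\<sigma> * \<bar>\<theta>\<bar>)
              * (1 + \<i> * complex_of_real (\<beta> * (2 / pi) * sgn \<theta> * ln \<bar>\<theta>\<bar>))
            + \<i> * complex_of_real (\<mu> * \<theta>)))"

definition stable_law :: "real \<Rightarrow> real \<Rightarrow> real \<Rightarrow> real \<Rightarrow> real measure \<Rightarrow> bool" where
  "stable_law \<alpha> \<sigma> \<beta> \<mu> N \<longleftrightarrow> real_distribution N \<and> (\<forall>\<theta>. char N \<theta> = stable_char \<alpha> \<sigma> \<beta> \<mu> \<theta>)"

text \<open>Paths are functions real => real; only their values on [0,1] matter.\<close>
definition D01 :: "(real \<Rightarrow> real) set" where
  "D01 = {x. (\<forall>t\<in>{0..<1}. (x \<longlongrightarrow> x t) (at_right t)) \<and>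
             (\<forall>t\<in>{0<..1}. \<exists>l. (x \<longlongrightarrow> l) (at_left t))}"

definition time_changes :: "(real \<Rightarrow> real) set" where
  "time_changes = {r. strict_mono_on {0..1} r \<and> continuous_on {0..1} r \<and> r 0 = 0 \<and> r 1 = 1}"

definition J1_dist :: "(real \<Rightarrow> real) \<Rightarrow> (real \<Rightarrow> real) \<Rightarrow> real" where
  "J1_dist x y = (INF r\<in>time_changes.
      max (SUP t\<in>{0..1}. \<bar>r t - t\<bar>) (SUP t\<in>{0..1}. \<bar>x t - y (r t)\<bar>))"

definition J1_continuous_on_D :: "((real \<Rightarrow> real) \<Rightarrow> real) \<Rightarrow> bool" where
  "J1_continuous_on_D g \<longleftrightarrow>
     (\<forall>x\<in>D01. \<forall>e>0. \<exists>d>0. \<forall>y\<in>D01. J1_dist x y < d \<longrightarrow> \<bar>g y - g x\<bar> < e)"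

definition converges_in_distribution_J1 ::
    "'a measure \<Rightarrow> (nat \<Rightarrow> 'a \<Rightarrow> real \<Rightarrow> real) \<Rightarrow> 'b measure \<Rightarrow> ('b \<Rightarrow> real \<Rightarrow> real) \<Rightarrow> bool" where
  "converges_in_distribution_J1 M X P Y \<longleftrightarrow>
     (\<forall>g. J1_continuous_on_D g \<and> bounded (g ` D01) \<longrightarrow>
        (\<lambda>n. \<integral>\<omega>. g (X n \<omega>) \<partial>M) \<longlonglongrightarrow> (\<integral>\<omega>. g (Y \<omega>) \<partial>P))"

definition stable_levy_motion ::
    "real \<Rightarrow> real \<Rightarrow> real \<Rightarrow> 'b measure \<Rightarrow> ('b \<Rightarrow> real \<Rightarrow> real) \<Rightarrow> bool" where
  "stable_levy_motion \<alpha> \<sigma> \<beta> P W \<longleftrightarrow>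
     prob_space P \<and>
     (\<forall>t\<in>{0..1}. (\<lambda>\<omega>. W \<omega> t) \<in> borel_measurable P) \<and>
     (\<forall>\<omega>\<in>space P. W \<omega> \<in> D01 \<and> W \<omega> 0 = 0) \<and>
     (\<forall>(k::nat) (s::nat \<Rightarrow> real). 0 \<le> s 0 \<and> s k \<le> 1 \<and> (\<forall>i<k. s i < s (Suc i)) \<longrightarrow>
        prob_space.indep_vars P (\<lambda>_. borel) (\<lambda>i \<omega>. W \<omega> (s (Suc i)) - W \<omega> (s i)) {..<k}) \<and>
     (\<forall>s t. 0 \<le> s \<and> s < t \<and> t \<le> 1 \<longrightarrow>
        stable_law \<alpha> (\<sigma> * (t - s) powr (1 / \<alpha>)) \<beta> 0 (distr P borel (\<lambda>\<omega>. W \<omega> t - W \<omega> s)))"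

end

theory Submission
  imports Defs "HOL-Complex_Analysis.Complex_Analysis"
begin

text \<open>Let \<open>a = 1 / \<alpha> > 1\<close>. Since \<open>\<alpha> < 1\<close>, the jumps of the Levy motion are absolutely summable, so no centering
is needed and its paths are pure jump series, driven by Poisson points with a uniform time and a size
\<open>c * g powr (- a)\<close> at position \<open>g\<close>. Cutting time into \<open>n\<close> cells and rounding the sizes to multiples of
\<open>n powr (- a)\<close> turns this series into an array of independent occupied/unoccupied cells (level \<open>l\<close>, time \<open>j\<close>)
whose occupation probability depends on \<open>l\<close> but not on \<open>n\<close>. One can therefore imitate all the arrays by
a single function \<open>f = (\<Sum>l. v l * indicator (F l))\<close>, provided that the events \<open>T^j x \<in> F l\<close> with \<open>j < n \<le> l\<close>
are nearly independent with these probabilities: \<open>n powr (- a)\<close> times the partial sums of \<open>f\<close> then have, up to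
a small error in total variation and up to the negligible levels \<open>l < n\<close>, the law of the rounded series, which
converges to the Levy motion pathwise in \<open>J1\<close>.\<close>

section \<open>Nearly independent sets\<close>

text \<open>The occupation probability is free of \<open>n\<close> because two factors cancel: the
  positions that round to \<open>k\<close> units form an interval of length \<open>n\<close> times
  \<open>k powr (- 1 / a) - (k + 1) powr (- 1 / a)\<close>, while a time cell has length
  \<open>1 / n\<close>. The parity of a level carries the sign, so level \<open>l\<close> stands for
  \<open>l div 2 + 1\<close> units. The construction of \<open>F l\<close> controls the orbit only
  over \<open>l + 1\<close> times, which is the origin of the restriction to levels from
  \<open>n\<close> on. The lower levels are harmless for two reasons. A fixed jump sits at a level
  of order \<open>n powr a\<close>, eventually above \<open>n\<close> since \<open>a > 1\<close>, so
  no jump of the limit is lost. And the scaled contribution of the low levels has mean of order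
  \<open>n powr (2 - a - 1 / a)\<close>, which vanishes because \<open>a + 1 / a > 2\<close>. The
  test functional \<open>g\<close> is merely J1-continuous, assumed neither uniformly continuous nor
  measurable. All comparisons therefore run through paths determined by a finite set of cells, and
  the uniform error between Birkhoff sums and such a path is charged to the oscillation of
  \<open>g\<close> around it.\<close>

locale aperiodic_ergodic_system = prob_space M for M :: "'a measure" +
  fixes T :: "'a \<Rightarrow> 'a"
  assumes system: "prob_preserving_system M T"
    and ergodic: "ergodic M T"
    and aperiodic: "aperiodic M T"
begin

lemma T_measurable [measurable]: "T \<in> M \<rightarrow>\<^sub>M M"
  using system by (simp add: prob_preserving_system_def)

lemma T_iter_measurable [measurable]: "T ^^ n \<in> M \<rightarrow>\<^sub>M M"
  by (induction n) (auto intro: measurable_comp[of _ M M])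

lemma T_iter_space: "x \<in> space M \<Longrightarrow> (T ^^ n) x \<in> space M"
  using T_iter_measurable[of n] by (rule measurable_space)

lemma distr_T_iter: "distr M M (T ^^ n) = M"
proof (induction n)
  case 0
  then show ?case by (simp add: distr_id2 id_def)
next
  case (Suc n)
  have "distr M M (T ^^ Suc n) = distr (distr M M (T ^^ n)) M T"
    by (subst distr_distr) auto
  then show ?case
    using Suc system by (simp add: prob_preserving_system_def comp_def)
qed

lemma prob_T_iter:
  assumes [measurable]: "A \<in> sets M"
  shows "prob {x \<in> space M. (T ^^ n) x \<in> A} = prob A"
proof -
  have "prob A = measure (distr M M (T ^^ n)) A" by (simp add: distr_T_iter)
  also have "\<dots> = prob ((T ^^ n) -` A \<inter> space M)" by (rule measure_distr) auto
  also have "(T ^^ n) -` A \<inter> space M = {x \<in> space M. (T ^^ n) x \<in> A}" by auto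
  finally show ?thesis by simp
qed

text \<open>An injective Borel map to the line is what is kept of the standard Borel structure: it
  makes points measurable and lets mass be cut along half-lines.\<close>

definition chart :: "'a \<Rightarrow> real" where
  "chart = (SOME \<phi>. inj_on \<phi> (space M) \<and> \<phi> \<in> M \<rightarrow>\<^sub>M borel)"

lemma inj_on_chart: "inj_on chart (space M)" and chart_measurable [measurable]: "chart \<in> M \<rightarrow>\<^sub>M borel"
proof -
  have "\<exists>\<phi>::'a \<Rightarrow> real. inj_on \<phi> (space M) \<and> \<phi> \<in> M \<rightarrow>\<^sub>M borel"
    using system unfolding prob_preserving_system_def standard_borel_space_def bij_betw_def by blast
  from someI_ex[OF this] show "inj_on chart (space M)" "chart \<in> M \<rightarrow>\<^sub>M borel"
    by (auto simp: chart_def)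
qed

lemma singleton_sets: "x \<in> space M \<Longrightarrow> {x} \<in> sets M"
proof -
  assume x: "x \<in> space M"
  have "{x} = chart -` {chart x} \<inter> space M"
    using x inj_on_chart by (auto simp: inj_on_def)
  also have "\<dots> \<in> sets M" by measurable
  finally show ?thesis .
qed

text \<open>An atom of mass \<open>c\<close> would pass mass at least \<open>c\<close> to every
  point of its forward orbit. Infinitely many distinct such points exceed total mass 1, so the orbit
  runs into a cycle, and a periodic point of positive mass contradicts aperiodicity.\<close>

lemma prob_singleton: assumes x: "x \<in> space M" shows "prob {x} = 0"
proof (rule ccontr)
  assume "prob {x} \<noteq> 0"
  define c where "c = prob {x}"
  have c: "c > 0" using \<open>prob {x} \<noteq> 0\<close> by (simp add: c_def zero_less_measure_iff)
  define a where "a n = (T ^^ n) x" for n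
  have asp: "a n \<in> space M" for n using T_iter_space[OF x] by (simp add: a_def)
  have ge: "c \<le> prob {a n}" for n
  proof -
    have "c \<le> prob {y \<in> space M. (T ^^ n) y \<in> {a n}}"
      unfolding c_def using singleton_sets[OF asp] x
      by (intro finite_measure_mono) (auto simp: a_def)
    then show ?thesis using prob_T_iter[OF singleton_sets[OF asp], of n n] by simp
  qed
  have "\<not> inj a"
  proof
    assume inj: "inj a"
    obtain N :: nat where N: "1 < of_nat N * c" using ex_less_of_nat_mult[OF c] by blast
    have "prob (\<Union>n\<in>{..<N}. {a n}) = (\<Sum>n<N. prob {a n})"
      using inj asp singleton_sets
      by (intro finite_measure_finite_Union) (auto simp: disjoint_family_on_def inj_def)
    also have "\<dots> \<ge> of_nat N * c"
      using sum_mono[of "{..<N}" "\<lambda>_. c" "\<lambda>n. prob {a n}"] ge by simp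
    finally show False using N prob_le_1[of "\<Union>n\<in>{..<N}. {a n}"] by simp
  qed
  then obtain i j where ij: "i < j" "a i = a j"
    unfolding inj_def by (metis linorder_neqE_nat)
  have "(T ^^ (j - i)) (a i) = a j"
    unfolding a_def using ij(1) by (simp add: funpow_add[symmetric, unfolded comp_def, THEN fun_cong] flip: comp_apply[of "T ^^ (j-i)" "T^^i"] funpow_add)
  then have per: "(T ^^ (j - i)) (a i) = a i" "j - i > 0" using ij by auto
  obtain N where N: "N \<in> null_sets M" "{x \<in> space M. \<not> (\<forall>n>0. (T ^^ n) x \<noteq> x)} \<subseteq> N"
    using aperiodic unfolding aperiodic_def by (auto simp: eventually_ae_filter)
  have "\<exists>n>0. (T ^^ n) (a i) = a i" using per by blast
  then have "{a i} \<subseteq> N" using N(2) asp by auto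
  then have "prob {a i} \<le> prob N" using N by (intro finite_measure_mono) auto
  also have "prob N = 0" using N(1) by (simp add: measure_eq_0_null_sets)
  finally show False using ge[of i] c by simp
qed

text \<open>The mass of \<open>A\<close> pushed to the line by \<open>chart\<close> has no atoms, so
  its distribution function is continuous and takes the value \<open>p * prob A\<close> at some
  \<open>t\<close>; the part of \<open>A\<close> with chart value at most \<open>t\<close> is the
  subset.\<close>

lemma exists_subset_of_proportion:
  assumes [measurable]: "A \<in> sets M" and p: "0 \<le> p" "p \<le> 1"
  shows "\<exists>B\<in>sets M. B \<subseteq> A \<and> prob B = p * prob A"
proof (cases "p = 0 \<or> p = 1 \<or> prob A = 0")
  case True
  then consider "p = 0 \<or> prob A = 0" | "p = 1" by blast
  then show ?thesis
  proof cases
    case 1 then show ?thesis by (intro bexI[of _ "{}"]) auto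
  next
    case 2 then show ?thesis by (intro bexI[of _ A]) auto
  qed
next
  case False
  then have p: "0 < p" "p < 1" and A: "prob A > 0"
    using p by (auto simp: zero_less_measure_iff)
  define N where "N = distr (density M (indicator A)) borel chart"
  have eN: "emeasure N X = emeasure M (A \<inter> (chart -` X \<inter> space M))" if [measurable]: "X \<in> sets borel" for X
  proof -
    have "emeasure N X = emeasure (density M (indicator A)) (chart -` X \<inter> space M)"
      unfolding N_def by (subst emeasure_distr) auto
    also have "\<dots> = (\<integral>\<^sup>+x. indicator A x * indicator (chart -` X \<inter> space M) x \<partial>M)"
      by (rule emeasure_density) auto
    also have "\<dots> = (\<integral>\<^sup>+x. indicator (A \<inter> (chart -` X \<inter> space M)) x \<partial>M)"
      by (intro nn_integral_cong) (auto simp: indicator_def)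
    finally show ?thesis by simp
  qed
  have mN: "measure N X = prob (A \<inter> (chart -` X \<inter> space M))" if "X \<in> sets borel" for X
    unfolding measure_def by (simp add: eN[OF that])
  have "finite_measure N"
    using eN[of UNIV] by (intro finite_measureI) (simp add: N_def)
  then interpret N: finite_borel_measure N
    by (intro finite_borel_measure.intro finite_borel_measure_axioms.intro) (simp_all add: N_def)
  have N_UNIV: "measure N (space N) = prob A"
    using mN[of UNIV] sets.sets_into_space[of A M] by (simp add: N_def Int_absorb2)
  have sing: "measure N {t} = 0" for t
  proof (cases "\<exists>x\<in>space M. chart x = t")
    case True
    then obtain x where x: "x \<in> space M" "chart x = t" by blast
    then have "measure N {t} \<le> prob {x}"
      unfolding mN[OF borel_singleton[OF sets.empty_sets]]
      using inj_on_chart singleton_sets[OF x(1)]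
      by (intro finite_measure_mono) (auto simp: inj_on_def)
    then show ?thesis using prob_singleton[OF x(1)] by (simp add: antisym)
  next
    case False
    then have "chart -` {t} \<inter> space M = {}" by auto
    then show ?thesis using mN[of "{t}"] by simp
  qed
  have "\<forall>\<^sub>F t in at_top. cdf N t > p * prob A"
    using N.cdf_lim_at_top p A unfolding N_UNIV by (intro order_tendstoD(1)[of _ "prob A"]) auto
  then obtain t2 where t2: "cdf N t2 > p * prob A"
    using eventually_happens'[OF trivial_limit_at_top_linorder] by blast
  have "\<forall>\<^sub>F t in at_bot. cdf N t < p * prob A"
    using N.cdf_lim_at_bot p A by (intro order_tendstoD(2)[of _ 0]) auto
  then obtain t1 where t1: "cdf N t1 < p * prob A"
    using eventually_happens'[OF trivial_limit_at_bot_linorder] by blast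
  have "t1 \<le> t2" using t1 t2 N.cdf_nondecreasing[of t2 t1] by linarith
  then obtain t where "cdf N t = p * prob A"
    using IVT[of "cdf N" t1 "p * prob A" t2] t1 t2 N.isCont_cdf sing by auto
  then have "prob (A \<inter> (chart -` {..t} \<inter> space M)) = p * prob A"
    unfolding cdf_def by (simp add: mN)
  moreover have "A \<inter> (chart -` {..t} \<inter> space M) \<in> sets M"
    by (intro sets.Int measurable_sets[OF chart_measurable]) auto
  ultimately show ?thesis
    by (intro bexI[of _ "A \<inter> (chart -` {..t} \<inter> space M)"]) auto
qed

section \<open>Independent sets of a given probability, and mixing\<close>

definition pattern :: "('i \<Rightarrow> 'a set) \<Rightarrow> 'i set \<Rightarrow> 'i set \<Rightarrow> 'a set" where
  "pattern G J S = {x \<in> space M. \<forall>i\<in>J. x \<in> G i \<longleftrightarrow> i \<in> S}"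

lemma pattern_sets [measurable]:
  assumes "finite J" "\<And>i. i \<in> J \<Longrightarrow> G i \<in> sets M"
  shows "pattern G J S \<in> sets M"
proof -
  have "pattern G J S = {x \<in> space M. \<forall>i\<in>J. (if i \<in> S then x \<in> G i else x \<in> space M - G i)}"
    by (auto simp: pattern_def)
  also have "\<dots> \<in> sets M"
  proof (rule sets.sets_Collect_finite_All[OF _ assms(1)])
    fix i assume "i \<in> J"
    then have "G i \<in> sets M" by (rule assms)
    moreover from this have "{x \<in> space M. x \<in> G i} = G i" "{x \<in> space M. x \<in> space M - G i} = space M - G i"
      using sets.sets_into_space by auto
    ultimately show "{x \<in> space M. if i \<in> S then x \<in> G i else x \<in> space M - G i} \<in> sets M"
      by (cases "i \<in> S") auto
  qed
  finally show ?thesis .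
qed

lemma pattern_partition:
  assumes "finite K" "J \<subseteq> K" "S \<subseteq> J"
  shows "pattern G J S = (\<Union>s\<in>{s. s \<subseteq> K \<and> s \<inter> J = S}. pattern G K s)"
proof -
  have "x \<in> (\<Union>s\<in>{s. s \<subseteq> K \<and> s \<inter> J = S}. pattern G K s)" if "x \<in> pattern G J S" for x
    using that assms by (intro UN_I[of "{i\<in>K. x \<in> G i}"]) (auto simp: pattern_def)
  then show ?thesis using assms by (auto simp: pattern_def)
qed

lemma disjoint_patterns: "disjoint_family_on (pattern G K) (Pow K)"
  unfolding disjoint_family_on_def pattern_def by (auto simp: set_eq_iff)

text \<open>The sets are built one after the other: each new one takes proportion \<open>p\<close>
  of every atom \<open>pattern G {..<n} s\<close> of the algebra generated by its predecessors. An
  arbitrary finite \<open>J\<close> is then handled by peeling off its largest index.\<close>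

lemma exists_bernoulli_sets:
  assumes p: "0 \<le> p" "p \<le> 1"
  shows "\<exists>G :: nat \<Rightarrow> 'a set. (\<forall>i. G i \<in> sets M) \<and>
    (\<forall>J S. finite J \<longrightarrow> S \<subseteq> J \<longrightarrow> prob (pattern G J S) = p ^ card S * (1 - p) ^ card (J - S))"
proof -
  \<comment> \<open>The choice principle demands a successor for arbitrary predecessors, measurable
    or not, hence the guard; it is discharged by induction in \<open>GM\<close>.\<close>
  let ?P = "\<lambda>(G :: nat \<Rightarrow> 'a set) (n :: nat) r. (\<forall>i<n. G i \<in> sets M) \<longrightarrow>
    r \<in> sets M \<and> (\<forall>s\<subseteq>{..<n}. prob (pattern G {..<n} s \<inter> r) = p * prob (pattern G {..<n} s))"
  have "\<exists>G. \<forall>n. ?P G n (G n)"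
  proof (rule dependent_wellorder_choice[where P = ?P])
    show "?P f x r = ?P g x r" if "\<And>y. y < x \<Longrightarrow> f y = g y" for f g :: "nat \<Rightarrow> 'a set" and x r
    proof -
      have "pattern f {..<x} s = pattern g {..<x} s" for s using that by (auto simp: pattern_def)
      then show ?thesis using that by auto
    qed
  next
    fix n :: nat and G :: "nat \<Rightarrow> 'a set"
    show "\<exists>r. ?P G n r"
    proof (cases "\<forall>i<n. G i \<in> sets M")
      case True
      then have [measurable]: "pattern G {..<n} s \<in> sets M" for s
        by (intro pattern_sets) auto
      have "\<forall>s. \<exists>B. B \<in> sets M \<and> B \<subseteq> pattern G {..<n} s \<and> prob B = p * prob (pattern G {..<n} s)"
        using exists_subset_of_proportion[OF _ p] by (simp add: Bex_def)
      then obtain B where B: "\<And>s. B s \<in> sets M" "\<And>s. B s \<subseteq> pattern G {..<n} s"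
        "\<And>s. prob (B s) = p * prob (pattern G {..<n} s)" by metis
      define r where "r = (\<Union>s\<in>Pow {..<n}. B s)"
      have "pattern G {..<n} s \<inter> r = B s" if "s \<subseteq> {..<n}" for s
      proof -
        have "B s' \<inter> pattern G {..<n} s = {}" if "s' \<subseteq> {..<n}" "s' \<noteq> s" for s'
          using B(2)[of s'] disjoint_family_onD[OF disjoint_patterns, of s' "{..<n}" s] that \<open>s \<subseteq> {..<n}\<close> by blast
        then show ?thesis using that B(2)[of s] unfolding r_def by blast
      qed
      moreover have "r \<in> sets M" unfolding r_def using B(1) by (intro sets.finite_UN) auto
      ultimately show ?thesis using B(3) by (intro exI[of _ r]) auto
    qed auto
  qed
  then obtain G where G0: "\<And>n. ?P G n (G n)" by blast
  have GM[measurable]: "G n \<in> sets M" for n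
    by (induction n rule: less_induct) (use G0 in auto)
  have G: "prob (pattern G {..<n} s \<inter> G n) = p * prob (pattern G {..<n} s)" if "s \<subseteq> {..<n}" for n s
    using G0[of n] GM that by auto
  \<comment> \<open>Indices below \<open>n\<close> that are missing from \<open>J\<close> are filled
    in by splitting into the atoms over \<open>{..<n}\<close>.\<close>
  have step: "prob (pattern G J S \<inter> G n) = p * prob (pattern G J S)" if J: "J \<subseteq> {..<n}" "S \<subseteq> J" for J S n
  proof -
    let ?I = "{s. s \<subseteq> {..<n} \<and> s \<inter> J = S}"
    have fin: "finite ?I" by (rule finite_subset[of _ "Pow {..<n}"]) auto
    have dis: "disjoint_family_on (\<lambda>s. pattern G {..<n} s) ?I"
      by (rule disjoint_family_on_mono[OF _ disjoint_patterns]) auto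
    have pm[measurable]: "pattern G {..<n} s \<in> sets M" for s by (intro pattern_sets) auto
    have "prob (pattern G J S \<inter> G n) = prob (\<Union>s\<in>?I. pattern G {..<n} s \<inter> G n)"
      using pattern_partition[of "{..<n}" J S G] J by (simp add: Int_commute)
    also have "\<dots> = (\<Sum>s\<in>?I. prob (pattern G {..<n} s \<inter> G n))"
      using dis fin by (intro finite_measure_finite_Union) (auto simp: disjoint_family_on_def)
    also have "\<dots> = (\<Sum>s\<in>?I. p * prob (pattern G {..<n} s))"
      by (intro sum.cong) (auto simp: G)
    also have "\<dots> = p * prob (\<Union>s\<in>?I. pattern G {..<n} s)"
      unfolding sum_distrib_left[symmetric]
      using dis fin by (subst finite_measure_finite_Union) auto
    finally show ?thesis using pattern_partition[of "{..<n}" J S G] J by simp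
  qed
  have "prob (pattern G J S) = p ^ card S * (1 - p) ^ card (J - S)" if "finite J" "S \<subseteq> J" for J S
    using that
  proof (induction J arbitrary: S rule: finite_linorder_max_induct)
    case empty
    then show ?case by (simp add: pattern_def prob_space)
  next
    case (insert b A)
    have [measurable]: "pattern G A S' \<in> sets M" for S' using insert(1) by (intro pattern_sets) auto
    have bA: "b \<notin> A" "A \<subseteq> {..<b}" using insert(2) by auto
    show ?case
    proof (cases "b \<in> S")
      case True
      have "pattern G (insert b A) S = pattern G A (S - {b}) \<inter> G b"
        using True bA sets.sets_into_space[OF GM] by (auto simp: pattern_def)
      moreover have "S - {b} \<subseteq> A" using insert.prems by auto
      moreover have "insert b A - S = A - (S - {b})" using True bA by auto
      moreover have "card S = Suc (card (S - {b}))"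
        using True card_Suc_Diff1[of S b] finite_subset[OF insert.prems] insert(1) by simp
      ultimately show ?thesis using insert.IH[of "S - {b}"] step[of A b "S - {b}"] bA by simp
    next
      case False
      have "pattern G (insert b A) S = pattern G A S - pattern G A S \<inter> G b"
        using False bA by (auto simp: pattern_def)
      then have "prob (pattern G (insert b A) S) = prob (pattern G A S) - prob (pattern G A S \<inter> G b)"
        by (simp add: finite_measure_Diff)
      moreover have "S \<subseteq> A" using insert.prems False by auto
      moreover from this have "insert b A - S = insert b (A - S)" "b \<notin> A - S" using False bA by auto
      then have "card (insert b A - S) = Suc (card (A - S))" using insert(1) by simp
      ultimately show ?thesis using insert.IH[of S] step[of A b S] bA
        by (simp add: algebra_simps)
    qed
  qed
  then show ?thesis using GM by blast
qed

text \<open>The centred indicators \<open>h i\<close> are orthogonal with squared norm at most 1. By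
  Bessel's inequality their coefficients \<open>c i\<close> against the indicator of
  \<open>A\<close> are square summable, hence tend to 0.\<close>

lemma pairwise_independent_mixing:
  assumes E [measurable]: "\<And>i::nat. E i \<in> sets M"
    and pE: "\<And>i. prob (E i) = q" and pw: "\<And>i j. i \<noteq> j \<Longrightarrow> prob (E i \<inter> E j) = q * q"
    and A [measurable]: "A \<in> sets M"
  shows "(\<lambda>i. prob (A \<inter> E i)) \<longlonglongrightarrow> q * prob A"
proof -
  define h where "h i x = indicator (E i) x - q" for i x
  define c where "c i = prob (A \<inter> E i) - q * prob A" for i
  have h_int[simp]: "integrable M (h i)" "integrable M (\<lambda>x. h i x * h j x)" "integrable M (\<lambda>x. indicator A x * h i x)" for i j
  proof -
    have [measurable]: "h i \<in> borel_measurable M" for i unfolding h_def by measurable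
    have b: "\<bar>h i x\<bar> \<le> 1 + \<bar>q\<bar>" for i x
      unfolding h_def by (auto simp: indicator_def)
    have b2: "\<bar>h i x * h j x\<bar> \<le> (1 + \<bar>q\<bar>) * (1 + \<bar>q\<bar>)" for i j x
      unfolding abs_mult by (intro mult_mono b) auto
    show "integrable M (h i)" by (rule integrable_const_bound[where B="1 + \<bar>q\<bar>"]) (auto simp: b)
    show "integrable M (\<lambda>x. h i x * h j x)"
      by (rule integrable_const_bound[where B="(1 + \<bar>q\<bar>) * (1 + \<bar>q\<bar>)"]) (auto simp: b2)
    show "integrable M (\<lambda>x. indicator A x * h i x)"
      by (rule integrable_const_bound[where B="1 + \<bar>q\<bar>"]) (auto simp: indicator_def b)
  qed
  have hh: "(\<integral>x. h i x * h j x \<partial>M) = (if i = j then q - q * q else 0)" for i j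
  proof -
    have "(\<integral>x. h i x * h j x \<partial>M) = (\<integral>x. indicator (E i \<inter> E j) x - q * indicator (E i) x - q * indicator (E j) x + q * q \<partial>M)"
      unfolding h_def by (intro Bochner_Integration.integral_cong) (auto simp: indicator_def algebra_simps)
    also have "\<dots> = prob (E i \<inter> E j) - q * prob (E i) - q * prob (E j) + q * q"
      by (simp add: prob_space less_top[symmetric])
    finally show ?thesis using pw[of i j] by (simp add: pE)
  qed
  have Ah: "(\<integral>x. indicator A x * h i x \<partial>M) = c i" for i
  proof -
    have "(\<integral>x. indicator A x * h i x \<partial>M) = (\<integral>x. indicator (A \<inter> E i) x - q * indicator A x \<partial>M)"
      unfolding h_def by (intro Bochner_Integration.integral_cong) (auto simp: indicator_def algebra_simps)
    also have "\<dots> = c i" by (simp add: c_def less_top[symmetric])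
    finally show ?thesis .
  qed
  have q: "0 \<le> q" "q \<le> 1" using pE[of 0] by auto
  have bessel: "(\<Sum>i<n. (c i)\<^sup>2) \<le> 1" for n
  proof -
    \<comment> \<open>Squared distance from the indicator of \<open>A\<close> to the combination of
      the \<open>h i\<close> with coefficients \<open>c i\<close>. As the squared norms
      \<open>q - q * q\<close> are at most 1, it is at most \<open>prob A\<close> minus the sum of
      the squares of the \<open>c i\<close>.\<close>
    have "0 \<le> (\<integral>x. (indicator A x - (\<Sum>i<n. c i * h i x))\<^sup>2 \<partial>M)" by simp
    also have "\<dots> = (\<integral>x. indicator A x - 2 * (\<Sum>i<n. c i * (indicator A x * h i x)) + (\<Sum>i<n. \<Sum>j<n. c i * c j * (h i x * h j x)) \<partial>M)"
      by (intro Bochner_Integration.integral_cong)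
        (auto simp: power2_eq_square algebra_simps sum_product sum_distrib_left sum_distrib_right indicator_def intro!: sum.cong)
    also have "\<dots> = prob A - 2 * (\<Sum>i<n. c i * c i) + (\<Sum>i<n. \<Sum>j<n. c i * c j * (if i = j then q - q * q else 0))"
      by (simp add: Ah hh less_top[symmetric] cong del: if_weak_cong)
    also have "(\<Sum>i<n. \<Sum>j<n. c i * c j * (if i = j then q - q * q else 0)) = (\<Sum>i<n. c i * c i * (q - q * q))"
      by (intro sum.cong) (auto simp: if_distrib sum.delta' cong: if_cong)
    also have "\<dots> \<le> (\<Sum>i<n. c i * c i)"
      using q by (intro sum_mono mult_left_le) (auto simp: algebra_simps intro!: add_increasing2)
    finally have "(\<Sum>i<n. c i * c i) \<le> prob A" by simp
    then show ?thesis using prob_le_1[of A] unfolding power2_eq_square by linarith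
  qed
  have "summable (\<lambda>i. (c i)\<^sup>2)"
    by (rule summableI_nonneg_bounded[of _ 1]) (auto simp: bessel)
  then have "(\<lambda>i. (c i)\<^sup>2) \<longlonglongrightarrow> 0" by (rule summable_LIMSEQ_zero)
  from tendsto_real_sqrt[OF this] have "c \<longlonglongrightarrow> 0" by (simp add: tendsto_rabs_zero_iff)
  then have "(\<lambda>i. c i + q * prob A) \<longlonglongrightarrow> 0 + q * prob A" by (intro tendsto_intros)
  then show ?thesis by (simp add: c_def)
qed

end

section \<open>Itineraries and the law of independent cells\<close>

definition names :: "('a \<Rightarrow> 'a) \<Rightarrow> (nat \<Rightarrow> 'a set) \<Rightarrow> (nat \<times> nat) set \<Rightarrow> 'a \<Rightarrow> (nat \<times> nat) set" where
  "names T F R x = {c \<in> R. (T ^^ snd c) x \<in> F (fst c)}"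

text \<open>A cell is a pair (level, time). This is the target law of \<open>names T F R\<close>:
  independent cells, occupied with probability \<open>p l\<close> at level \<open>l\<close>, with
  \<open>S\<close> the set of occupied ones.\<close>

definition bernoulli_weight :: "(nat \<Rightarrow> real) \<Rightarrow> (nat \<times> nat) set \<Rightarrow> (nat \<times> nat) set \<Rightarrow> real" where
  "bernoulli_weight p R S = (\<Prod>c\<in>R. if c \<in> S then p (fst c) else 1 - p (fst c))"

lemma sum_Pow_disjoint_Un:
  fixes h :: "'b set \<Rightarrow> real"
  assumes "finite A" "finite B" "A \<inter> B = {}"
  shows "(\<Sum>S\<in>Pow (A \<union> B). h S) = (\<Sum>S\<in>Pow A. \<Sum>S'\<in>Pow B. h (S \<union> S'))"
proof -
  have "(\<Sum>S\<in>Pow A. \<Sum>S'\<in>Pow B. h (S \<union> S')) = (\<Sum>(S, S')\<in>Pow A \<times> Pow B. h (S \<union> S'))"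
    using assms by (subst sum.cartesian_product) auto
  also have "\<dots> = (\<Sum>S\<in>Pow (A \<union> B). h S)"
    using assms(3)
    by (intro sum.reindex_bij_witness[of _ "\<lambda>S. (S \<inter> A, S \<inter> B)" "\<lambda>(S, S'). S \<union> S'"]) auto
  finally show ?thesis by simp
qed

lemma bernoulli_weight_nonneg: "(\<And>l. 0 \<le> p l \<and> p l \<le> 1) \<Longrightarrow> 0 \<le> bernoulli_weight p R S"
  unfolding bernoulli_weight_def by (intro prod_nonneg) auto

lemma bernoulli_weight_Un:
  assumes "finite A" "finite B" "A \<inter> B = {}" "S \<subseteq> A" "S' \<subseteq> B"
  shows "bernoulli_weight p (A \<union> B) (S \<union> S') = bernoulli_weight p A S * bernoulli_weight p B S'"
proof -
  have "bernoulli_weight p (A \<union> B) (S \<union> S') =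
    (\<Prod>c\<in>A. if c \<in> S \<union> S' then p (fst c) else 1 - p (fst c)) * (\<Prod>c\<in>B. if c \<in> S \<union> S' then p (fst c) else 1 - p (fst c))"
    unfolding bernoulli_weight_def using assms by (intro prod.union_disjoint) auto
  also have "\<dots> = bernoulli_weight p A S * bernoulli_weight p B S'"
    unfolding bernoulli_weight_def using assms by (intro arg_cong2[of _ _ _ _ times] prod.cong) auto
  finally show ?thesis .
qed

lemma bernoulli_weight_row:
  assumes "S \<subseteq> {..<n}"
  shows "bernoulli_weight p ({b} \<times> {..<n}) ({b} \<times> S) = p b ^ card S * (1 - p b) ^ card ({..<n} - S)"
proof -
  have "bernoulli_weight p ({b} \<times> {..<n}) ({b} \<times> S) = (\<Prod>j<n. if j \<in> S then p b else 1 - p b)"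
    unfolding bernoulli_weight_def
    by (rule prod.reindex_bij_witness[of _ "\<lambda>j. (b, j)" snd]) auto
  also have "\<dots> = p b ^ card ({..<n} \<inter> {j. j \<in> S}) * (1 - p b) ^ card ({..<n} \<inter> - {j. j \<in> S})"
    by (simp add: prod.If_cases)
  finally show ?thesis using assms by (simp add: Int_absorb1 Diff_eq)
qed

lemma sum_bernoulli_weight:
  assumes "finite R"
  shows "(\<Sum>S\<in>Pow R. bernoulli_weight p R S) = 1"
  using assms
proof (induction R)
  case empty
  then show ?case by (simp add: bernoulli_weight_def)
next
  case (insert c R)
  have "(\<Sum>S\<in>Pow ({c} \<union> R). bernoulli_weight p ({c} \<union> R) S) =
    (\<Sum>S'\<in>Pow {c}. \<Sum>S\<in>Pow R. bernoulli_weight p ({c} \<union> R) (S' \<union> S))"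
    using insert by (intro sum_Pow_disjoint_Un) auto
  also have "\<dots> = (\<Sum>S'\<in>Pow {c}. \<Sum>S\<in>Pow R. bernoulli_weight p {c} S' * bernoulli_weight p R S)"
    using insert by (intro sum.cong refl bernoulli_weight_Un) auto
  also have "\<dots> = 1"
    unfolding sum_distrib_left[symmetric] insert.IH by (simp add: Pow_insert bernoulli_weight_def)
  finally show ?case by simp
qed

section \<open>Sets with nearly independent itineraries\<close>

context aperiodic_ergodic_system begin

text \<open>The points that visit \<open>B\<close> infinitely often form an invariant set. By
  stationarity all \<open>D n\<close> have the same mass, so this set has the mass of
  \<open>D 0\<close>, which is at least \<open>prob B\<close>, and ergodicity makes it full.\<close>

lemma AE_hitting:
  assumes [measurable]: "B \<in> sets M" and B: "prob B > 0"
  shows "AE x in M. \<exists>i. (T ^^ i) x \<in> B"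
proof -
  define D where "D n = {x \<in> space M. \<exists>i\<ge>n. (T ^^ i) x \<in> B}" for n
  have [measurable]: "D n \<in> sets M" for n unfolding D_def by measurable
  define C where "C = (\<Inter>n. D n)"
  have [measurable]: "C \<in> sets M" unfolding C_def by measurable
  have shift: "D n = {x \<in> space M. (T ^^ n) x \<in> D 0}" for n
  proof -
    have "(\<exists>i\<ge>n. (T ^^ i) x \<in> B) \<longleftrightarrow> (\<exists>i. (T ^^ i) ((T ^^ n) x) \<in> B)" for x
    proof -
      have "(T ^^ i) ((T ^^ n) x) = (T ^^ (i + n)) x" for i by (simp add: funpow_add)
      then show ?thesis by (metis le_add2 le_add_diff_inverse2)
    qed
    then show ?thesis using T_iter_space by (auto simp: D_def)
  qed
  have pD: "prob (D n) = prob (D 0)" for n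
    by (subst shift) (rule prob_T_iter, measurable)
  have "(\<lambda>n. prob (D n)) \<longlonglongrightarrow> prob C"
    unfolding C_def by (intro finite_Lim_measure_decseq) (auto simp: decseq_def D_def intro: order_trans)
  moreover have "(\<lambda>n. prob (D n)) = (\<lambda>_. prob (D 0))"
    by (rule ext) (rule pD)
  ultimately have "prob C = prob (D 0)"
    by (simp only: LIMSEQ_const_iff)
  moreover have "prob B \<le> prob (D 0)"
    using sets.sets_into_space[of B M] by (intro finite_measure_mono) (auto simp: D_def intro!: exI[of _ 0])
  ultimately have "prob C > 0" using B by simp
  moreover have inv: "T -` C \<inter> space M = C"
  proof -
    have shift: "(T ^^ i) (T x) = (T ^^ Suc i) x" for i x by (simp add: funpow_swap1)
    have "(\<forall>n. \<exists>i\<ge>n. (T ^^ i) (T x) \<in> B) \<longleftrightarrow> (\<forall>n. \<exists>i\<ge>n. (T ^^ i) x \<in> B)" for x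
      unfolding shift by (metis Suc_le_D Suc_le_mono le_SucI)
    then show ?thesis using T_iter_space[of _ 1] by (auto simp: C_def D_def)
  qed
  moreover have "prob C = 0 \<or> prob C = 1"
    using ergodic \<open>C \<in> sets M\<close> inv unfolding ergodic_def by blast
  ultimately have "prob C = 1" by linarith
  then have "AE x in M. x \<in> C" by (simp add: AE_prob_1)
  then show ?thesis by eventually_elim (auto simp: C_def D_def)
qed

text \<open>Instead of a Rokhlin tower we use the hitting time \<open>i\<close> of a small set \<open>B\<close>: the point \<open>x\<close> belongs to \<open>F\<close> iff
\<open>T^i x\<close> lies in the \<open>i\<close>-th of a family of independent sets. Before the hit, \<open>i\<close> decreases by one at each step,
so the orbit reads independent sets at the same point \<open>T^i x\<close>. Taking these sets far out in the sequence makes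
them nearly independent of the finitely many given \<open>A\<close>, by mixing.\<close>

lemma exists_nearly_iid_set:
  assumes fin: "finite \<A>" and \<A>: "\<A> \<subseteq> sets M" and p: "0 \<le> p" "p \<le> 1" and "\<epsilon> > 0"
  shows "\<exists>F\<in>sets M. \<forall>n\<le>N. \<forall>A\<in>\<A>. \<forall>S\<subseteq>{..<n}.
    \<bar>prob (A \<inter> {x \<in> space M. \<forall>j<n. (T ^^ j) x \<in> F \<longleftrightarrow> j \<in> S}) - prob A * (p ^ card S * (1 - p) ^ card ({..<n} - S))\<bar> \<le> \<epsilon>"
proof -
  \<comment> \<open>\<open>B\<close> is so small that a hit before time \<open>N\<close> has
    probability at most \<epsilon> / 4; the absence of a hit before \<open>h\<close> costs another
    \<epsilon> / 4 and the mixing \<epsilon> / 2. The minimum with 1 keeps \<delta> a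
    probability.\<close>
  define \<delta> where "\<delta> = min 1 (\<epsilon> / (4 * (real N + 1)))"
  have \<delta>: "0 < \<delta>" "\<delta> \<le> 1" "real N * \<delta> \<le> \<epsilon> / 4"
  proof -
    show "0 < \<delta>" "\<delta> \<le> 1" using \<open>\<epsilon> > 0\<close> by (auto simp: \<delta>_def)
    have "real N * \<delta> \<le> real N * (\<epsilon> / (4 * (real N + 1)))" by (intro mult_left_mono) (auto simp: \<delta>_def)
    also have "\<dots> \<le> \<epsilon> / 4" using \<open>\<epsilon> > 0\<close> by (simp add: field_simps)
    finally show "real N * \<delta> \<le> \<epsilon> / 4" .
  qed
  obtain B where B[measurable]: "B \<in> sets M" and pB: "prob B = \<delta>"
    using exists_subset_of_proportion[of "space M" \<delta>] \<delta> by (auto simp: prob_space)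
  define L where "L i = {x \<in> space M. (T ^^ i) x \<in> B \<and> (\<forall>i'<i. (T ^^ i') x \<notin> B)}" for i
  have [measurable]: "L i \<in> sets M" for i unfolding L_def by measurable
  have Ldisj: "disjoint_family L"
    unfolding disjoint_family_on_def L_def by (auto, metis linorder_neqE_nat)
  have early: "prob {x \<in> space M. \<exists>i<N. (T ^^ i) x \<in> B} \<le> \<epsilon> / 4"
  proof -
    have "{x \<in> space M. \<exists>i<N. (T ^^ i) x \<in> B} = (\<Union>i\<in>{..<N}. {x \<in> space M. (T ^^ i) x \<in> B})" by auto
    also have "prob \<dots> \<le> (\<Sum>i<N. prob {x \<in> space M. (T ^^ i) x \<in> B})"
      by (intro finite_measure_subadditive_finite) auto
    also have "\<dots> = real N * \<delta>" by (simp add: prob_T_iter pB)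
    finally show ?thesis using \<delta> by simp
  qed
  obtain h where late: "prob {x \<in> space M. \<forall>i<h. (T ^^ i) x \<notin> B} < \<epsilon> / 4"
  proof -
    define Z where "Z h = {x \<in> space M. \<forall>i<h. (T ^^ i) x \<notin> B}" for h
    have "(\<lambda>h. prob (Z h)) \<longlonglongrightarrow> prob (\<Inter>h. Z h)"
      unfolding Z_def by (intro finite_Lim_measure_decseq) (auto simp: decseq_def)
    moreover have "prob (\<Inter>h. Z h) = 0"
    proof -
      have "AE x in M. x \<notin> (\<Inter>h. Z h)"
        using AE_hitting[OF B] pB \<delta> by (auto simp: Z_def elim!: eventually_mono)
      moreover have "(\<Inter>h. Z h) \<in> sets M" unfolding Z_def by measurable
      ultimately show ?thesis
        by (simp add: AE_iff_measurable[of "\<Inter>h. Z h" M] prob_eq_0)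
    qed
    ultimately have "\<forall>\<^sub>F h in sequentially. prob (Z h) < \<epsilon> / 4"
      using \<open>\<epsilon> > 0\<close> by (intro order_tendstoD(2)[of _ 0]) auto
    then show ?thesis using that eventually_happens'[OF sequentially_bot] unfolding Z_def by blast
  qed
  obtain G :: "nat \<Rightarrow> 'a set" where G[measurable]: "\<And>i. G i \<in> sets M"
    and pG: "\<And>J S. finite J \<Longrightarrow> S \<subseteq> J \<Longrightarrow> prob (pattern G J S) = p ^ card S * (1 - p) ^ card (J - S)"
    using exists_bernoulli_sets[OF p] by blast
  define w where "w n S = p ^ card S * (1 - p) ^ card ({..<n} - S)" for n :: nat and S
  \<comment> \<open>Read at the hitting point, time \<open>j\<close> of the orbit uses the set with
    index \<open>k * h + (i - j)\<close>. Since \<open>i - j < h\<close>, different \<open>k\<close>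
    use disjoint blocks of indices, so the \<open>E i n S k\<close> are pairwise independent in
    \<open>k\<close>, and mixing applies as \<open>k\<close> grows.\<close>
  define E where "E i n S k = {x \<in> space M. (T ^^ i) x \<in> pattern G ((\<lambda>j. k * h + (i - j)) ` {..<n}) ((\<lambda>j. k * h + (i - j)) ` S)}"
    for i n :: nat and S and k :: nat
  have [measurable]: "pattern G ((\<lambda>j. k * h + (i - j)) ` {..<n}) S' \<in> sets M" for i n k S'
    by (intro pattern_sets) auto
  have [measurable]: "E i n S k \<in> sets M" for i n S k unfolding E_def by measurable
  \<comment> \<open>The constraints that one and the same \<open>k\<close> has to meet; there are
    finitely many.\<close>
  define I where "I = {(A, i, n, S). A \<in> \<A> \<and> i < h \<and> n \<le> N \<and> n \<le> i \<and> S \<subseteq> {..<n}}"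
  have finI: "finite I"
  proof (rule finite_subset)
    show "I \<subseteq> \<A> \<times> {..<h} \<times> {..N} \<times> Pow {..<N}" unfolding I_def by auto
  qed (use fin in auto)
  have mix: "\<forall>\<^sub>F k in sequentially. \<bar>prob (A \<inter> L i \<inter> E i n S k) - w n S * prob (A \<inter> L i)\<bar> < \<epsilon> / (2 * (real h + 1))"
    if "A \<in> \<A>" "i < h" "n \<le> i" "S \<subseteq> {..<n}" for A i n S
  proof -
    have inj: "inj_on (\<lambda>j. k * h + (i - j)) {..<n}" for k using that(3) by (auto simp: inj_on_def)
    have cS: "card ((\<lambda>j. k * h + (i - j)) ` S) = card S" for k
      using inj_on_subset[OF inj that(4)] by (rule card_image)
    have cD: "card ((\<lambda>j. k * h + (i - j)) ` {..<n} - (\<lambda>j. k * h + (i - j)) ` S) = card ({..<n} - S)" for k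
      using inj_on_image_set_diff[OF inj, of "{..<n}" S k] that(4) card_image[OF inj_on_subset[OF inj, of "{..<n} - S"], of k]
      by auto
    have pE: "prob (E i n S k) = w n S" for k
      unfolding E_def by (subst prob_T_iter) (use that(4) in \<open>auto simp: pG cS cD w_def image_mono\<close>)
    have pEE: "prob (E i n S k \<inter> E i n S k') = w n S * w n S" if "k \<noteq> k'" for k k'
    proof -
      define J where "J k = (\<lambda>j. k * h + (i - j)) ` {..<n}" for k
      define JS where "JS k = (\<lambda>j. k * h + (i - j)) ` S" for k
      have sub: "JS k \<subseteq> J k" for k using \<open>S \<subseteq> {..<n}\<close> by (auto simp: J_def JS_def)
      have quot: "x div h = k" if "x \<in> J k" for x k
      proof -
        obtain j where "x = k * h + (i - j)" using \<open>x \<in> J k\<close> by (auto simp: J_def)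
        moreover have "i - j < h" using \<open>i < h\<close> by simp
        ultimately show ?thesis by simp
      qed
      have dJ: "J k \<inter> J k' = {}" using quot \<open>k \<noteq> k'\<close> by blast
      have finJ: "finite (J k)" for k by (simp add: J_def)
      have "E i n S k \<inter> E i n S k' = {x \<in> space M. (T ^^ i) x \<in> pattern G (J k \<union> J k') (JS k \<union> JS k')}"
        using dJ sub[of k] sub[of k'] unfolding E_def J_def[symmetric] JS_def[symmetric] pattern_def by blast
      moreover have "prob {x \<in> space M. (T ^^ i) x \<in> pattern G (J k \<union> J k') (JS k \<union> JS k')} = w n S * w n S"
      proof -
        have c1: "card (JS k \<union> JS k') = card S + card S"
        proof -
          have "JS k \<inter> JS k' = {}" using dJ sub by blast
          then show ?thesis
            using cS finite_subset[OF sub finJ] by (subst card_Un_disjoint) (auto simp: JS_def)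
        qed
        have "J k \<union> J k' - (JS k \<union> JS k') = (J k - JS k) \<union> (J k' - JS k')"
          using dJ sub[of k] sub[of k'] by blast
        moreover have "card ((J k - JS k) \<union> (J k' - JS k')) = card ({..<n} - S) + card ({..<n} - S)"
        proof -
          have "(J k - JS k) \<inter> (J k' - JS k') = {}" using dJ by blast
          then show ?thesis
            using cD finJ by (subst card_Un_disjoint) (auto simp: J_def JS_def)
        qed
        ultimately have c2: "card (J k \<union> J k' - (JS k \<union> JS k')) = card ({..<n} - S) + card ({..<n} - S)" by simp
        have "pattern G (J k \<union> J k') (JS k \<union> JS k') \<in> sets M" using finJ by (intro pattern_sets) auto
        moreover have "prob (pattern G (J k \<union> J k') (JS k \<union> JS k')) = w n S * w n S"
          using finJ sub by (subst pG) (auto simp: c1 c2 w_def power_add subset_iff)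
        ultimately show ?thesis by (subst prob_T_iter) auto
      qed
      ultimately show ?thesis by simp
    qed
    have [measurable]: "A \<in> sets M" using that \<A> by auto
    have "(\<lambda>k. prob (A \<inter> L i \<inter> E i n S k)) \<longlonglongrightarrow> w n S * prob (A \<inter> L i)"
      by (rule pairwise_independent_mixing) (auto simp: pE pEE)
    then show ?thesis
      using \<open>\<epsilon> > 0\<close> by (auto dest!: tendstoD[where e = "\<epsilon> / (2 * (real h + 1))"] simp: dist_real_def)
  qed
  have "\<forall>\<^sub>F k in sequentially. \<forall>(A, i, n, S)\<in>I. \<bar>prob (A \<inter> L i \<inter> E i n S k) - w n S * prob (A \<inter> L i)\<bar> < \<epsilon> / (2 * (real h + 1))"
    using mix by (intro eventually_ball_finite[OF finI]) (auto simp: I_def)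
  then obtain k where k: "\<And>A i n S. (A, i, n, S) \<in> I \<Longrightarrow> \<bar>prob (A \<inter> L i \<inter> E i n S k) - w n S * prob (A \<inter> L i)\<bar> < \<epsilon> / (2 * (real h + 1))"
    using eventually_happens'[OF sequentially_bot] by blast
  define F where "F = (\<Union>i\<in>{..<h}. L i \<inter> {x \<in> space M. (T ^^ i) x \<in> G (k * h + i)})"
  have [measurable]: "F \<in> sets M" unfolding F_def by measurable
  have F_iff: "(T ^^ j) x \<in> F \<longleftrightarrow> (T ^^ i) x \<in> G (k * h + (i - j))" if "x \<in> L i" "j \<le> i" "i < h" for x i j
  proof -
    have add: "(T ^^ a) ((T ^^ j) x) = (T ^^ (a + j)) x" for a by (simp add: funpow_add)
    have x: "x \<in> space M" using that by (simp add: L_def)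
    have "(T ^^ j) x \<in> L (i - j)"
      using that T_iter_space[OF x] by (auto simp: L_def add)
    then have "(T ^^ j) x \<in> L i' \<longleftrightarrow> i' = i - j" for i'
      using disjoint_family_onD[OF Ldisj, of i' "i - j"] by auto
    then have "(T ^^ j) x \<in> F \<longleftrightarrow> (T ^^ (i - j)) ((T ^^ j) x) \<in> G (k * h + (i - j))"
      using that T_iter_space[OF x] unfolding F_def by auto
    then show ?thesis using that by (simp add: add)
  qed
  have main: "\<bar>prob (A \<inter> {x \<in> space M. \<forall>j<n. (T ^^ j) x \<in> F \<longleftrightarrow> j \<in> S}) - prob A * w n S\<bar> \<le> \<epsilon>"
    if n: "n \<le> N" and A: "A \<in> \<A>" and S: "S \<subseteq> {..<n}" for n A S
  proof -
    have [measurable]: "A \<in> sets M" using A \<A> by auto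
    define Q where "Q = {x \<in> space M. \<forall>j<n. (T ^^ j) x \<in> F \<longleftrightarrow> j \<in> S}"
    have [measurable]: "Q \<in> sets M" unfolding Q_def by measurable
    have QL: "A \<inter> Q \<inter> L i = A \<inter> L i \<inter> E i n S k" if "N \<le> i" "i < h" for i
    proof -
      have "x \<in> Q \<longleftrightarrow> x \<in> E i n S k" if x: "x \<in> L i" for x
      proof -
        have "(\<forall>j<n. (T ^^ i) x \<in> G (k * h + (i - j)) \<longleftrightarrow> j \<in> S) \<longleftrightarrow>
          (\<forall>j<n. (T ^^ i) x \<in> G (k * h + (i - j)) \<longleftrightarrow> k * h + (i - j) \<in> (\<lambda>j. k * h + (i - j)) ` S)"
        proof -
          have "k * h + (i - j) \<in> (\<lambda>j. k * h + (i - j)) ` S \<longleftrightarrow> j \<in> S" if "j < n" for j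
          proof
            assume "k * h + (i - j) \<in> (\<lambda>j. k * h + (i - j)) ` S"
            then obtain j' where j': "j' \<in> S" "i - j = i - j'" by auto
            moreover have "j' < n" using j' S by auto
            ultimately show "j \<in> S" using \<open>N \<le> i\<close> n that by (metis diff_diff_cancel le_trans less_imp_le_nat)
          qed auto
          then show ?thesis by auto
        qed
        then show ?thesis
          using x \<open>N \<le> i\<close> \<open>i < h\<close> n F_iff[OF x] T_iter_space
          unfolding Q_def E_def pattern_def by (auto simp: L_def)
      qed
      then show ?thesis by auto
    qed
    \<comment> \<open>If the first hit falls into \<open>{N..<h}\<close>, all times
      \<open>j < n\<close> precede it because \<open>n \<le> N\<close>. Only mass \<epsilon> / 2 is
      left outside \<open>V\<close>.\<close>
    define V where "V = (\<Union>i\<in>{N..<h}. L i)"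
    have [measurable]: "V \<in> sets M" unfolding V_def by measurable
    have rest: "prob (space M - V) \<le> \<epsilon> / 2"
    proof -
      have "space M - V \<subseteq> {x \<in> space M. \<exists>i<N. (T ^^ i) x \<in> B} \<union> {x \<in> space M. \<forall>i<h. (T ^^ i) x \<notin> B}"
      proof
        fix x assume x: "x \<in> space M - V"
        { assume "\<exists>i<h. (T ^^ i) x \<in> B"
          then obtain i where "i < h" "(T ^^ i) x \<in> B" by blast
          define m where "m = (LEAST i. (T ^^ i) x \<in> B)"
          have "(T ^^ m) x \<in> B" "m \<le> i" "\<forall>i'<m. (T ^^ i') x \<notin> B"
            unfolding m_def using \<open>(T ^^ i) x \<in> B\<close> by (auto intro: LeastI Least_le dest: not_less_Least)
          moreover from this have "x \<in> L m" using x by (simp add: L_def)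
          ultimately have "\<exists>i<N. (T ^^ i) x \<in> B"
            using x \<open>i < h\<close> unfolding V_def by (intro exI[of _ m]) (auto simp: not_le)
        }
        then show "x \<in> {x \<in> space M. \<exists>i<N. (T ^^ i) x \<in> B} \<union> {x \<in> space M. \<forall>i<h. (T ^^ i) x \<notin> B}"
          using x by auto
      qed
      then have "prob (space M - V) \<le> prob ({x \<in> space M. \<exists>i<N. (T ^^ i) x \<in> B} \<union> {x \<in> space M. \<forall>i<h. (T ^^ i) x \<notin> B})"
        by (intro finite_measure_mono) auto
      also have "\<dots> \<le> prob {x \<in> space M. \<exists>i<N. (T ^^ i) x \<in> B} + prob {x \<in> space M. \<forall>i<h. (T ^^ i) x \<notin> B}"
        by (intro measure_Un_le) auto
      finally show ?thesis using early late by linarith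
    qed
    have split: "prob X = (\<Sum>i=N..<h. prob (X \<inter> L i)) + prob (X - V)" if [measurable]: "X \<in> sets M" for X
    proof -
      have "prob X = prob (X \<inter> V) + prob (X - V)"
        by (subst finite_measure_Union[symmetric]) (auto simp: Int_Diff_Un)
      also have "X \<inter> V = (\<Union>i\<in>{N..<h}. X \<inter> L i)" unfolding V_def by auto
      also have "prob \<dots> = (\<Sum>i=N..<h. prob (X \<inter> L i))"
        using Ldisj by (intro finite_measure_finite_Union) (auto simp: disjoint_family_on_def)
      finally show ?thesis .
    qed
    have w: "0 \<le> w n S" "w n S \<le> 1"
      unfolding w_def using p by (auto intro!: mult_le_one power_le_one)
    have sm: "\<bar>\<Sum>i=N..<h. prob (A \<inter> Q \<inter> L i) - prob (A \<inter> L i) * w n S\<bar> \<le> \<epsilon> / 2"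
    proof -
      have "\<bar>\<Sum>i=N..<h. prob (A \<inter> Q \<inter> L i) - prob (A \<inter> L i) * w n S\<bar> \<le> (\<Sum>i=N..<h. \<epsilon> / (2 * (real h + 1)))"
      proof (rule order_trans[OF sum_abs sum_mono])
        fix i assume i: "i \<in> {N..<h}"
        then have "(A, i, n, S) \<in> I" using A S n by (auto simp: I_def)
        from k[OF this] show "\<bar>prob (A \<inter> Q \<inter> L i) - prob (A \<inter> L i) * w n S\<bar> \<le> \<epsilon> / (2 * (real h + 1))"
          using QL[of i] i by (simp add: mult.commute)
      qed
      also have "\<dots> = real (h - N) * (\<epsilon> / (2 * (real h + 1)))" by simp
      also have "\<dots> \<le> (real h + 1) * (\<epsilon> / (2 * (real h + 1)))"
        using \<open>\<epsilon> > 0\<close> by (intro mult_right_mono) auto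
      also have "\<dots> = \<epsilon> / 2" by (simp add: field_simps)
      finally show ?thesis .
    qed
    have r1: "0 \<le> prob (A \<inter> Q - V)" "prob (A \<inter> Q - V) \<le> \<epsilon> / 2"
      by (simp, intro order_trans[OF finite_measure_mono rest]) (auto simp: Q_def)
    have r2: "0 \<le> prob (A - V) * w n S" "prob (A - V) * w n S \<le> \<epsilon> / 2"
    proof -
      have "prob (A - V) \<le> \<epsilon> / 2"
        using sets.sets_into_space[of A M] by (intro order_trans[OF finite_measure_mono rest]) auto
      then show "prob (A - V) * w n S \<le> \<epsilon> / 2"
        using mult_left_le[OF w(2), of "prob (A - V)"] by simp
    qed (use w in simp)
    \<comment> \<open>Both remainders outside \<open>V\<close> lie between 0 and \<epsilon> / 2, so
      their difference costs \<epsilon> / 2 and not the sum of the two bounds.\<close>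
    have "prob (A \<inter> Q) - prob A * w n S =
      (\<Sum>i=N..<h. prob (A \<inter> Q \<inter> L i) - prob (A \<inter> L i) * w n S) + (prob (A \<inter> Q - V) - prob (A - V) * w n S)"
      using split[of "A \<inter> Q"] split[of A] by (simp add: sum_subtractf ring_distribs flip: sum_distrib_right)
    then show ?thesis using sm r1 r2 unfolding Q_def by linarith
  qed
  then show ?thesis unfolding w_def by (intro bexI[of _ F]) auto
qed

lemma names_sets [measurable]:
  assumes "finite R" "\<And>c. c \<in> R \<Longrightarrow> F (fst c) \<in> sets M"
  shows "{x \<in> space M. names T F R x = S} \<in> sets M"
proof (cases "S \<subseteq> R")
  case True
  have "{x \<in> space M. names T F R x = S} = pattern (\<lambda>c. {x \<in> space M. (T ^^ snd c) x \<in> F (fst c)}) R S"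
    using True by (auto simp: pattern_def names_def)
  moreover have "{x \<in> space M. (T ^^ snd c) x \<in> F (fst c)} \<in> sets M" if "c \<in> R" for c
    using assms(2)[OF that] by measurable
  ultimately show ?thesis using assms(1) by (simp add: pattern_sets)
next
  case False
  then have empty: "{x \<in> space M. names T F R x = S} = {}" by (auto simp: names_def)
  show ?thesis unfolding empty by (rule sets.empty_sets)
qed

text \<open>Level after level, \<open>F l\<close> is chosen nearly iid over \<open>l + 1\<close>
  times and nearly independent of everything read from earlier levels at these times. A window whose
  lowest level is \<open>a\<close> may thus use \<open>n \<le> Suc a\<close> times. The sum over
  \<open>S\<close> is twice the total variation distance to the independent array, and each level
  adds at most \<open>e l\<close> to it.\<close>

lemma exists_nearly_independent_sets:
  fixes p e :: "nat \<Rightarrow> real"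
  assumes p: "\<And>l. 0 \<le> p l \<and> p l \<le> 1" and e: "\<And>l. 0 < e l"
  shows "\<exists>F. (\<forall>l. F l \<in> sets M) \<and> (\<forall>l. prob (F l) \<le> p l + e l) \<and>
    (\<forall>a b n. n \<le> Suc a \<longrightarrow>
      (\<Sum>S\<in>Pow ({a..<b} \<times> {..<n}). \<bar>prob {x \<in> space M. names T F ({a..<b} \<times> {..<n}) x = S}
         - bernoulli_weight p ({a..<b} \<times> {..<n}) S\<bar>) \<le> (\<Sum>l\<in>{a..<b}. e l))"
proof -
  \<comment> \<open>The errors add up over all patterns. Levels up to \<open>l\<close>, over at most
    \<open>l + 1\<close> times, have at most \<open>Suc l * Suc l\<close> cells and hence at most
    \<open>2 ^ (Suc l * Suc l)\<close> patterns.\<close>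
  define \<eta> where "\<eta> l = e l / 2 ^ (Suc l * Suc l)" for l
  have \<eta>: "\<eta> l > 0" "\<eta> l \<le> e l" for l
  proof -
    have "1 \<le> (2::real) ^ (Suc l * Suc l)" by (rule one_le_power) simp
    then show "\<eta> l \<le> e l"
      using e[of l] unfolding \<eta>_def by (simp add: divide_le_eq mult_le_cancel_left1 del: mult_Suc mult_Suc_right)
  qed (use e in \<open>simp add: \<eta>_def\<close>)
  \<comment> \<open>\<open>R\<close> ranges over all sets of earlier levels and times up to
    \<open>l\<close>, so that the new row can be added to any window that ends just below
    it.\<close>
  let ?P = "\<lambda>(F :: nat \<Rightarrow> 'a set) (l :: nat) r. (\<forall>i<l. F i \<in> sets M) \<longrightarrow> r \<in> sets M \<and>
    (\<forall>n\<le>Suc l. \<forall>R\<subseteq>{..<l} \<times> {..<Suc l}. \<forall>S\<subseteq>R. \<forall>S'\<subseteq>{..<n}.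
      \<bar>prob ({x \<in> space M. names T F R x = S} \<inter> {x \<in> space M. \<forall>j<n. (T ^^ j) x \<in> r \<longleftrightarrow> j \<in> S'})
       - prob {x \<in> space M. names T F R x = S} * (p l ^ card S' * (1 - p l) ^ card ({..<n} - S'))\<bar> \<le> \<eta> l)"
  have "\<exists>F. \<forall>l. ?P F l (F l)"
  proof (rule dependent_wellorder_choice[where P = ?P])
    show "?P f l r = ?P g l r" if "\<And>y. y < l \<Longrightarrow> f y = g y" for f g :: "nat \<Rightarrow> 'a set" and l r
    proof -
      have "names T f R = names T g R" if "R \<subseteq> {..<l} \<times> {..<Suc l}" for R
        using that \<open>\<And>y. y < l \<Longrightarrow> f y = g y\<close> by (auto simp: names_def fun_eq_iff)
      then show ?thesis using that by (simp cong: conj_cong imp_cong)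
    qed
  next
    fix l :: nat and F :: "nat \<Rightarrow> 'a set"
    show "\<exists>r. ?P F l r"
    proof (cases "\<forall>i<l. F i \<in> sets M")
      case True
      define D where "D = {..<l} \<times> {..<Suc l}"
      define \<A> where "\<A> = (\<lambda>(R, S). {x \<in> space M. names T F R x = S}) ` (Pow D \<times> Pow D)"
      have "finite \<A>" unfolding \<A>_def D_def by auto
      moreover have "\<A> \<subseteq> sets M"
      proof -
        have "{x \<in> space M. names T F R x = S} \<in> sets M" if "R \<subseteq> D" for R S
          using that True by (intro names_sets) (auto simp: D_def intro: finite_subset)
        then show ?thesis by (auto simp: \<A>_def)
      qed
      ultimately obtain r where r: "r \<in> sets M" "\<forall>n\<le>Suc l. \<forall>A\<in>\<A>. \<forall>S\<subseteq>{..<n}.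
        \<bar>prob (A \<inter> {x \<in> space M. \<forall>j<n. (T ^^ j) x \<in> r \<longleftrightarrow> j \<in> S}) - prob A * (p l ^ card S * (1 - p l) ^ card ({..<n} - S))\<bar> \<le> \<eta> l"
        using exists_nearly_iid_set[of \<A> "p l" "\<eta> l" "Suc l"] conjunct1[OF p[of l]] conjunct2[OF p[of l]] \<eta>(1)[of l]
        by (elim meta_impE bexE) assumption+
      have "{x \<in> space M. names T F R x = S} \<in> \<A>" if "R \<subseteq> {..<l} \<times> {..<Suc l}" "S \<subseteq> R" for R S
        unfolding \<A>_def D_def using that by (intro image_eqI[of _ _ "(R, S)"]) auto
      then show ?thesis using r by (intro exI[of _ r] impI conjI) simp_all
    qed auto
  qed
  then obtain F where F0: "\<And>l. ?P F l (F l)" by blast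
  have FM[measurable]: "F l \<in> sets M" for l
    by (induction l rule: less_induct) (use F0 in auto)
  have F: "\<bar>prob ({x \<in> space M. names T F R x = S} \<inter> {x \<in> space M. \<forall>j<n. (T ^^ j) x \<in> F l \<longleftrightarrow> j \<in> S'})
       - prob {x \<in> space M. names T F R x = S} * (p l ^ card S' * (1 - p l) ^ card ({..<n} - S'))\<bar> \<le> \<eta> l"
    if "n \<le> Suc l" "R \<subseteq> {..<l} \<times> {..<Suc l}" "S \<subseteq> R" "S' \<subseteq> {..<n}" for n l R S S'
    using F0[of l] FM that by blast
  have first: "prob (F l) \<le> p l + e l" for l
  proof -
    have "{x \<in> space M. names T F {} x = {}} = space M" by (simp add: names_def)
    moreover have "space M \<inter> {x \<in> space M. x \<in> F l} = F l" using sets.sets_into_space[OF FM] by auto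
    ultimately show ?thesis using F[of 1 l "{}" "{}" "{0}"] \<eta>[of l] by (auto simp: prob_space)
  qed
  have "(\<Sum>S\<in>Pow ({a..<b} \<times> {..<n}). \<bar>prob {x \<in> space M. names T F ({a..<b} \<times> {..<n}) x = S}
         - bernoulli_weight p ({a..<b} \<times> {..<n}) S\<bar>) \<le> (\<Sum>l\<in>{a..<b}. e l)" if n: "n \<le> Suc a" for a b n
  proof (induction b)
    case 0
    then show ?case by (simp add: names_def bernoulli_weight_def prob_space)
  next
    case (Suc b)
    show ?case
    proof (cases "a \<le> b")
      case False
      then have "{a..<Suc b} = {}" by simp
      then show ?thesis by (simp add: names_def bernoulli_weight_def prob_space)
    next
      case True
      define R where "R = {a..<b} \<times> {..<n}"
      define C where "C = {b} \<times> {..<n}"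
      have RC: "{a..<Suc b} \<times> {..<n} = R \<union> C" "R \<inter> C = {}" "finite R" "finite C"
        using True by (auto simp: R_def C_def)
      define \<mu> where "\<mu> S = prob {x \<in> space M. names T F R x = S}" for S
      have row: "\<bar>prob {x \<in> space M. names T F (R \<union> C) x = S \<union> S'} - \<mu> S * bernoulli_weight p C S'\<bar> \<le> \<eta> b"
        if S: "S \<subseteq> R" and S': "S' \<subseteq> C" for S S'
      proof -
        define s where "s = snd ` S'"
        have s: "S' = {b} \<times> s" "s \<subseteq> {..<n}" using S' by (force simp: s_def C_def)+
        have "x \<in> {x \<in> space M. names T F (R \<union> C) x = S \<union> S'} \<longleftrightarrow>
          x \<in> {x \<in> space M. names T F R x = S} \<inter> {x \<in> space M. \<forall>j<n. (T ^^ j) x \<in> F b \<longleftrightarrow> j \<in> s}" for x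
        proof -
          have "names T F (R \<union> C) x = names T F R x \<union> names T F C x" by (auto simp: names_def)
          moreover have "names T F R x \<subseteq> R" "names T F C x \<subseteq> C" by (auto simp: names_def)
          ultimately have "names T F (R \<union> C) x = S \<union> S' \<longleftrightarrow> names T F R x = S \<and> names T F C x = S'"
            using RC(2) S S' by blast
          moreover have "names T F C x = S' \<longleftrightarrow> (\<forall>j<n. (T ^^ j) x \<in> F b \<longleftrightarrow> j \<in> s)"
          proof -
            have "names T F C x = {b} \<times> {j \<in> {..<n}. (T ^^ j) x \<in> F b}" by (auto simp: names_def C_def)
            then have "names T F C x = S' \<longleftrightarrow> {j \<in> {..<n}. (T ^^ j) x \<in> F b} = s"
              unfolding s(1) by (simp add: times_eq_iff) blast
            then show ?thesis using s(2) by auto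
          qed
          ultimately show ?thesis by auto
        qed
        then have "{x \<in> space M. names T F (R \<union> C) x = S \<union> S'} =
          {x \<in> space M. names T F R x = S} \<inter> {x \<in> space M. \<forall>j<n. (T ^^ j) x \<in> F b \<longleftrightarrow> j \<in> s}" by (rule set_eqI)
        moreover have "bernoulli_weight p C S' = p b ^ card s * (1 - p b) ^ card ({..<n} - s)"
          unfolding s(1) C_def by (rule bernoulli_weight_row[OF s(2)])
        moreover have "R \<subseteq> {..<b} \<times> {..<Suc b}" using n True by (auto simp: R_def)
        ultimately show ?thesis using F[of n b R S s] n True S s(2) by (simp add: \<mu>_def)
      qed
      have bw: "bernoulli_weight p (R \<union> C) (S \<union> S') = bernoulli_weight p R S * bernoulli_weight p C S'"
        if "S \<subseteq> R" "S' \<subseteq> C" for S S' using RC that by (intro bernoulli_weight_Un) auto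
      have "(\<Sum>S\<in>Pow (R \<union> C). \<bar>prob {x \<in> space M. names T F (R \<union> C) x = S} - bernoulli_weight p (R \<union> C) S\<bar>)
        = (\<Sum>S\<in>Pow R. \<Sum>S'\<in>Pow C. \<bar>prob {x \<in> space M. names T F (R \<union> C) x = S \<union> S'} - bernoulli_weight p (R \<union> C) (S \<union> S')\<bar>)"
        using RC by (intro sum_Pow_disjoint_Un) auto
      \<comment> \<open>Compared through \<open>\<mu> S * bernoulli_weight p C S'\<close>: the new
        row costs \<open>\<eta> b\<close> per pattern, while the previous error is merely
        redistributed, because the weights of the row sum to 1.\<close>
      also have "\<dots> \<le> (\<Sum>S\<in>Pow R. \<Sum>S'\<in>Pow C. \<eta> b + \<bar>\<mu> S - bernoulli_weight p R S\<bar> * bernoulli_weight p C S')"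
      proof (intro sum_mono)
        fix S S' assume S: "S \<in> Pow R" "S' \<in> Pow C"
        have nn: "0 \<le> bernoulli_weight p C S'" using p by (rule bernoulli_weight_nonneg)
        have "\<bar>prob {x \<in> space M. names T F (R \<union> C) x = S \<union> S'} - bernoulli_weight p (R \<union> C) (S \<union> S')\<bar>
          \<le> \<bar>prob {x \<in> space M. names T F (R \<union> C) x = S \<union> S'} - \<mu> S * bernoulli_weight p C S'\<bar>
            + \<bar>\<mu> S * bernoulli_weight p C S' - bernoulli_weight p R S * bernoulli_weight p C S'\<bar>"
          using S bw[of S S'] by simp
        also have "\<bar>\<mu> S * bernoulli_weight p C S' - bernoulli_weight p R S * bernoulli_weight p C S'\<bar>
          = \<bar>\<mu> S - bernoulli_weight p R S\<bar> * bernoulli_weight p C S'"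
          using nn by (simp add: abs_mult flip: left_diff_distrib)
        finally show "\<bar>prob {x \<in> space M. names T F (R \<union> C) x = S \<union> S'} - bernoulli_weight p (R \<union> C) (S \<union> S')\<bar>
          \<le> \<eta> b + \<bar>\<mu> S - bernoulli_weight p R S\<bar> * bernoulli_weight p C S'"
          using row[of S S'] S by simp
      qed
      also have "\<dots> = real (2 ^ card R * 2 ^ card C) * \<eta> b + (\<Sum>S\<in>Pow R. \<bar>\<mu> S - bernoulli_weight p R S\<bar>)"
        using RC by (simp add: sum.distrib sum_distrib_left[symmetric] sum_bernoulli_weight card_Pow)
      also have "real (2 ^ card R * 2 ^ card C) * \<eta> b \<le> e b"
      proof -
        have "card R + card C = (b - a + 1) * n" by (simp add: R_def C_def)
        also have "\<dots> \<le> Suc b * Suc b" using n True by (intro mult_mono) auto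
        finally have "real (2 ^ card R * 2 ^ card C) \<le> 2 ^ (Suc b * Suc b)"
          unfolding power_add[symmetric] by (simp add: power_increasing del: mult_Suc mult_Suc_right)
        then have "real (2 ^ card R * 2 ^ card C) * \<eta> b \<le> 2 ^ (Suc b * Suc b) * \<eta> b"
          using \<eta>(1)[of b] by (intro mult_right_mono) auto
        then show ?thesis by (simp add: \<eta>_def)
      qed
      also have "(\<Sum>S\<in>Pow R. \<bar>\<mu> S - bernoulli_weight p R S\<bar>) \<le> (\<Sum>l\<in>{a..<b}. e l)"
        using Suc by (simp add: R_def \<mu>_def)
      finally show ?thesis using True RC(1) by (simp add: add.commute)
    qed
  qed
  then show ?thesis using first FM by blast
qed

end

section \<open>Pure jump paths and the Skorokhod distance\<close>

text \<open>A jump of size 0 stands for an absent point, so a random set of jumps can be indexed by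
  all of \<open>nat\<close>.\<close>

definition jump_path :: "(nat \<Rightarrow> real) \<Rightarrow> (nat \<Rightarrow> real) \<Rightarrow> real \<Rightarrow> real" where
  "jump_path x \<tau> t = (\<Sum>y. x y * of_bool (\<tau> y \<le> t))"

lemma summable_jumps:
  fixes x :: "nat \<Rightarrow> real"
  assumes "summable (\<lambda>y. \<bar>x y\<bar>)"
  shows "summable (\<lambda>y. x y * of_bool (P y))"
  by (rule summable_comparison_test'[OF assms, of 0]) auto

text \<open>Dominated convergence for series (Tannery), in a form that covers right limits, left
  limits and the exhaustion by blocks.\<close>

lemma tendsto_suminf_indicators:
  fixes x :: "nat \<Rightarrow> real"
  assumes x: "summable (\<lambda>y. \<bar>x y\<bar>)" and F: "F \<noteq> bot"
    and P: "\<And>y. x y \<noteq> 0 \<Longrightarrow> \<forall>\<^sub>F t in F. P y t \<longleftrightarrow> Q y"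
  shows "((\<lambda>t. \<Sum>y. x y * of_bool (P y t)) \<longlongrightarrow> (\<Sum>y. x y * of_bool (Q y))) F"
proof -
  have "((\<lambda>t. x y * of_bool (P y t)) \<longlongrightarrow> x y * of_bool (Q y)) F" for y
  proof (cases "x y = 0")
    case False
    from P[OF this] show ?thesis
      by (intro tendsto_eventually) (auto elim: eventually_mono)
  qed simp
  moreover have "\<forall>\<^sub>F (y, t) in at_top \<times>\<^sub>F F. norm (x y * of_bool (P y t)) \<le> \<bar>x y\<bar>"
    by (intro always_eventually) auto
  ultimately show ?thesis
    using tannerys_theorem[of "\<lambda>y t. x y * of_bool (P y t)" "\<lambda>y. x y * of_bool (Q y)" F "\<lambda>y. \<bar>x y\<bar>"] x F
    by blast
qed

lemma jump_path_in_D01: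
  assumes x: "summable (\<lambda>y. \<bar>x y\<bar>)"
  shows "jump_path x \<tau> \<in> D01"
proof -
  have "(jump_path x \<tau> \<longlongrightarrow> jump_path x \<tau> t) (at_right t)" for t
    unfolding jump_path_def
  proof (rule tendsto_suminf_indicators[OF x])
    show "\<forall>\<^sub>F s in at_right t. (\<tau> y \<le> s) = (\<tau> y \<le> t)" for y
    proof (cases "\<tau> y \<le> t")
      case True
      then show ?thesis by (auto simp: eventually_at_filter)
    next
      case False
      then have "\<forall>\<^sub>F s in at_right t. s < \<tau> y"
        by (intro eventually_at_right_less[THEN eventually_mono] order_tendstoD(2)[OF tendsto_ident_at]) auto
      then show ?thesis using False by (auto elim: eventually_mono)
    qed
  qed simp
  moreover have "(jump_path x \<tau> \<longlongrightarrow> (\<Sum>y. x y * of_bool (\<tau> y < t))) (at_left t)" for t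
    unfolding jump_path_def
  proof (rule tendsto_suminf_indicators[OF x])
    show "\<forall>\<^sub>F s in at_left t. (\<tau> y \<le> s) = (\<tau> y < t)" for y
    proof (cases "\<tau> y < t")
      case True
      then have "\<forall>\<^sub>F s in at_left t. \<tau> y < s"
        by (rule order_tendstoD(1)[OF tendsto_ident_at])
      then show ?thesis using True by (auto elim: eventually_mono)
    next
      case False
      then show ?thesis by (auto simp: eventually_at_filter)
    qed
  qed simp
  ultimately show ?thesis unfolding D01_def by blast
qed

lemma J1_dist_le:
  assumes r: "r \<in> time_changes" and 1: "\<And>t. t \<in> {0..1} \<Longrightarrow> \<bar>r t - t\<bar> \<le> e"
    and 2: "\<And>t. t \<in> {0..1} \<Longrightarrow> \<bar>x t - y (r t)\<bar> \<le> e"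
  shows "J1_dist x y \<le> e"
proof -
  let ?h = "\<lambda>r. max (SUP t\<in>{0..1}. \<bar>r t - t\<bar>) (SUP t\<in>{0..1}. \<bar>x t - y (r t)\<bar>)"
  \<comment> \<open>A real infimum lies below its terms only if these are bounded below. The first
    supremum is bounded and at least 0, its term at \<open>t = 0\<close>; about the second one
    nothing needs to be known, as the maximum dominates the first.\<close>
  have "0 \<le> ?h r" if "r \<in> time_changes" for r
  proof -
    have "\<bar>r t - t\<bar> \<le> 1" if t: "t \<in> {0..1}" for t
    proof -
      have "r 0 \<le> r t" "r t \<le> r 1"
        using \<open>r \<in> time_changes\<close> t strict_mono_on_leD[of "{0..1}" r 0 t] strict_mono_on_leD[of "{0..1}" r t 1]
        by (auto simp: time_changes_def)
      then show ?thesis using \<open>r \<in> time_changes\<close> t unfolding time_changes_def by auto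
    qed
    then have "\<bar>r 0 - 0\<bar> \<le> (SUP t\<in>{0..1}. \<bar>r t - t\<bar>)"
      by (intro cSUP_upper2[of _ _ 0] bdd_aboveI2[of _ _ 1]) auto
    then show ?thesis by simp
  qed
  then have "J1_dist x y \<le> ?h r"
    unfolding J1_dist_def by (intro cINF_lower[OF bdd_belowI2[of _ 0]] r) auto
  also have "\<dots> \<le> e"
    using 1 2 by (intro max.boundedI cSUP_least) auto
  finally show ?thesis .
qed

text \<open>The time change is the identity plus a tent of height \<open>d y\<close> at each
  \<open>\<tau> y\<close>. Tents of half-width \<open>w\<close> vanish at the other times and at 0
  and 1, and their slopes are at most \<open>\<bar>d y\<bar> / w\<close>, so a total height below
  \<open>w\<close> keeps the map strictly increasing.\<close>

lemma exists_time_change: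
  fixes \<tau> :: "nat \<Rightarrow> real"
  assumes Y: "finite Y" and inj: "inj_on \<tau> Y" and \<tau>: "\<And>y. y \<in> Y \<Longrightarrow> \<tau> y \<in> {0<..<1}"
  shows "\<exists>w>0. \<forall>d. (\<Sum>y\<in>Y. \<bar>d y\<bar>) < w \<longrightarrow>
    (\<exists>r\<in>time_changes. (\<forall>y\<in>Y. r (\<tau> y) = \<tau> y + d y) \<and> (\<forall>t. \<bar>r t - t\<bar> \<le> (\<Sum>y\<in>Y. \<bar>d y\<bar>)))"
proof -
  \<comment> \<open>Distances between the times and to both ends; the element 1 gives a minimum when
    \<open>Y\<close> is empty.\<close>
  define A where "A = insert 1 ((\<lambda>y. \<tau> y) ` Y \<union> (\<lambda>y. 1 - \<tau> y) ` Y \<union> (\<lambda>(y, z). \<bar>\<tau> y - \<tau> z\<bar>) ` {(y, z) \<in> Y \<times> Y. y \<noteq> z})"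
  have finA: "finite A" using Y unfolding A_def
    by (intro finite.insertI finite_UnI finite_imageI finite_subset[of "{(y, z) \<in> Y \<times> Y. y \<noteq> z}" "Y \<times> Y"]) auto
  define w where "w = Min A"
  have "\<forall>a\<in>A. a > 0" using \<tau> inj unfolding A_def by (auto simp: inj_on_def)
  then have w: "w > 0" unfolding w_def using finA by (subst Min_gr_iff) (auto simp: A_def)
  have wA: "w \<le> a" if "a \<in> A" for a unfolding w_def using finA that by simp
  have w1: "w \<le> \<tau> y" "w \<le> 1 - \<tau> y" if "y \<in> Y" for y using that by (auto intro!: wA simp: A_def)
  have w2: "w \<le> \<bar>\<tau> y - \<tau> z\<bar>" if "y \<in> Y" "z \<in> Y" "y \<noteq> z" for y z
    using that by (intro wA) (auto simp: A_def intro!: image_eqI[of _ _ "(y, z)"])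
  define tent where "tent c t = max 0 (1 - \<bar>t - c\<bar> / w)" for c t :: real
  have tent_bounds: "0 \<le> tent c t" "tent c t \<le> 1" for c t
    using w by (auto simp: tent_def)
  have tent_0: "tent c t = 0" if "w \<le> \<bar>t - c\<bar>" for c t
    using that w by (simp add: tent_def)
  have tent_lip: "\<bar>tent c t - tent c s\<bar> \<le> \<bar>t - s\<bar> / w" for c s t
  proof -
    have "\<bar>tent c t - tent c s\<bar> \<le> \<bar>\<bar>t - c\<bar> / w - \<bar>s - c\<bar> / w\<bar>" unfolding tent_def by linarith
    also have "\<dots> = \<bar>\<bar>t - c\<bar> - \<bar>s - c\<bar>\<bar> / w" using w by (simp flip: diff_divide_distrib)
    also have "\<dots> \<le> \<bar>t - s\<bar> / w" using w by (intro divide_right_mono) auto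
    finally show ?thesis .
  qed
  show ?thesis
  proof (intro exI[of _ w] conjI allI impI w)
    fix d :: "nat \<Rightarrow> real"
    assume d: "(\<Sum>y\<in>Y. \<bar>d y\<bar>) < w"
    define r where "r t = t + (\<Sum>y\<in>Y. d y * tent (\<tau> y) t)" for t
    have "r s < r t" if "s < t" for s t
    proof -
      have "\<bar>(\<Sum>y\<in>Y. d y * tent (\<tau> y) t) - (\<Sum>y\<in>Y. d y * tent (\<tau> y) s)\<bar> \<le> (\<Sum>y\<in>Y. \<bar>d y\<bar> * (\<bar>t - s\<bar> / w))"
        unfolding sum_subtractf[symmetric] right_diff_distrib[symmetric]
        by (rule order_trans[OF sum_abs sum_mono], unfold abs_mult) (intro mult_left_mono tent_lip abs_ge_zero)
      also have "\<dots> = (\<Sum>y\<in>Y. \<bar>d y\<bar>) * ((t - s) / w)"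
        unfolding sum_distrib_right[symmetric] using that by simp
      also have "\<dots> < w * ((t - s) / w)" using d that w by (intro mult_strict_right_mono) auto
      also have "\<dots> = t - s" using w by simp
      finally show ?thesis unfolding r_def by linarith
    qed
    moreover have "continuous_on {0..1} r"
      unfolding r_def tent_def by (intro continuous_intros) (use w in auto)
    moreover have "r 0 = 0" "r 1 = 1"
    proof -
      have "w \<le> \<bar>0 - \<tau> y\<bar>" "w \<le> \<bar>1 - \<tau> y\<bar>" if "y \<in> Y" for y
        using w1[OF that] \<tau>[OF that] by auto
      then show "r 0 = 0" "r 1 = 1" unfolding r_def by (simp_all add: tent_0)
    qed
    ultimately have "r \<in> time_changes" by (auto simp: time_changes_def strict_mono_on_def)
    moreover have "r (\<tau> y) = \<tau> y + d y" if "y \<in> Y" for y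
    proof -
      have "(\<Sum>z\<in>Y. d z * tent (\<tau> z) (\<tau> y)) = (\<Sum>z\<in>Y. if z = y then d y else 0)"
      proof (rule sum.cong)
        fix z assume "z \<in> Y"
        then show "d z * tent (\<tau> z) (\<tau> y) = (if z = y then d y else 0)"
          using w2[of y z] that tent_0[of "\<tau> y" "\<tau> z"] by (cases "z = y") (auto simp: tent_def)
      qed simp
      then show ?thesis using that Y by (simp add: r_def)
    qed
    moreover have "\<bar>r t - t\<bar> \<le> (\<Sum>y\<in>Y. \<bar>d y\<bar>)" for t
      unfolding r_def using tent_bounds
      by (auto intro!: order_trans[OF sum_abs sum_mono] mult_left_le simp: abs_mult)
    ultimately show "\<exists>r\<in>time_changes. (\<forall>y\<in>Y. r (\<tau> y) = \<tau> y + d y) \<and> (\<forall>t. \<bar>r t - t\<bar> \<le> (\<Sum>y\<in>Y. \<bar>d y\<bar>))"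
      by blast
  qed
qed

text \<open>The nonzero ones among the first \<open>m\<close> jumps are aligned by a time change.
  The error is \<open>e\<close> for their sizes, \<open>2 * e\<close> for the tails of
  \<open>x\<close> and of the dominated \<open>x'\<close>, and \<open>e\<close> for
  \<open>z\<close>. One threshold on \<open>n\<close> serves all \<open>z\<close> near the
  approximation, as the oscillation estimate later requires.\<close>

lemma jump_path_J1_approximation:
  fixes x :: "nat \<Rightarrow> real" and x' :: "nat \<Rightarrow> nat \<Rightarrow> real"
  assumes x: "summable (\<lambda>y. \<bar>x y\<bar>)"
    and inj: "inj_on \<tau> {y. x y \<noteq> 0}" and \<tau>: "\<And>y. x y \<noteq> 0 \<Longrightarrow> \<tau> y \<in> {0<..<1}"
    and le: "\<And>n y. \<bar>x' n y\<bar> \<le> \<bar>x y\<bar>"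
    and lim: "\<And>y. (\<lambda>n. x' n y) \<longlonglongrightarrow> x y" and lim_\<tau>: "\<And>y. x y \<noteq> 0 \<Longrightarrow> (\<lambda>n. \<tau>' n y) \<longlonglongrightarrow> \<tau> y"
    and e: "0 < e"
  shows "\<forall>\<^sub>F n in sequentially. \<forall>z. (\<forall>t\<in>{0..1}. \<bar>z t - jump_path (x' n) (\<tau>' n) t\<bar> \<le> e) \<longrightarrow>
    J1_dist (jump_path x \<tau>) z \<le> 4 * e"
proof -
  have x': "summable (\<lambda>y. \<bar>x' n y\<bar>)" for n
    by (rule summable_comparison_test'[OF x, of 0]) (auto simp: le)
  obtain m where m: "(\<Sum>y. \<bar>x (y + m)\<bar>) < e"
  proof -
    have "(\<lambda>m. \<Sum>y. \<bar>x (y + m)\<bar>) \<longlonglongrightarrow> 0"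
      by (rule suminf_exist_split2[OF x])
    then have "\<forall>\<^sub>F m in sequentially. (\<Sum>y. \<bar>x (y + m)\<bar>) < e" using e by (rule order_tendstoD)
    then show ?thesis using that eventually_happens'[OF sequentially_bot] by blast
  qed
  \<comment> \<open>Only nonzero jumps have times that are distinct, interior and
    convergent.\<close>
  define Y where "Y = {y. y < m \<and> x y \<noteq> 0}"
  have Y: "finite Y" "inj_on \<tau> Y" "\<And>y. y \<in> Y \<Longrightarrow> \<tau> y \<in> {0<..<1}"
    using inj \<tau> by (auto simp: Y_def inj_on_def)
  obtain w where w: "w > 0" and r: "\<And>d. (\<Sum>y\<in>Y. \<bar>d y\<bar>) < w \<Longrightarrow>
    (\<exists>r\<in>time_changes. (\<forall>y\<in>Y. r (\<tau> y) = \<tau> y + d y) \<and> (\<forall>t. \<bar>r t - t\<bar> \<le> (\<Sum>y\<in>Y. \<bar>d y\<bar>)))"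
    using exists_time_change[OF Y] by blast
  have "(\<lambda>n. \<Sum>y\<in>Y. \<bar>\<tau>' n y - \<tau> y\<bar>) \<longlonglongrightarrow> (\<Sum>y\<in>Y. \<bar>\<tau> y - \<tau> y\<bar>)"
    by (intro tendsto_intros lim_\<tau>) (auto simp: Y_def)
  then have ev1: "\<forall>\<^sub>F n in sequentially. (\<Sum>y\<in>Y. \<bar>\<tau>' n y - \<tau> y\<bar>) < min w e"
    using w e by (intro order_tendstoD(2)[of _ 0]) auto
  have "(\<lambda>n. \<Sum>y<m. \<bar>x y - x' n y\<bar>) \<longlonglongrightarrow> (\<Sum>y<m. \<bar>x y - x y\<bar>)"
    by (intro tendsto_intros lim)
  then have ev2: "\<forall>\<^sub>F n in sequentially. (\<Sum>y<m. \<bar>x y - x' n y\<bar>) < e"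
    using e by (intro order_tendstoD(2)[of _ 0]) auto
  show ?thesis using ev1 ev2
  proof eventually_elim
    case (elim n)
    define d where "d y = \<tau>' n y - \<tau> y" for y
    obtain r where rt: "r \<in> time_changes" and rd: "\<And>y. y \<in> Y \<Longrightarrow> r (\<tau> y) = \<tau>' n y"
      and rid: "\<And>t. \<bar>r t - t\<bar> \<le> e"
    proof -
      have s: "(\<Sum>y\<in>Y. \<bar>d y\<bar>) < w" "(\<Sum>y\<in>Y. \<bar>d y\<bar>) < e" using elim(1) by (simp_all add: d_def)
      obtain r where "r \<in> time_changes" "\<And>y. y \<in> Y \<Longrightarrow> r (\<tau> y) = \<tau> y + d y"
        "\<And>t. \<bar>r t - t\<bar> \<le> (\<Sum>y\<in>Y. \<bar>d y\<bar>)"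
        using r[OF s(1)] by blast
      with s(2) show ?thesis by (intro that[of r]) (auto simp: d_def intro: order_trans[OF _ less_imp_le])
    qed
    have rmono: "r s < r t \<longleftrightarrow> s < t" if "s \<in> {0..1}" "t \<in> {0..1}" for s t
      using rt that strict_mono_on_less[of "{0..1}" r s t] by (auto simp: time_changes_def)
    have rle: "r s \<le> r t \<longleftrightarrow> s \<le> t" if "s \<in> {0..1}" "t \<in> {0..1}" for s t
      using rmono[OF that(2) that(1)] by (metis linorder_not_less)
    have r01: "r t \<in> {0..1}" if "t \<in> {0..1}" for t
      using rt that rle[of t 1] rle[of 0 t] by (auto simp: time_changes_def)
    show ?case
    proof (intro allI impI J1_dist_le[OF rt])
      fix z t assume z: "\<forall>t\<in>{0..1}. \<bar>z t - jump_path (x' n) (\<tau>' n) t\<bar> \<le> e" and t: "t \<in> {0..1::real}"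
      show "\<bar>r t - t\<bar> \<le> 4 * e" using rid[of t] e by linarith
      define D where "D y = x y * of_bool (\<tau> y \<le> t) - x' n y * of_bool (\<tau>' n y \<le> r t)" for y
      have D_le: "\<bar>D y\<bar> \<le> 2 * \<bar>x y\<bar>" for y
        using le[of n y] by (auto simp: D_def)
      have D_sum: "summable (\<lambda>y. \<bar>D y\<bar>)"
        by (rule summable_comparison_test'[OF summable_mult[OF x, of 2], of 0]) (auto simp: D_le)
      have D_small: "\<bar>D y\<bar> \<le> \<bar>x y - x' n y\<bar>" if "y < m" for y
      proof (cases "x y = 0")
        case True
        then show ?thesis using le[of n y] by (simp add: D_def)
      next
        case False
        then have "y \<in> Y" using that by (simp add: Y_def)
        then have "\<tau>' n y \<le> r t \<longleftrightarrow> \<tau> y \<le> t"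
          using rle[of "\<tau> y" t] t Y(3)[of y] rd[of y] by simp
        then show ?thesis by (simp add: D_def)
      qed
      have "jump_path x \<tau> t - jump_path (x' n) (\<tau>' n) (r t) = (\<Sum>y. D y)"
        unfolding jump_path_def D_def by (rule suminf_diff[OF summable_jumps[OF x] summable_jumps[OF x']])
      also have "\<bar>\<dots>\<bar> \<le> (\<Sum>y. \<bar>D y\<bar>)" by (rule summable_rabs[OF D_sum])
      also have "\<dots> = (\<Sum>y. \<bar>D (y + m)\<bar>) + (\<Sum>y<m. \<bar>D y\<bar>)" by (rule suminf_split_initial_segment[OF D_sum])
      also have "(\<Sum>y. \<bar>D (y + m)\<bar>) \<le> (\<Sum>y. 2 * \<bar>x (y + m)\<bar>)"
        by (intro suminf_le D_le summable_mult summable_ignore_initial_segment[OF D_sum] summable_ignore_initial_segment[OF x])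
      also have "\<dots> = 2 * (\<Sum>y. \<bar>x (y + m)\<bar>)"
        by (intro suminf_mult summable_ignore_initial_segment[OF x])
      also have "(\<Sum>y<m. \<bar>D y\<bar>) \<le> (\<Sum>y<m. \<bar>x y - x' n y\<bar>)" by (intro sum_mono D_small) auto
      finally have "\<bar>jump_path x \<tau> t - jump_path (x' n) (\<tau>' n) (r t)\<bar> \<le> 3 * e"
        using m elim(2) by linarith
      then show "\<bar>jump_path x \<tau> t - z (r t)\<bar> \<le> 4 * e"
        using z r01[OF t] by (auto dest!: bspec[of _ _ "r t"])
    qed
  qed
qed

section \<open>The characteristic exponent\<close>

definition stable_integrand :: "real \<Rightarrow> complex \<Rightarrow> real \<Rightarrow> complex" where
  "stable_integrand a z g = 1 - exp (- (z * of_real (g powr (- a))))"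

text \<open>Laplace exponent at \<open>z\<close> of the sum of \<open>g powr (- a)\<close> over the
  points \<open>g\<close> of a unit-rate Poisson process on the half-line. For
  \<open>0 \<le> Re z\<close> it converges without compensator because \<open>a > 1\<close>.\<close>

definition stable_exponent :: "real \<Rightarrow> complex \<Rightarrow> complex" where
  "stable_exponent a z = (\<integral>g. indicator {0<..} g *\<^sub>R stable_integrand a z g \<partial>lborel)"

text \<open>The second bound holds because \<open>exp\<close> has derivative of norm at most 1 on
  the convex left half-plane.\<close>

lemma norm_one_minus_exp_le:
  fixes w :: complex
  assumes "0 \<le> Re w"
  shows "norm (1 - exp (- w)) \<le> 2" "norm (1 - exp (- w)) \<le> norm w"
proof -
  have "norm (1 - exp (- w)) \<le> norm (1::complex) + norm (exp (- w))" by (rule norm_triangle_ineq4)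
  also have "norm (exp (- w)) \<le> 1" using assms by simp
  finally show "norm (1 - exp (- w)) \<le> 2" by simp
  have "norm (exp 0 - exp (- w)) \<le> 1 * norm (0 - (- w))"
  proof (rule field_differentiable_bound[of "{z. Re z \<le> 0}" exp exp])
    show "convex {z. Re z \<le> 0}" by (rule convex_halfspace_Re_le)
    show "(exp has_field_derivative exp z) (at z within {z. Re z \<le> 0})" for z :: complex
      by (rule DERIV_subset[OF DERIV_exp]) auto
  qed (use assms in auto)
  then show "norm (1 - exp (- w)) \<le> norm w" by simp
qed

lemma stable_integrand_measurable [measurable]: "stable_integrand a z \<in> borel_measurable borel"
  unfolding stable_integrand_def by measurable

lemma norm_stable_integrand_le:
  assumes "0 \<le> Re z"
  shows "norm (stable_integrand a z g) \<le> 2" "norm (stable_integrand a z g) \<le> norm z * g powr (- a)"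
  using norm_one_minus_exp_le[of "z * of_real (g powr (- a))"] assms
  by (auto simp: stable_integrand_def norm_mult)

lemma powr_tail:
  fixes a N :: real
  assumes a: "1 < a" and N: "0 < N"
  shows "integrable lborel (\<lambda>g. indicator {N..} g * g powr (- a))"
    and "(\<integral>g. indicator {N..} g * g powr (- a) \<partial>lborel) = N powr (1 - a) / (a - 1)"
proof -
  have "(\<integral>\<^sup>+g. ennreal (g powr (- a)) * indicator {N..} g \<partial>lborel) = 0 - (- (N powr (1 - a) / (a - 1)))"
  proof (rule nn_integral_FTC_atLeast)
    fix x assume "N \<le> x"
    then have x: "0 < x" using N by simp
    show "((\<lambda>x. - (x powr (1 - a) / (a - 1))) has_real_derivative x powr (- a)) (at x)"
    proof -
      have "- ((1 - a) * X / (a - 1)) = X" for X using a by (simp add: field_simps)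
      then show ?thesis
        using DERIV_minus[OF DERIV_cdivide[OF has_real_derivative_powr[OF x, of "1 - a"], of "a - 1"]] by simp
    qed
  next
    have "((\<lambda>x. - (x powr (1 - a) / (a - 1))) \<longlongrightarrow> - (0 / (a - 1))) at_top"
      using a by (intro tendsto_intros tendsto_neg_powr filterlim_ident) auto
    then show "((\<lambda>x. - (x powr (1 - a) / (a - 1))) \<longlongrightarrow> 0) at_top" by simp
  qed auto
  also have "(\<integral>\<^sup>+g. ennreal (g powr (- a)) * indicator {N..} g \<partial>lborel) = (\<integral>\<^sup>+g. ennreal (indicator {N..} g * g powr (- a)) \<partial>lborel)"
    by (intro nn_integral_cong) (auto simp: indicator_def)
  finally have "has_bochner_integral lborel (\<lambda>g. indicator {N..} g * g powr (- a)) (N powr (1 - a) / (a - 1))"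
    using a by (intro has_bochner_integral_nn_integral) auto
  then show "integrable lborel (\<lambda>g. indicator {N..} g * g powr (- a))"
    and "(\<integral>g. indicator {N..} g * g powr (- a) \<partial>lborel) = N powr (1 - a) / (a - 1)"
    by (auto simp: has_bochner_integral_iff)
qed

text \<open>Dominates the integrand for all \<open>z\<close> with \<open>0 \<le> Re z\<close> and
  \<open>norm z \<le> K\<close> at once: the constant bound near 0, the linear bound at
  infinity.\<close>

definition stable_majorant :: "real \<Rightarrow> real \<Rightarrow> real \<Rightarrow> real" where
  "stable_majorant a K g = 2 * indicator {0..1} g + K * (indicator {1..} g * g powr (- a))"

lemma integrable_stable_majorant: "1 < a \<Longrightarrow> integrable lborel (stable_majorant a K)"
  unfolding stable_majorant_def
  by (intro Bochner_Integration.integrable_add integrable_mult_right powr_tail) auto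

lemma stable_integrand_le_majorant:
  assumes "0 \<le> Re z" "norm z \<le> K"
  shows "norm (indicator {0<..} g *\<^sub>R stable_integrand a z g) \<le> stable_majorant a K g"
proof -
  have "norm z * g powr (- a) \<le> K * g powr (- a)" using assms by (intro mult_right_mono) auto
  moreover have "0 \<le> K" using assms norm_ge_zero order_trans by blast
  ultimately show ?thesis
    using norm_stable_integrand_le[OF assms(1), of a g]
    by (auto simp: stable_majorant_def indicator_def)
qed

lemma integrable_stable_integrand:
  assumes "1 < a" "0 \<le> Re z"
  shows "integrable lborel (\<lambda>g. indicator {0<..} g *\<^sub>R stable_integrand a z g)"
proof (rule Bochner_Integration.integrable_bound[OF integrable_stable_majorant[OF assms(1), of "norm z"]])
  show "AE g in lborel. norm (indicator {0<..} g *\<^sub>R stable_integrand a z g) \<le> norm (stable_majorant a (norm z) g)"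
    using stable_integrand_le_majorant[OF assms(2) order_refl]
    by (intro AE_I2, unfold real_norm_def) (meson abs_ge_self order_trans)
qed measurable

text \<open>Substitute \<open>c powr (1 / a) * g\<close> for \<open>g\<close>; the homogeneity of
  degree \<open>1 / a\<close> is the self-similarity of the stable law.\<close>

lemma stable_exponent_scale:
  assumes a: "1 < a" and c: "0 < c"
  shows "stable_exponent a (of_real c * z) = of_real (c powr (1 / a)) * stable_exponent a z"
proof -
  have "stable_exponent a (of_real c * z) =
    \<bar>c powr (1/a)\<bar> *\<^sub>R (\<integral>g. indicator {0<..} (0 + c powr (1/a) * g) *\<^sub>R stable_integrand a (of_real c * z) (0 + c powr (1/a) * g) \<partial>lborel)"
    unfolding stable_exponent_def by (rule lborel_integral_real_affine) (use c in simp)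
  also have "(\<integral>g. indicator {0<..} (0 + c powr (1/a) * g) *\<^sub>R stable_integrand a (of_real c * z) (0 + c powr (1/a) * g) \<partial>lborel)
    = stable_exponent a z"
    unfolding stable_exponent_def
  proof (rule Bochner_Integration.integral_cong[OF refl])
    fix g :: real
    have "0 < c powr (1/a) * g \<longleftrightarrow> 0 < g" using c by (simp add: zero_less_mult_iff)
    moreover have "of_real c * z * of_real ((c powr (1/a) * g) powr (- a)) = z * of_real (g powr (- a))" if "0 < g"
    proof -
      have "(c powr (1/a) * g) powr (- a) = (c powr (1/a)) powr (- a) * g powr (- a)"
        using that c by (simp add: powr_mult)
      also have "(c powr (1/a)) powr (- a) = inverse c" using a c by (simp add: powr_powr powr_minus)
      finally have eq: "c * (c powr (1/a) * g) powr (- a) = g powr (- a)" using c by simp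
      show ?thesis unfolding eq[symmetric] by simp
    qed
    ultimately have "stable_integrand a (of_real c * z) (0 + c powr (1/a) * g) = stable_integrand a z g" if "0 < g"
      unfolding stable_integrand_def add_0 using that by (simp only:)
    with \<open>0 < c powr (1/a) * g \<longleftrightarrow> 0 < g\<close> show "indicator {0<..} (0 + c powr (1/a) * g) *\<^sub>R stable_integrand a (of_real c * z) (0 + c powr (1/a) * g)
      = indicator {0<..} g *\<^sub>R stable_integrand a z g"
      by (cases "0 < g") (auto simp: indicator_def)
  qed
  finally show ?thesis by (simp add: scaleR_conv_of_real)
qed

text \<open>This is the number Gamma(1 - 1 / a).\<close>

definition stable_const :: "real \<Rightarrow> real" where
  "stable_const a = (\<integral>g. indicator {0<..} g * (1 - exp (- (g powr (- a)))) \<partial>lborel)"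

lemma stable_exponent_1: "stable_exponent a 1 = of_real (stable_const a)"
proof -
  have "indicator {0<..} g *\<^sub>R stable_integrand a 1 g = of_real (indicator {0<..} g * (1 - exp (- (g powr (- a)))))" for g
    by (simp add: stable_integrand_def scaleR_conv_of_real exp_of_real flip: of_real_minus)
  then show ?thesis unfolding stable_exponent_def stable_const_def by (simp only: integral_complex_of_real)
qed

lemma stable_const_pos:
  assumes a: "1 < a"
  shows "0 < stable_const a"
proof -
  let ?f = "\<lambda>g::real. indicator {0<..} g * (1 - exp (- (g powr (- a)))) :: real"
  have "complex_of_real (?f g) = indicator {0<..} g *\<^sub>R stable_integrand a 1 g" for g
    by (simp add: stable_integrand_def scaleR_conv_of_real exp_of_real flip: of_real_minus)
  then have "integrable lborel (\<lambda>g. complex_of_real (?f g))"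
    using integrable_stable_integrand[OF a, of 1] by (simp only: one_complex.simps zero_le_one)
  then have int: "integrable lborel ?f" by (simp only: complex_of_real_integrable_eq)
  have nn: "0 \<le> ?f g" for g by (auto simp: indicator_def)
  have "integral\<^sup>L lborel (\<lambda>g::real. indicator {0<..<1} g * (1 - exp (- 1))) \<le> stable_const a"
    unfolding stable_const_def
  proof (rule integral_mono_AE[OF _ int AE_I2])
    show "integrable lborel (\<lambda>g. indicator {0<..<1::real} g * (1 - exp (- 1::real)))" by auto
    fix g :: real
    show "indicator {0<..<1} g * (1 - exp (- 1)) \<le> ?f g"
    proof (cases "0 < g \<and> g < 1")
      case True
      then have "1 powr (-a) \<le> g powr (- a)" using a by (intro powr_mono2') auto
      then show ?thesis using True by (simp add: indicator_def)
    qed (use nn[of g] in \<open>auto simp: indicator_def\<close>)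
  qed
  moreover have "(\<integral>g. indicator {0<..<1::real} g * (1 - exp (- 1::real)) \<partial>lborel) = 1 - exp (- 1)" by simp
  moreover have "exp (- 1::real) < 1" by simp
  ultimately show ?thesis by linarith
qed

text \<open>Over the compact range from \<open>1 / (n + 1)\<close> to \<open>n + 1\<close> one may
  differentiate under the integral. The parts cut off are at most \<open>2 * l n\<close> plus a
  power tail, uniformly on small balls, so holomorphy passes to the limit.\<close>

lemma stable_exponent_holomorphic:
  assumes a: "1 < a"
  shows "stable_exponent a holomorphic_on {z. 0 < Re z}"
proof -
  define l where "l n = inverse (real (Suc n))" for n
  define u where "u n = real (Suc n)" for n
  have lu: "0 < l n" "l n \<le> u n" "0 < u n" for n
  proof -
    have "l n \<le> 1" "1 \<le> u n" by (simp_all add: l_def u_def inverse_le_1_iff)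
    then show "l n \<le> u n" by linarith
  qed (simp_all add: l_def u_def)
  define P where "P n z = integral (cbox (l n) (u n)) (stable_integrand a z)" for n z
  have cont: "continuous_on (cbox (l n) (u n)) (stable_integrand a z)" for n z
    unfolding stable_integrand_def using lu[of n] by (intro continuous_intros) auto
  have hol: "P n holomorphic_on {z. 0 < Re z}" for n
    unfolding P_def
  proof (rule leibniz_rule_holomorphic)
    show "((\<lambda>z. stable_integrand a z t) has_field_derivative of_real (t powr (- a)) * exp (- (z * of_real (t powr (- a))))) (at z within {z. 0 < Re z})" for z t
      unfolding stable_integrand_def by (auto intro!: derivative_eq_intros)
    show "stable_integrand a z integrable_on cbox (l n) (u n)" for z
      by (rule integrable_continuous[OF cont])
    show "continuous_on ({z. 0 < Re z} \<times> cbox (l n) (u n)) (\<lambda>(z, t). of_real (t powr (- a)) * exp (- (z * of_real (t powr (- a)))))"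
      unfolding case_prod_beta using lu[of n] by (intro continuous_intros) auto
    show "convex {z. 0 < Re z}" by (rule convex_halfspace_Re_gt)
  qed
  have P: "P n z = (\<integral>g. indicator {l n..u n} g *\<^sub>R stable_integrand a z g \<partial>lborel)" for n z
  proof -
    have "set_integrable lborel {l n..u n} (stable_integrand a z)"
      using cont[of n z] by (intro borel_integrable_atLeastAtMost') simp
    from set_borel_integral_eq_integral(2)[OF this] show ?thesis
      by (simp add: P_def set_lebesgue_integral_def)
  qed
  have bound: "norm (P n z - stable_exponent a z) \<le> 2 * l n + K * (u n powr (1 - a) / (a - 1))"
    if z: "0 \<le> Re z" "norm z \<le> K" for n z K
  proof -
    have K: "0 \<le> K" using z norm_ge_zero order_trans by blast
    have i1: "integrable lborel (\<lambda>g. indicator {l n..u n} g *\<^sub>R stable_integrand a z g)"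
      using cont[of n z] borel_integrable_atLeastAtMost'[of "l n" "u n" "stable_integrand a z"]
      by (simp add: set_integrable_def)
    have "P n z - stable_exponent a z = (\<integral>g. indicator {l n..u n} g *\<^sub>R stable_integrand a z g - indicator {0<..} g *\<^sub>R stable_integrand a z g \<partial>lborel)"
      unfolding P stable_exponent_def
      by (rule Bochner_Integration.integral_diff[symmetric, OF i1 integrable_stable_integrand[OF a z(1)]])
    also have "norm \<dots> \<le> (\<integral>g. 2 * indicator {0..l n} g + K * (indicator {u n..} g * g powr (- a)) \<partial>lborel)"
    proof (rule Bochner_Integration.integral_norm_bound_integral)
      show "integrable lborel (\<lambda>g. 2 * indicator {0..l n} g + K * (indicator {u n..} g * g powr (- a)))"
        using lu[of n] by (intro Bochner_Integration.integrable_add integrable_mult_right powr_tail a) auto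
      fix g :: real
      have "norm z * g powr (- a) \<le> K * g powr (- a)" using z by (intro mult_right_mono) auto
      then show "norm (indicator {l n..u n} g *\<^sub>R stable_integrand a z g - indicator {0<..} g *\<^sub>R stable_integrand a z g)
        \<le> 2 * indicator {0..l n} g + K * (indicator {u n..} g * g powr (- a))"
        using norm_stable_integrand_le[OF z(1), of a g] lu[of n] K
        by (auto simp: indicator_def)
    qed (use i1 integrable_stable_integrand[OF a z(1)] in auto)
    also have "\<dots> = 2 * l n + K * (u n powr (1 - a) / (a - 1))"
      using lu[of n] powr_tail[OF a lu(3)[of n]] by (subst Bochner_Integration.integral_add) auto
    finally show ?thesis .
  qed
  show ?thesis
  proof (rule holomorphic_uniform_sequence[OF _ hol])
    show "open {z. 0 < Re z}" by (rule open_halfspace_Re_gt)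
    fix z assume z: "z \<in> {z. 0 < Re z}"
    define d where "d = Re z / 2"
    have "d > 0" using z by (simp add: d_def)
    have sub: "0 < Re w" "norm w \<le> norm z + d" if "w \<in> cball z d" for w
    proof -
      have "\<bar>Re z - Re w\<bar> \<le> d" using that abs_Re_le_cmod[of "z - w"] by (simp add: dist_norm)
      then have "Re z - Re w \<le> Re z / 2" unfolding d_def by linarith
      then show "0 < Re w" using z by simp
      show "norm w \<le> norm z + d"
        using that norm_triangle_ineq2[of w z] by (simp add: dist_norm norm_minus_commute)
    qed
    have lim: "(\<lambda>n. 2 * l n + (norm z + d) * (u n powr (1 - a) / (a - 1))) \<longlonglongrightarrow> 2 * 0 + (norm z + d) * (0 / (a - 1))"
      unfolding l_def u_def using a
      by (intro tendsto_intros LIMSEQ_inverse_real_of_nat tendsto_neg_powr filterlim_compose[OF filterlim_real_sequentially filterlim_Suc]) auto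
    have "uniform_limit (cball z d) P (stable_exponent a) sequentially"
    proof (rule uniform_limitI)
      fix e :: real assume "0 < e"
      have "\<forall>\<^sub>F n in sequentially. 2 * l n + (norm z + d) * (u n powr (1 - a) / (a - 1)) < e"
        using lim \<open>0 < e\<close> by (intro order_tendstoD(2)[OF lim]) simp
      then show "\<forall>\<^sub>F n in sequentially. \<forall>w\<in>cball z d. dist (P n w) (stable_exponent a w) < e"
      proof eventually_elim
        case (elim n)
        then show ?case
          using bound[OF less_imp_le[OF sub(1)] sub(2)] unfolding dist_norm by (blast intro: le_less_trans)
      qed
    qed
    then show "\<exists>d>0. cball z d \<subseteq> {z. 0 < Re z} \<and> uniform_limit (cball z d) P (stable_exponent a) sequentially"
      using \<open>d > 0\<close> sub(1) by blast
  qed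
qed

text \<open>By scaling the identity holds on the positive axis, hence by analytic continuation on the half plane; its
boundary values give the exponent of the stable law.\<close>

lemma stable_exponent_right_half_plane:
  assumes a: "1 < a" and z: "0 < Re z"
  shows "stable_exponent a z = of_real (stable_const a) * z powr of_real (1 / a)"
proof -
  let ?S = "{z. 0 < Re z}"
  have real: "stable_exponent a (of_real c) - of_real (stable_const a) * of_real c powr of_real (1 / a) = 0" if "0 < c" for c
    using stable_exponent_scale[OF a that, of 1] that
    by (simp add: stable_exponent_1 powr_of_real del: of_real_divide)
  have hol: "(\<lambda>z. stable_exponent a z - of_real (stable_const a) * z powr of_real (1 / a)) holomorphic_on ?S"
    by (intro holomorphic_intros stable_exponent_holomorphic[OF a]) (auto simp: complex_nonpos_Reals_iff)
  have "1 islimpt (of_real ` {0<..} :: complex set)"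
  proof (rule islimpt_approachable[THEN iffD2], intro allI impI)
    fix e :: real assume "0 < e"
    then show "\<exists>x'\<in>of_real ` {0<..}. x' \<noteq> 1 \<and> dist x' (1::complex) < e"
      by (intro bexI[of _ "of_real (1 + e / 2)"] imageI) (auto simp: dist_norm)
  qed
  moreover have "complex_of_real ` {0<..} \<subseteq> ?S" by auto
  moreover have "stable_exponent a w - of_real (stable_const a) * w powr of_real (1 / a) = 0"
    if "w \<in> of_real ` {0<..}" for w
    using that by (elim imageE, simp only: greaterThan_iff real)
  ultimately have "stable_exponent a z - of_real (stable_const a) * z powr of_real (1 / a) = 0"
    using analytic_continuation[OF hol open_halfspace_Re_gt convex_connected[OF convex_halfspace_Re_gt], of "of_real ` {0<..}" 1 z] z
    by simp
  then show ?thesis by simp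
qed

text \<open>The imaginary axis bounds the half-plane, so the value is reached by dominated
  convergence along \<open>1 / (n + 1) + \<i> * s\<close>. The power is continuous at the limit,
  since its branch cut is the negative real axis.\<close>

lemma stable_exponent_imaginary_unit:
  assumes a: "1 < a" and s: "s = 1 \<or> s = - 1"
  shows "stable_exponent a (\<i> * of_real s) =
    of_real (stable_const a) * (of_real (cos (pi / (2 * a))) + \<i> * of_real (s * sin (pi / (2 * a))))"
proof -
  define z where "z n = of_real (inverse (real (Suc n))) + \<i> * of_real s" for n
  have z: "z \<longlonglongrightarrow> of_real 0 + \<i> * of_real s"
    unfolding z_def by (intro tendsto_intros LIMSEQ_inverse_real_of_nat)
  have Re: "0 < Re (z n)" for n by (simp add: z_def)
  have "(\<lambda>n. stable_exponent a (z n)) \<longlonglongrightarrow> stable_exponent a (\<i> * of_real s)"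
    unfolding stable_exponent_def
  proof (rule integral_dominated_convergence[where w = "stable_majorant a 2"])
    show "AE g in lborel. (\<lambda>n. indicator {0<..} g *\<^sub>R stable_integrand a (z n) g) \<longlonglongrightarrow> indicator {0<..} g *\<^sub>R stable_integrand a (\<i> * of_real s) g"
      unfolding stable_integrand_def using z by (intro AE_I2 tendsto_intros) simp
    fix n
    have "norm (z n) \<le> 2"
      using s norm_triangle_ineq[of "of_real (inverse (real (Suc n)))" "\<i> * of_real s"]
      by (auto simp: z_def norm_mult norm_inverse inverse_le_1_iff simp del: of_real_inverse intro: order_trans)
    then show "AE g in lborel. norm (indicator {0<..} g *\<^sub>R stable_integrand a (z n) g) \<le> stable_majorant a 2 g"
      using Re[of n] by (intro AE_I2 stable_integrand_le_majorant) auto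
  qed (auto intro: integrable_stable_majorant[OF a])
  moreover have "(\<lambda>n. stable_exponent a (z n)) \<longlonglongrightarrow> of_real (stable_const a) * (\<i> * of_real s) powr of_real (1 / a)"
    unfolding stable_exponent_right_half_plane[OF a Re]
    using z s by (intro tendsto_intros) (auto simp: complex_nonpos_Reals_iff)
  ultimately have "stable_exponent a (\<i> * of_real s) = of_real (stable_const a) * (\<i> * of_real s) powr of_real (1 / a)"
    by (rule LIMSEQ_unique)
  also have "(\<i> * of_real s) powr of_real (1 / a) = of_real (cos (pi / (2 * a))) + \<i> * of_real (s * sin (pi / (2 * a)))"
  proof -
    have "(\<i> * of_real s) powr of_real (1 / a) = exp (\<i> * of_real (s * (pi / (2 * a))))"
      using s by (auto simp: powr_def field_simps)
    also have "\<dots> = of_real (cos (s * (pi / (2 * a)))) + \<i> * of_real (sin (s * (pi / (2 * a))))"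
      by (simp only: cis_conv_exp[symmetric] cis.code complex_eq_iff) simp
    finally show ?thesis using s by auto
  qed
  finally show ?thesis .
qed

lemma stable_exponent_imaginary:
  assumes a: "1 < a"
  shows "stable_exponent a (\<i> * of_real \<theta>) = of_real (stable_const a * \<bar>\<theta>\<bar> powr (1 / a)) *
    (of_real (cos (pi / (2 * a))) + \<i> * of_real (sgn \<theta> * sin (pi / (2 * a))))"
proof (cases "\<theta> = 0")
  case True
  then show ?thesis by (simp add: stable_exponent_def stable_integrand_def)
next
  case False
  then have "\<i> * of_real \<theta> = of_real \<bar>\<theta>\<bar> * (\<i> * of_real (sgn \<theta>))"
    by (metis abs_mult_sgn mult.left_commute of_real_mult)
  moreover have "0 < \<bar>\<theta>\<bar>" "sgn \<theta> = 1 \<or> sgn \<theta> = - 1" using False by (auto simp: sgn_if)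
  ultimately show ?thesis
    using stable_exponent_scale[OF a, of "\<bar>\<theta>\<bar>" "\<i> * of_real (sgn \<theta>)"] stable_exponent_imaginary_unit[OF a, of "sgn \<theta>"]
    by (simp only: of_real_mult mult_ac)
qed

text \<open>Made for the blocks: the points of one sign in the \<open>m\<close>-th pair of blocks
  sit at \<open>m\<close> plus a uniform variable, so the blocks of one sign together exhaust an
  integral over the half-line.\<close>

lemma sums_unit_interval_integrals:
  fixes h :: "real \<Rightarrow> complex"
  assumes h: "integrable lborel (\<lambda>g. indicator {0<..} g *\<^sub>R h g)" and [measurable]: "h \<in> borel_measurable borel"
  shows "(\<lambda>m. \<integral>u. indicator {0<..1} u *\<^sub>R h (real m + u) \<partial>lborel) sums (\<integral>g. indicator {0<..} g *\<^sub>R h g \<partial>lborel)"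
proof -
  have shift: "(\<integral>u. indicator {0<..1} u *\<^sub>R h (real m + u) \<partial>lborel) = (\<integral>g. indicator {real m<..real (Suc m)} g *\<^sub>R h g \<partial>lborel)" for m
    by (subst lborel_integral_real_affine[of 1 _ "real m"])
      (auto intro!: Bochner_Integration.integral_cong simp: indicator_def)
  have int: "integrable lborel (\<lambda>g. indicator {real m<..real n} g *\<^sub>R h g)" for m n
    by (rule Bochner_Integration.integrable_bound[OF h]) (auto intro!: AE_I2 simp: indicator_def)
  have part: "(\<Sum>m<n. \<integral>u. indicator {0<..1} u *\<^sub>R h (real m + u) \<partial>lborel) = (\<integral>g. indicator {0<..real n} g *\<^sub>R h g \<partial>lborel)" for n
  proof (induction n)
    case (Suc n)
    have "(\<Sum>m<Suc n. \<integral>u. indicator {0<..1} u *\<^sub>R h (real m + u) \<partial>lborel)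
      = (\<integral>g. indicator {0<..real n} g *\<^sub>R h g + indicator {real n<..real (Suc n)} g *\<^sub>R h g \<partial>lborel)"
      using Suc int[of 0 n] int[of n "Suc n"] by (simp add: shift Bochner_Integration.integral_add)
    also have "\<dots> = (\<integral>g. indicator {0<..real (Suc n)} g *\<^sub>R h g \<partial>lborel)"
      by (intro Bochner_Integration.integral_cong) (auto simp: indicator_def)
    finally show ?case .
  qed simp
  show ?thesis
    unfolding sums_def part
  proof (rule integral_dominated_convergence[where w = "\<lambda>g. norm (indicator {0<..} g *\<^sub>R h g)"])
    show "AE g in lborel. (\<lambda>n. indicator {0<..real n} g *\<^sub>R h g) \<longlonglongrightarrow> indicator {0<..} g *\<^sub>R h g"
    proof (rule AE_I2)
      fix g :: real
      have "\<forall>\<^sub>F n in sequentially. g \<le> real n"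
        using filterlim_real_sequentially by (rule filterlim_at_top[THEN iffD1, rule_format])
      then have "\<forall>\<^sub>F n in sequentially. indicator {0<..real n} g *\<^sub>R h g = indicator {0<..} g *\<^sub>R h g"
        by eventually_elim (auto simp: indicator_def)
      then show "(\<lambda>n. indicator {0<..real n} g *\<^sub>R h g) \<longlonglongrightarrow> indicator {0<..} g *\<^sub>R h g"
        by (rule tendsto_eventually)
    qed
    show "integrable lborel (\<lambda>g. norm (indicator {0<..} g *\<^sub>R h g))" by (rule integrable_norm[OF h])
  qed (auto simp: indicator_def)
qed

section \<open>Poisson points and the stable Levy motion\<close>

text \<open>Open at 0 and closed at 1, so that the shifts by natural numbers tile the positive
  half-line.\<close>

definition unif :: "real measure" where
  "unif = density lborel (indicator {0<..1})"

lemma sets_unif [simp, measurable_cong]: "sets unif = sets borel"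
  by (simp add: unif_def)

lemma space_unif [simp]: "space unif = UNIV"
  by (simp add: unif_def)

lemma prob_space_unif: "prob_space unif"
  by (rule prob_spaceI) (simp add: unif_def emeasure_density)

lemma integral_unif:
  fixes h :: "real \<Rightarrow> 'c::{banach, second_countable_topology}"
  assumes [measurable]: "h \<in> borel_measurable borel"
  shows "integral\<^sup>L unif h = (\<integral>u. indicator {0<..1} u *\<^sub>R h u \<partial>lborel)"
proof -
  have "unif = density lborel (\<lambda>u. ennreal (indicator {0<..1} u))"
    unfolding unif_def by (intro arg_cong[where f = "density lborel"]) (auto simp: indicator_def)
  then have "integral\<^sup>L unif h = integral\<^sup>L (density lborel (\<lambda>u. ennreal (indicator {0<..1} u))) h" by simp
  also have "\<dots> = (\<integral>u. indicator {0<..1} u *\<^sub>R h u \<partial>lborel)" by (rule integral_density) auto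
  finally show ?thesis .
qed

lemma integral_unif_of_bool:
  assumes "0 \<le> s" "s \<le> t" "t \<le> 1"
  shows "(\<integral>u. of_bool (s < u \<and> u \<le> t) \<partial>unif) = t - s"
    and "(\<integral>u. of_bool (s \<le> u \<and> u < t) \<partial>unif) = t - s"
proof -
  have "(\<lambda>u. indicat_real {0<..1} u *\<^sub>R of_bool (s < u \<and> u \<le> t)) = indicat_real {s<..t}"
    using assms by (auto simp: fun_eq_iff indicator_def)
  then show "(\<integral>u. of_bool (s < u \<and> u \<le> t) \<partial>unif) = t - s"
    using assms by (subst integral_unif) simp_all
  have "(\<lambda>u. indicat_real {0<..1} u *\<^sub>R of_bool (s \<le> u \<and> u < t)) = indicat_real ({s..<t} - {0})"
    using assms by (auto simp: fun_eq_iff indicator_def)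
  then have "(\<integral>u. of_bool (s \<le> u \<and> u < t) \<partial>unif) = measure lborel ({s..<t} - {0})"
    by (subst integral_unif) simp_all
  also have "\<dots> = measure lborel {s..<t}"
    by (intro measure_Diff_null_set) auto
  finally show "(\<integral>u. of_bool (s \<le> u \<and> u < t) \<partial>unif) = t - s" using assms by simp
qed

text \<open>The sample space has to be \<open>real \<Rightarrow> real\<close>, the type in the final
  theorem. The product is therefore indexed by all reals, and the coordinates at natural numbers are
  read.\<close>

lemma exists_independent_coordinates:
  fixes D :: "nat \<Rightarrow> real measure"
  assumes D: "\<And>q. prob_space (D q)" and sets_D: "\<And>q. sets (D q) = sets borel"
  shows "\<exists>(P :: (real \<Rightarrow> real) measure) \<zeta>. prob_space P \<and>
    prob_space.indep_vars P (\<lambda>_. borel) \<zeta> (UNIV :: nat set) \<and> (\<forall>q. distr P borel (\<zeta> q) = D q)"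
proof -
  let ?D = "\<lambda>i::real. D (nat \<lfloor>i\<rfloor>)"
  define P where "P = PiM UNIV ?D"
  have sets_D': "sets borel = sets (D q)" for q using sets_D by simp
  interpret P: prob_space P unfolding P_def by (rule prob_space_PiM) (rule D)
  have meas: "(\<lambda>\<omega>. \<omega> (real q)) \<in> P \<rightarrow>\<^sub>M borel" for q :: nat
  proof -
    have "(\<lambda>\<omega>. \<omega> (real q)) \<in> P \<rightarrow>\<^sub>M ?D (real q)" unfolding P_def by (rule measurable_component_singleton) simp
    then show ?thesis by (simp add: sets_D cong: measurable_cong_sets)
  qed
  have distr: "distr P borel (\<lambda>\<omega>. \<omega> (real q)) = D q" for q :: nat
  proof -
    have "distr P borel (\<lambda>\<omega>. \<omega> (real q)) = distr P (?D (real q)) (\<lambda>\<omega>. \<omega> (real q))"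
      by (rule distr_cong) (simp_all add: sets_D)
    also have "\<dots> = ?D (real q)" unfolding P_def by (rule distr_PiM_component) (auto intro: D)
    finally show ?thesis by simp
  qed
  have "P.indep_vars (\<lambda>_. borel) (\<lambda>q \<omega>. \<omega> (real q)) (UNIV :: nat set)"
  proof (subst P.indep_vars_iff_distr_eq_PiM')
    have "distr P (PiM UNIV (\<lambda>_. borel)) (\<lambda>\<omega>. \<lambda>q\<in>UNIV. \<omega> (real q)) =
      distr P (PiM UNIV (\<lambda>q::nat. ?D (real q))) (\<lambda>\<omega>. \<lambda>q\<in>UNIV. \<omega> (real q))"
      by (intro distr_cong sets_PiM_cong) (simp_all add: sets_D)
    also have "\<dots> = PiM UNIV (\<lambda>q::nat. ?D (real q))"
      unfolding P_def by (rule distr_PiM_reindex) (auto intro: D simp: inj_on_def)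
    finally show "distr P (PiM UNIV (\<lambda>_. borel)) (\<lambda>\<omega>. \<lambda>q\<in>UNIV. \<omega> (real q)) =
      PiM UNIV (\<lambda>q::nat. distr P borel (\<lambda>\<omega>. \<omega> (real q)))" by (simp add: distr)
  qed (use meas in auto)
  then show ?thesis using distr P.prob_space_axioms by (intro exI[of _ P] exI[of _ "\<lambda>q \<omega>. \<omega> (real q)"]) auto
qed

lemma prod_of_bool: "finite A \<Longrightarrow> (\<Prod>i\<in>A. of_bool (Q i)) = (of_bool (\<forall>i\<in>A. Q i) :: 'c::comm_semiring_1)"
  by (induction A rule: finite_induct) auto

text \<open>The first component of \<open>prod_decode q\<close> is the role of a coordinate: 0 for
  the number of points in a block, 1 for a mark, 2 for a time.\<close>

locale poisson_points = prob_space P for P :: "'b measure" +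
  fixes \<zeta> :: "nat \<Rightarrow> 'b \<Rightarrow> real"
  assumes indep: "indep_vars (\<lambda>_. borel) \<zeta> UNIV"
    and distr_\<zeta>: "\<And>q. distr P borel (\<zeta> q) =
      (if fst (prod_decode q) = 0 then distr (measure_pmf (poisson_pmf 1)) borel real else unif)"
begin

text \<open>Block \<open>r\<close> carries a Poisson(1) number of points; the point \<open>y = prod_encode (r, i)\<close>, the \<open>i\<close>-th
  point of block \<open>r\<close>, has the independent uniform coordinates \<open>mark y\<close> and \<open>time y\<close>.\<close>

definition count :: "nat \<Rightarrow> 'b \<Rightarrow> nat" where
  "count r \<omega> = nat \<lfloor>\<zeta> (prod_encode (0, r)) \<omega>\<rfloor>"

definition mark :: "nat \<Rightarrow> 'b \<Rightarrow> real" where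
  "mark y = \<zeta> (prod_encode (1, y))"

definition time :: "nat \<Rightarrow> 'b \<Rightarrow> real" where
  "time y = \<zeta> (prod_encode (2, y))"

lemma \<zeta>_measurable [measurable]: "\<zeta> q \<in> borel_measurable P"
  using indep by (auto simp: indep_vars_def)

lemma count_measurable [measurable]: "count r \<in> P \<rightarrow>\<^sub>M count_space UNIV"
  unfolding count_def by measurable

lemma mark_measurable [measurable]: "mark y \<in> borel_measurable P"
  and time_measurable [measurable]: "time y \<in> borel_measurable P"
  unfolding mark_def time_def by measurable

lemma indep_blocks:
  assumes "disjoint_family_on B L"
    and "\<And>l. l \<in> L \<Longrightarrow> F l \<in> PiM (B l) (\<lambda>_. borel) \<rightarrow>\<^sub>M borel"
  shows "indep_vars (\<lambda>_. borel) (\<lambda>l \<omega>. F l (restrict (\<lambda>q. \<zeta> q \<omega>) (B l))) L"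
  by (rule indep_vars_compose2[OF indep_vars_restrict[OF indep]]) (use assms in auto)

lemma integral_\<zeta>:
  fixes h :: "real \<Rightarrow> 'c::{banach, second_countable_topology}"
  assumes [measurable]: "h \<in> borel_measurable borel" and "fst (prod_decode q) \<noteq> 0"
  shows "(\<integral>\<omega>. h (\<zeta> q \<omega>) \<partial>P) = integral\<^sup>L unif h"
proof -
  have "(\<integral>\<omega>. h (\<zeta> q \<omega>) \<partial>P) = integral\<^sup>L (distr P borel (\<zeta> q)) h"
    by (rule integral_distr[symmetric]) auto
  then show ?thesis using assms(2) by (simp add: distr_\<zeta>)
qed

lemma expectation_product:
  fixes f g :: "real \<Rightarrow> 'c::{real_normed_field, banach, second_countable_topology}"
  assumes [measurable]: "f \<in> borel_measurable borel" "g \<in> borel_measurable borel"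
    and bf: "\<And>u. norm (f u) \<le> C" and bg: "\<And>u. norm (g u) \<le> C"
    and q: "q \<noteq> q'" "fst (prod_decode q) \<noteq> 0" "fst (prod_decode q') \<noteq> 0"
  shows "(\<integral>\<omega>. f (\<zeta> q \<omega>) * g (\<zeta> q' \<omega>) \<partial>P) = integral\<^sup>L unif f * integral\<^sup>L unif g"
proof -
  have "(\<integral>\<omega>. (\<Prod>p\<in>{q, q'}. (if p = q then f else g) (\<zeta> p \<omega>)) \<partial>P) =
    (\<Prod>p\<in>{q, q'}. (\<integral>\<omega>. (if p = q then f else g) (\<zeta> p \<omega>) \<partial>P))"
  proof (rule indep_vars_lebesgue_integral)
    show "indep_vars (\<lambda>_. borel) (\<lambda>p \<omega>. (if p = q then f else g) (\<zeta> p \<omega>)) {q, q'}"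
      by (rule indep_vars_compose2[OF indep_vars_subset[OF indep]]) auto
    fix p
    show "integrable P (\<lambda>\<omega>. (if p = q then f else g) (\<zeta> p \<omega>))"
      by (rule integrable_const_bound[where B = C]) (auto simp: bf bg)
  qed simp
  then show ?thesis using q by (simp add: integral_\<zeta>)
qed

lemma prob_count: "prob {\<omega> \<in> space P. count r \<omega> = k} = exp (- 1) / fact k"
proof -
  have "prob {\<omega> \<in> space P. count r \<omega> = k} = measure (distr P borel (\<zeta> (prod_encode (0, r)))) {x. nat \<lfloor>x\<rfloor> = k}"
    by (subst measure_distr) (auto intro!: arg_cong[where f = prob] simp: count_def)
  also have "\<dots> = measure (measure_pmf (poisson_pmf 1)) {k}"
    by (simp add: distr_\<zeta> measure_distr vimage_def)
  finally show ?thesis by (simp add: measure_pmf_single)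
qed

lemma AE_unif_coordinate:
  assumes "fst (prod_decode q) \<noteq> 0" and [measurable]: "Measurable.pred borel Q"
    and "AE u in lborel. 0 < u \<longrightarrow> u \<le> 1 \<longrightarrow> Q u"
  shows "AE \<omega> in P. Q (\<zeta> q \<omega>)"
proof -
  have "AE u in unif. Q u"
    unfolding unif_def using assms(3) by (subst AE_density) (auto simp: indicator_def elim: eventually_mono split: if_splits)
  then have "AE u in distr P borel (\<zeta> q). Q u" by (simp only: distr_\<zeta> assms(1) if_False)
  then show ?thesis by (subst (asm) AE_distr_iff) auto
qed

lemma AE_time_neq: "AE \<omega> in P. time y \<omega> \<noteq> t"
  unfolding time_def using AE_lborel_singleton[of t] by (intro AE_unif_coordinate) (auto elim: eventually_mono)

lemma AE_time_01: "AE \<omega> in P. 0 < time y \<omega> \<and> time y \<omega> < 1"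
  unfolding time_def using AE_lborel_singleton[of 1] by (intro AE_unif_coordinate) (auto elim: eventually_mono)

lemma AE_mark_01: "AE \<omega> in P. 0 < mark y \<omega> \<and> mark y \<omega> \<le> 1"
  unfolding mark_def by (intro AE_unif_coordinate) auto

text \<open>Coinciding times fall into the same one of \<open>N\<close> equal cells; by independence
  this has probability at most \<open>N * (1 / N) * (1 / N)\<close>, and \<open>N\<close> is
  arbitrary.\<close>

lemma AE_times_distinct:
  assumes "y \<noteq> z"
  shows "AE \<omega> in P. time y \<omega> \<noteq> time z \<omega>"
proof -
  define A where "A = {\<omega> \<in> space P. time y \<omega> = time z \<omega> \<and> 0 < time y \<omega> \<and> time y \<omega> < 1}"
  have [measurable]: "A \<in> sets P" unfolding A_def by measurable
  have "prob A \<le> 1 / real N" if "0 < N" for N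
  proof -
    let ?I = "\<lambda>j u. of_bool (real j / real N \<le> u \<and> u < real (Suc j) / real N) :: real"
    have ij: "(\<integral>\<omega>. ?I j (time y \<omega>) * ?I j (time z \<omega>) \<partial>P) = 1 / real N * (1 / real N)" if "j < N" for j
    proof -
      have "(\<integral>u. ?I j u \<partial>unif) = real (Suc j) / real N - real j / real N"
        using that \<open>0 < N\<close> by (intro integral_unif_of_bool) (auto simp: divide_simps)
      also have "\<dots> = 1 / real N" using \<open>0 < N\<close> by (simp add: field_simps)
      finally show ?thesis
        unfolding time_def using assms by (subst expectation_product[where C = 1]) (auto simp: prod_encode_eq)
    qed
    have int: "integrable P (\<lambda>\<omega>. ?I j (time y \<omega>) * ?I j (time z \<omega>))" for j
      by (rule integrable_const_bound[where B = 1]) auto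
    have "prob A = (\<integral>\<omega>. indicator A \<omega> \<partial>P)" by simp
    also have "\<dots> \<le> (\<integral>\<omega>. (\<Sum>j<N. ?I j (time y \<omega>) * ?I j (time z \<omega>)) \<partial>P)"
    proof (rule integral_mono_AE)
      show "AE \<omega> in P. indicator A \<omega> \<le> (\<Sum>j<N. ?I j (time y \<omega>) * ?I j (time z \<omega>))"
      proof (rule AE_I2)
        fix \<omega>
        show "indicator A \<omega> \<le> (\<Sum>j<N. ?I j (time y \<omega>) * ?I j (time z \<omega>))"
        proof (cases "\<omega> \<in> A")
          case True
          define j where "j = nat \<lfloor>real N * time y \<omega>\<rfloor>"
          have t: "time z \<omega> = time y \<omega>" "0 < time y \<omega>" "time y \<omega> < 1" using True by (auto simp: A_def)
          have fl: "real j \<le> real N * time y \<omega>" "real N * time y \<omega> < real (Suc j)"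
            using t unfolding j_def by (simp_all add: of_nat_nat) linarith
          moreover have "real N * time y \<omega> < real N" using t \<open>0 < N\<close> by simp
          ultimately have "j < N" by linarith
          have "1 = ?I j (time y \<omega>) * ?I j (time z \<omega>)"
            using fl t \<open>0 < N\<close> by (auto simp: field_simps)
          also have "\<dots> \<le> (\<Sum>j<N. ?I j (time y \<omega>) * ?I j (time z \<omega>))"
            using \<open>j < N\<close> by (intro member_le_sum) auto
          finally show ?thesis using True by simp
        qed (auto intro!: sum_nonneg)
      qed
      show "integrable P (\<lambda>\<omega>. \<Sum>j<N. ?I j (time y \<omega>) * ?I j (time z \<omega>))"
        by (rule Bochner_Integration.integrable_sum) (rule int)
    qed (simp add: less_top[symmetric])
    also have "\<dots> = (\<Sum>j<N. \<integral>\<omega>. ?I j (time y \<omega>) * ?I j (time z \<omega>) \<partial>P)"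
      by (rule Bochner_Integration.integral_sum) (rule int)
    also have "\<dots> = (\<Sum>j<N. 1 / real N * (1 / real N))"
      by (intro sum.cong refl ij) simp
    also have "\<dots> = 1 / real N" using that by simp
    finally show ?thesis .
  qed
  then have "\<forall>\<^sub>F N in sequentially. prob A \<le> 1 / real N"
    by (intro eventually_mono[OF eventually_gt_at_top[of 0]]) auto
  then have "prob A \<le> 0"
    by (intro tendsto_lowerbound[OF lim_1_over_n]) auto
  then have "AE \<omega> in P. \<omega> \<notin> A"
    by (subst prob_eq_0[symmetric]) (auto intro: antisym)
  with AE_time_01[of y] AE_space show ?thesis
    by eventually_elim (auto simp: A_def)
qed

text \<open>Generating function of the Poisson(1) law: on \<open>count r \<omega> = k\<close> the
  product has conditional mean \<open>g ^ k\<close>, and the sum of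
  \<open>exp (- 1) * g ^ k / fact k\<close> is \<open>exp (g - 1)\<close>.\<close>

lemma expectation_block:
  fixes G :: "real \<Rightarrow> real \<Rightarrow> complex"
  assumes meas: "(\<lambda>p. G (fst p) (snd p)) \<in> borel_measurable (borel \<Otimes>\<^sub>M borel)"
    and bound: "\<And>u t. norm (G u t) \<le> 1"
    and g: "\<And>i. (\<integral>\<omega>. G (mark (prod_encode (r, i)) \<omega>) (time (prod_encode (r, i)) \<omega>) \<partial>P) = g"
  shows "(\<integral>\<omega>. (\<Prod>i<count r \<omega>. G (mark (prod_encode (r, i)) \<omega>) (time (prod_encode (r, i)) \<omega>)) \<partial>P) = exp (g - 1)"
proof -
  define H where "H i \<omega> = G (mark (prod_encode (r, i)) \<omega>) (time (prod_encode (r, i)) \<omega>)" for i \<omega>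
  have [measurable]: "H i \<in> borel_measurable P" for i
  proof -
    have "(\<lambda>\<omega>. (mark (prod_encode (r, i)) \<omega>, time (prod_encode (r, i)) \<omega>)) \<in> P \<rightarrow>\<^sub>M borel \<Otimes>\<^sub>M borel" by measurable
    from measurable_compose[OF this meas] show ?thesis unfolding H_def by simp
  qed
  have Hb: "norm (H i \<omega>) \<le> 1" for i \<omega> unfolding H_def by (rule bound)
  have pb: "norm (\<Prod>i<k. H i \<omega>) \<le> 1" for k \<omega>
    unfolding prod_norm[symmetric] using Hb by (intro prod_le_1) auto
  have block_k: "(\<integral>\<omega>. of_bool (count r \<omega> = k) * (\<Prod>i<k. H i \<omega>) \<partial>P) = exp (- 1) * (g ^ k /\<^sub>R fact k)" for k
  proof -
    \<comment> \<open>Index 0 is the count and index \<open>Suc i\<close> the pair of coordinates of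
      point \<open>i\<close>, so that the count and the points become independent members of one
      family.\<close>
    define B where "B l = (case l of 0 \<Rightarrow> {prod_encode (0, r)}
      | Suc i \<Rightarrow> {prod_encode (1, prod_encode (r, i)), prod_encode (2, prod_encode (r, i))})" for l :: nat
    define F where "F l v = (case l of 0 \<Rightarrow> of_bool (nat \<lfloor>v (prod_encode (0, r))\<rfloor> = k)
      | Suc i \<Rightarrow> G (v (prod_encode (1, prod_encode (r, i)))) (v (prod_encode (2, prod_encode (r, i)))))" for l v
    have F_meas: "F l \<in> PiM (B l) (\<lambda>_. borel) \<rightarrow>\<^sub>M borel" for l
    proof (cases l)
      case 0
      have [measurable]: "(\<lambda>v. v (prod_encode (0, r))) \<in> PiM {prod_encode (0, r)} (\<lambda>_. borel) \<rightarrow>\<^sub>M (borel :: real measure)"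
        by (rule measurable_component_singleton) simp
      show ?thesis unfolding 0 F_def B_def by simp
    next
      case (Suc i)
      have "(\<lambda>v. (v (prod_encode (1, prod_encode (r, i))), v (prod_encode (2, prod_encode (r, i)))))
        \<in> PiM (B l) (\<lambda>_. borel) \<rightarrow>\<^sub>M (borel :: real measure) \<Otimes>\<^sub>M (borel :: real measure)"
        unfolding Suc B_def by (intro measurable_Pair measurable_component_singleton) auto
      from measurable_compose[OF this meas] show ?thesis unfolding F_def Suc by simp
    qed
    have "indep_vars (\<lambda>_. borel) (\<lambda>l \<omega>. F l (restrict (\<lambda>q. \<zeta> q \<omega>) (B l))) {..k}"
    proof (rule indep_blocks[OF _ F_meas])
      show "disjoint_family_on B {..k}"
        by (auto simp: disjoint_family_on_def B_def prod_encode_eq split: nat.splits)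
    qed
    moreover have F_eq: "F l (restrict (\<lambda>q. \<zeta> q \<omega>) (B l)) = (case l of 0 \<Rightarrow> of_bool (count r \<omega> = k) | Suc i \<Rightarrow> H i \<omega>)" for l \<omega>
      by (auto simp: F_def B_def H_def count_def mark_def time_def split: nat.splits)
    ultimately have ind: "indep_vars (\<lambda>_. borel) (\<lambda>l \<omega>. case l of 0 \<Rightarrow> of_bool (count r \<omega> = k) | Suc i \<Rightarrow> H i \<omega>) {..k}"
      by simp
    have "(\<integral>\<omega>. of_bool (count r \<omega> = k) * (\<Prod>i<k. H i \<omega>) \<partial>P) =
      (\<integral>\<omega>. (\<Prod>l\<le>k. case l of 0 \<Rightarrow> of_bool (count r \<omega> = k) | Suc i \<Rightarrow> H i \<omega>) \<partial>P)"
      by (simp add: prod.atMost_shift)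
    also have "\<dots> = (\<Prod>l\<le>k. \<integral>\<omega>. (case l of 0 \<Rightarrow> of_bool (count r \<omega> = k) | Suc i \<Rightarrow> H i \<omega>) \<partial>P)"
    proof (rule indep_vars_lebesgue_integral[OF _ ind])
      show "integrable P (\<lambda>\<omega>. case l of 0 \<Rightarrow> of_bool (count r \<omega> = k) | Suc i \<Rightarrow> H i \<omega>)" for l
        by (rule integrable_const_bound[where B = 1]) (auto simp: Hb split: nat.splits)
    qed simp
    also have "\<dots> = (\<integral>\<omega>. of_bool (count r \<omega> = k) \<partial>P) * (\<Prod>i<k. g)"
      using g by (simp add: prod.atMost_shift H_def)
    also have "(\<integral>\<omega>. of_bool (count r \<omega> = k) \<partial>P) = complex_of_real (prob {\<omega> \<in> space P. count r \<omega> = k})"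
    proof -
      have "(\<integral>\<omega>. of_bool (count r \<omega> = k) \<partial>P) = (\<integral>\<omega>. complex_of_real (indicator {\<omega> \<in> space P. count r \<omega> = k} \<omega>) \<partial>P)"
        by (intro Bochner_Integration.integral_cong) (auto simp: indicator_def)
      then show ?thesis by (simp add: integral_complex_of_real less_top[symmetric])
    qed
    finally show ?thesis by (simp add: prob_count scaleR_conv_of_real divide_inverse exp_of_real[symmetric])
  qed
  have "(\<lambda>n. \<integral>\<omega>. (\<Sum>k<n. of_bool (count r \<omega> = k) * (\<Prod>i<k. H i \<omega>)) \<partial>P) \<longlonglongrightarrow> (\<integral>\<omega>. (\<Prod>i<count r \<omega>. H i \<omega>) \<partial>P)"
  proof (rule integral_dominated_convergence[where w = "\<lambda>_. 1"])
    have sum_eq: "(\<Sum>k<n. of_bool (count r \<omega> = k) * (\<Prod>i<k. H i \<omega>)) = of_bool (count r \<omega> < n) * (\<Prod>i<count r \<omega>. H i \<omega>)" for n \<omega>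
      by (induction n) (auto simp: less_Suc_eq)
    show "AE \<omega> in P. (\<lambda>n. \<Sum>k<n. of_bool (count r \<omega> = k) * (\<Prod>i<k. H i \<omega>)) \<longlonglongrightarrow> (\<Prod>i<count r \<omega>. H i \<omega>)"
    proof (rule AE_I2)
      fix \<omega>
      show "(\<lambda>n. \<Sum>k<n. of_bool (count r \<omega> = k) * (\<Prod>i<k. H i \<omega>)) \<longlonglongrightarrow> (\<Prod>i<count r \<omega>. H i \<omega>)"
        unfolding sum_eq
        by (rule tendsto_eventually) (auto intro!: eventually_mono[OF eventually_gt_at_top[of "count r \<omega>"]])
    qed
    show "AE \<omega> in P. norm (\<Sum>k<n. of_bool (count r \<omega> = k) * (\<Prod>i<k. H i \<omega>)) \<le> 1" for n
      unfolding sum_eq using pb by (auto simp: norm_mult)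
    show "(\<lambda>\<omega>. \<Prod>i<count r \<omega>. H i \<omega>) \<in> borel_measurable P"
      by (rule measurable_compose_countable[where f = "\<lambda>k \<omega>. \<Prod>i<k. H i \<omega>"]) measurable
  qed auto
  moreover have "(\<integral>\<omega>. (\<Sum>k<n. of_bool (count r \<omega> = k) * (\<Prod>i<k. H i \<omega>)) \<partial>P) = (\<Sum>k<n. exp (- 1) * (g ^ k /\<^sub>R fact k))" for n
  proof (subst Bochner_Integration.integral_sum)
    show "integrable P (\<lambda>\<omega>. of_bool (count r \<omega> = k) * (\<Prod>i<k. H i \<omega>))" for k
      by (rule integrable_const_bound[where B = 1]) (auto simp: norm_mult pb)
  qed (simp add: block_k)
  moreover have "(\<lambda>k. exp (- 1) * (g ^ k /\<^sub>R fact k)) sums (exp (- 1) * exp g)"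
    by (intro sums_mult exp_converges)
  ultimately have "(\<integral>\<omega>. (\<Prod>i<count r \<omega>. H i \<omega>) \<partial>P) = exp (- 1) * exp g"
    unfolding sums_def by (auto intro: LIMSEQ_unique)
  then show ?thesis by (simp add: H_def exp_add[symmetric] add.commute)
qed

text \<open>The exponential (Campbell) formula. Each block reads only its own coordinates, so blocks
  are independent although their numbers of points are random.\<close>

lemma expectation_blocks:
  fixes G :: "nat \<Rightarrow> real \<Rightarrow> real \<Rightarrow> complex"
  assumes meas: "\<And>r. (\<lambda>p. G r (fst p) (snd p)) \<in> borel_measurable (borel \<Otimes>\<^sub>M borel)"
    and bound: "\<And>r u t. norm (G r u t) \<le> 1"
    and g: "\<And>r i. (\<integral>\<omega>. G r (mark (prod_encode (r, i)) \<omega>) (time (prod_encode (r, i)) \<omega>) \<partial>P) = g r"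
  shows "(\<integral>\<omega>. (\<Prod>r<R. \<Prod>i<count r \<omega>. G r (mark (prod_encode (r, i)) \<omega>) (time (prod_encode (r, i)) \<omega>)) \<partial>P)
    = exp (\<Sum>r<R. g r - 1)"
proof -
  define B where "B r = insert (prod_encode (0, r)) (\<Union>i. {prod_encode (1, prod_encode (r, i)), prod_encode (2, prod_encode (r, i))})" for r :: nat
  define F where "F r v = (\<Prod>i<nat \<lfloor>v (prod_encode (0, r))\<rfloor>. G r (v (prod_encode (1, prod_encode (r, i)))) (v (prod_encode (2, prod_encode (r, i)))))" for r and v :: "nat \<Rightarrow> real"
  have F_meas: "F r \<in> PiM (B r) (\<lambda>_. borel) \<rightarrow>\<^sub>M borel" for r
  proof -
    have m1: "(\<lambda>v. G r (v (prod_encode (1, prod_encode (r, i)))) (v (prod_encode (2, prod_encode (r, i))))) \<in> PiM (B r) (\<lambda>_. borel) \<rightarrow>\<^sub>M borel" for i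
    proof -
      have "(\<lambda>v. (v (prod_encode (1, prod_encode (r, i))), v (prod_encode (2, prod_encode (r, i)))))
        \<in> PiM (B r) (\<lambda>_. borel) \<rightarrow>\<^sub>M (borel :: real measure) \<Otimes>\<^sub>M (borel :: real measure)"
        unfolding B_def by (intro measurable_Pair measurable_component_singleton) auto
      from measurable_compose[OF this meas] show ?thesis by simp
    qed
    have m2: "(\<lambda>v :: nat \<Rightarrow> real. nat \<lfloor>v (prod_encode (0, r))\<rfloor>) \<in> PiM (B r) (\<lambda>_. borel) \<rightarrow>\<^sub>M count_space UNIV"
    proof -
      have comp: "(\<lambda>v. v (prod_encode (0, r))) \<in> PiM (B r) (\<lambda>_. borel) \<rightarrow>\<^sub>M (borel :: real measure)"
        unfolding B_def by (rule measurable_component_singleton) simp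
      have "(\<lambda>x::real. nat \<lfloor>x\<rfloor>) \<in> borel \<rightarrow>\<^sub>M count_space UNIV" by measurable
      from measurable_compose[OF comp this] show ?thesis .
    qed
    show ?thesis
      unfolding F_def by (rule measurable_compose_countable[OF _ m2], rule borel_measurable_prod, rule m1)
  qed
  have "indep_vars (\<lambda>_. borel) (\<lambda>r \<omega>. F r (restrict (\<lambda>q. \<zeta> q \<omega>) (B r))) {..<R}"
  proof (rule indep_blocks[OF _ F_meas])
    show "disjoint_family_on B {..<R}"
      by (auto simp: disjoint_family_on_def B_def prod_encode_eq)
  qed
  moreover have F_eq: "F r (restrict (\<lambda>q. \<zeta> q \<omega>) (B r)) = (\<Prod>i<count r \<omega>. G r (mark (prod_encode (r, i)) \<omega>) (time (prod_encode (r, i)) \<omega>))" for r \<omega>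
    by (simp add: F_def B_def count_def mark_def time_def)
  ultimately have ind: "indep_vars (\<lambda>_. borel) (\<lambda>r \<omega>. \<Prod>i<count r \<omega>. G r (mark (prod_encode (r, i)) \<omega>) (time (prod_encode (r, i)) \<omega>)) {..<R}"
    by simp
  have "(\<integral>\<omega>. (\<Prod>r<R. \<Prod>i<count r \<omega>. G r (mark (prod_encode (r, i)) \<omega>) (time (prod_encode (r, i)) \<omega>)) \<partial>P)
    = (\<Prod>r<R. \<integral>\<omega>. (\<Prod>i<count r \<omega>. G r (mark (prod_encode (r, i)) \<omega>) (time (prod_encode (r, i)) \<omega>)) \<partial>P)"
  proof (rule indep_vars_lebesgue_integral[OF _ ind])
    fix r assume "r \<in> {..<R}"
    then have "(\<lambda>\<omega>. \<Prod>i<count r \<omega>. G r (mark (prod_encode (r, i)) \<omega>) (time (prod_encode (r, i)) \<omega>)) \<in> borel_measurable P"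
      using ind by (auto simp: indep_vars_def)
    moreover have "norm (\<Prod>i<count r \<omega>. G r (mark (prod_encode (r, i)) \<omega>) (time (prod_encode (r, i)) \<omega>)) \<le> 1" for \<omega>
      unfolding prod_norm[symmetric] using bound by (intro prod_le_1) auto
    ultimately show "integrable P (\<lambda>\<omega>. \<Prod>i<count r \<omega>. G r (mark (prod_encode (r, i)) \<omega>) (time (prod_encode (r, i)) \<omega>))"
      by (intro integrable_const_bound[where B = 1]) auto
  qed simp
  also have "\<dots> = (\<Prod>r<R. exp (g r - 1))"
    by (intro prod.cong refl expectation_block[OF meas bound g])
  also have "\<dots> = exp (\<Sum>r<R. g r - 1)" by (simp add: exp_sum)
  finally show ?thesis .
qed

end

lemma sum_pairs: "(\<Sum>r<2 * R. f r) = (\<Sum>m<R. f (2 * m) + (f (Suc (2 * m)) :: 'c::comm_monoid_add))"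
  by (induction R) (auto simp: add.assoc)

lemma nat_floor_eq_iff:
  assumes "0 \<le> x"
  shows "nat \<lfloor>x\<rfloor> = k \<longleftrightarrow> real k \<le> x \<and> x < real k + 1"
  using assms by (auto simp: nat_eq_iff floor_eq_iff)

lemma powr_le_powr_iff: "0 < b \<Longrightarrow> 0 \<le> x \<Longrightarrow> 0 \<le> y \<Longrightarrow> x powr b \<le> y powr b \<longleftrightarrow> x \<le> (y::real)"
  by (meson linorder_not_less powr_less_mono2 powr_mono2 less_imp_le)

context poisson_points begin

text \<open>All naturals index potential points, so sums over the random set of points become series
  over \<open>nat\<close> in which the absent points vanish.\<close>

definition present :: "nat \<Rightarrow> 'b \<Rightarrow> bool" where
  "present y \<omega> \<longleftrightarrow> snd (prod_decode y) < count (fst (prod_decode y)) \<omega>"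

lemma present_measurable [measurable]: "Measurable.pred P (present y)"
  unfolding present_def by measurable

lemma present_in_blocks:
  assumes "present y \<omega>" "fst (prod_decode y) < R"
  shows "y \<in> prod_encode ` (SIGMA r:{..<R}. {..<count r \<omega>})"
proof -
  obtain r i where ri: "prod_decode y = (r, i)" by (cases "prod_decode y")
  then have "y = prod_encode (r, i)" by (metis prod_decode_inverse)
  then show ?thesis using assms ri by (auto simp: present_def)
qed

text \<open>Bridges two orders of summation: block by block, where the exponential formula applies,
  and by index, where \<open>jump_path\<close> lives.\<close>

lemma sum_blocks:
  fixes X :: "nat \<Rightarrow> real"
  assumes X: "\<And>y. \<not> present y \<omega> \<Longrightarrow> X y = 0"
  shows "(\<Sum>r<R. \<Sum>i<count r \<omega>. X (prod_encode (r, i))) = (\<Sum>y. X y * of_bool (fst (prod_decode y) < R))"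
proof -
  define A where "A = prod_encode ` (SIGMA r:{..<R}. {..<count r \<omega>})"
  have inj: "inj_on prod_encode B" for B by (rule inj_prod_encode)
  have "(\<Sum>r<R. \<Sum>i<count r \<omega>. X (prod_encode (r, i))) = (\<Sum>p\<in>(SIGMA r:{..<R}. {..<count r \<omega>}). X (prod_encode p))"
    by (subst sum.Sigma) auto
  also have "\<dots> = (\<Sum>y\<in>A. X y)" unfolding A_def by (subst sum.reindex[OF inj]) simp
  also have "\<dots> = (\<Sum>y\<in>A. X y * of_bool (fst (prod_decode y) < R))"
    unfolding A_def by (intro sum.cong) auto
  also have "\<dots> = (\<Sum>y. X y * of_bool (fst (prod_decode y) < R))"
  proof (rule suminf_finite[symmetric])
    show "finite A" unfolding A_def by auto
    fix y assume "y \<notin> A"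
    then show "X y * of_bool (fst (prod_decode y) < R) = 0" using X[of y] present_in_blocks[of y \<omega> R] unfolding A_def by auto
  qed
  finally show ?thesis .
qed

lemma sum_blocks_tendsto:
  fixes X :: "nat \<Rightarrow> real"
  assumes "\<And>y. \<not> present y \<omega> \<Longrightarrow> X y = 0" and "summable (\<lambda>y. \<bar>X y\<bar>)"
  shows "(\<lambda>R. \<Sum>r<R. \<Sum>i<count r \<omega>. X (prod_encode (r, i))) \<longlonglongrightarrow> suminf X"
proof -
  have "(\<lambda>R. \<Sum>y. X y * of_bool (fst (prod_decode y) < R)) \<longlonglongrightarrow> (\<Sum>y. X y * of_bool True)"
    by (rule tendsto_suminf_indicators[OF assms(2)]) (auto intro: eventually_gt_at_top)
  moreover have "(\<lambda>R. \<Sum>r<R. \<Sum>i<count r \<omega>. X (prod_encode (r, i))) = (\<lambda>R. \<Sum>y. X y * of_bool (fst (prod_decode y) < R))"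
    by (rule ext) (rule sum_blocks, rule assms(1))
  ultimately show ?thesis by simp
qed

lemma summable_from_blocks:
  fixes X :: "nat \<Rightarrow> real"
  assumes X0: "\<And>y. \<not> present y \<omega> \<Longrightarrow> X y = 0" and nn: "\<And>y. 0 \<le> X y"
    and b: "summable (\<lambda>r. \<Sum>i<count r \<omega>. X (prod_encode (r, i)))"
  shows "summable X"
proof (rule summableI_nonneg_bounded[OF nn])
  fix n
  define A where "A = prod_encode ` (SIGMA r:{..<n}. {..<count r \<omega>})"
  have inj: "inj_on prod_encode B" for B by (rule inj_prod_encode)
  have "(\<Sum>y<n. X y) = (\<Sum>y\<in>{..<n} \<inter> {y. present y \<omega>}. X y)"
    by (rule sum.mono_neutral_right) (auto simp: X0)
  also have "\<dots> \<le> (\<Sum>y\<in>A. X y)"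
  proof (rule sum_mono2)
    show "finite A" unfolding A_def by auto
    show "{..<n} \<inter> {y. present y \<omega>} \<subseteq> A"
    proof
      fix y assume "y \<in> {..<n} \<inter> {y. present y \<omega>}"
      \<comment> \<open>The code of a point dominates its block number, so the first
        \<open>n\<close> indices lie in the first \<open>n\<close> blocks.\<close>
      moreover have "fst (prod_decode y) \<le> y"
        using le_prod_encode_1[of "fst (prod_decode y)" "snd (prod_decode y)"] by simp
      ultimately show "y \<in> A"
        unfolding A_def by (intro present_in_blocks) auto
    qed
  qed (simp add: nn)
  also have "\<dots> = (\<Sum>r<n. \<Sum>i<count r \<omega>. X (prod_encode (r, i)))"
    unfolding A_def by (subst sum.reindex[OF inj]) (simp add: sum.Sigma split_beta)
  also have "\<dots> \<le> (\<Sum>r. \<Sum>i<count r \<omega>. X (prod_encode (r, i)))"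
    by (rule sum_le_suminf[OF b]) (auto intro: sum_nonneg nn)
  finally show "(\<Sum>y<n. X y) \<le> (\<Sum>r. \<Sum>i<count r \<omega>. X (prod_encode (r, i)))" .
qed

text \<open>The expectation of the sum is \<open>\<kappa>\<close> times the sum of \<open>d\<close>,
  where \<open>\<kappa>\<close> is the mean of the Poisson(1) law. What counts is that it is finite,
  and this follows from \<open>k \<le> 2 ^ k\<close>.\<close>

lemma AE_summable_count:
  fixes d :: "nat \<Rightarrow> real"
  assumes d: "summable d" "\<And>r. 0 \<le> d r"
  shows "AE \<omega> in P. summable (\<lambda>r. real (count r \<omega>) * d r)"
proof -
  define \<kappa> where "\<kappa> = (\<integral>\<^sup>+k. ennreal (real k) \<partial>measure_pmf (poisson_pmf 1))"
  have "\<kappa> = (\<Sum>k. ennreal (pmf (poisson_pmf 1) k) * ennreal (real k))"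
    unfolding \<kappa>_def by (simp add: nn_integral_measure_pmf nn_integral_count_space_nat)
  also have "\<dots> = (\<Sum>k. ennreal (1 / fact k * exp (- 1) * real k))"
    by (simp add: ennreal_mult'[symmetric])
  also have "\<dots> \<noteq> \<top>"
  proof (rule ennreal_suminf_neq_top)
    have "summable (\<lambda>k. exp (- 1) * (inverse (fact k) * (2::real) ^ k))"
      by (intro summable_mult summable_exp)
    then show "summable (\<lambda>k. 1 / fact k * exp (- 1) * real k :: real)"
    proof (rule summable_comparison_test'[where N = 0])
      fix k :: nat
      have "real k \<le> 2 ^ k" using of_nat_less_two_power[of k] by (simp add: less_imp_le)
      then show "norm (1 / fact k * exp (- 1) * real k :: real) \<le> exp (- 1) * (inverse (fact k) * 2 ^ k)"
        by (simp add: field_simps)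
    qed
  qed simp
  finally have \<kappa>: "\<kappa> \<noteq> \<top>" .
  have count_int: "(\<integral>\<^sup>+\<omega>. ennreal (real (count r \<omega>)) \<partial>P) = \<kappa>" for r
  proof -
    have "(\<integral>\<^sup>+\<omega>. ennreal (real (count r \<omega>)) \<partial>P) = (\<integral>\<^sup>+x. ennreal (real (nat \<lfloor>x\<rfloor>)) \<partial>distr P borel (\<zeta> (prod_encode (0, r))))"
      unfolding count_def by (subst nn_integral_distr) auto
    also have "\<dots> = \<kappa>" by (simp add: distr_\<zeta> nn_integral_distr \<kappa>_def)
    finally show ?thesis .
  qed
  have "(\<integral>\<^sup>+\<omega>. (\<Sum>r. ennreal (real (count r \<omega>) * d r)) \<partial>P) = (\<Sum>r. \<integral>\<^sup>+\<omega>. ennreal (real (count r \<omega>) * d r) \<partial>P)"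
    by (rule nn_integral_suminf) measurable
  also have "\<dots> = (\<Sum>r. \<kappa> * ennreal (d r))"
    using d(2) by (simp add: ennreal_mult' nn_integral_multc count_int)
  also have "\<dots> = \<kappa> * (\<Sum>r. ennreal (d r))" by (rule ennreal_suminf_cmult)
  also have "\<dots> < \<top>"
    using \<kappa> d by (simp add: suminf_ennreal2 ennreal_mult_eq_top_iff less_top[symmetric])
  finally have "AE \<omega> in P. (\<Sum>r. ennreal (real (count r \<omega>) * d r)) \<noteq> \<infinity>"
    by (intro nn_integral_noteq_infinite) auto
  then show ?thesis
    by eventually_elim (auto intro!: summable_suminf_not_top mult_nonneg_nonneg d(2))
qed

end

locale stable_jumps = poisson_points P \<zeta> for P :: "'b measure" and \<zeta> :: "nat \<Rightarrow> 'b \<Rightarrow> real" +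
  fixes a c0 c1 :: real
  assumes a: "1 < a" and c0: "0 \<le> c0" and c1: "0 \<le> c1"
begin

text \<open>Even blocks carry the positive and odd blocks the negative jumps; together the blocks \<open>2 * m\<close> (or the blocks
\<open>2 * m + 1\<close>) form a unit-rate Poisson process of positions on the half line.\<close>

definition weight :: "nat \<Rightarrow> real" where
  "weight r = (if even r then c0 else - c1)"

definition position :: "nat \<Rightarrow> 'b \<Rightarrow> real" where
  "position y \<omega> = real (fst (prod_decode y) div 2) + mark y \<omega>"

definition jump :: "nat \<Rightarrow> 'b \<Rightarrow> real" where
  "jump y \<omega> = (if present y \<omega> then weight (fst (prod_decode y)) * position y \<omega> powr (- a) else 0)"

lemma position_measurable [measurable]: "position y \<in> borel_measurable P"
  unfolding position_def by measurable

lemma jump_measurable [measurable]: "jump y \<in> borel_measurable P"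
  unfolding jump_def by measurable

lemma summable_block_bound: "summable (\<lambda>r. (c0 + c1) * real (r div 2) powr (- a))"
proof (rule summable_mult, rule summable_comparison_test'[where N = 2])
  show "summable (\<lambda>r. 3 powr a * real r powr (- a))"
    using a by (intro summable_mult) (simp add: summable_real_powr_iff)
  fix r :: nat assume "2 \<le> r"
  \<comment> \<open>Equality at \<open>r = 3\<close>, which is where the constant 3 comes
    from.\<close>
  then have "r \<le> 3 * (r div 2)" by presburger
  then have "real r / 3 \<le> real (r div 2)" by linarith
  then have "real (r div 2) powr (- a) \<le> (real r / 3) powr (- a)"
    using a \<open>2 \<le> r\<close> by (intro powr_mono2') auto
  also have "\<dots> = real r powr (- a) / inverse (3 powr a)"
    by (simp add: powr_divide powr_minus[of 3])
  also have "\<dots> = 3 powr a * real r powr (- a)" by (simp add: divide_inverse mult.commute)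
  finally show "norm (real (r div 2) powr (- a)) \<le> 3 powr a * real r powr (- a)" by simp
qed

lemma AE_summable_jumps: "AE \<omega> in P. summable (\<lambda>y. \<bar>jump y \<omega>\<bar>)"
proof -
  have "AE \<omega> in P. \<forall>y. 0 < mark y \<omega> \<and> mark y \<omega> \<le> 1"
    using AE_mark_01 by (simp add: AE_all_countable)
  moreover have "AE \<omega> in P. summable (\<lambda>r. real (count r \<omega>) * ((c0 + c1) * real (r div 2) powr (- a)))"
    using c0 c1 by (intro AE_summable_count summable_block_bound) simp
  ultimately show ?thesis
  proof eventually_elim
    case (elim \<omega>)
    show ?case
    proof (rule summable_from_blocks[of \<omega>])
      show "summable (\<lambda>r. \<Sum>i<count r \<omega>. \<bar>jump (prod_encode (r, i)) \<omega>\<bar>)"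
      \<comment> \<open>Blocks 0 and 1 have positions arbitrarily near 0 and so unbounded jumps, but
        each holds finitely many points and leaves summability alone.\<close>
      proof (rule summable_comparison_test'[OF elim(2), where N = 2])
        fix r :: nat assume r: "2 \<le> r"
        have "\<bar>jump (prod_encode (r, i)) \<omega>\<bar> \<le> (c0 + c1) * real (r div 2) powr (- a)" for i
        proof -
          have "position (prod_encode (r, i)) \<omega> powr (- a) \<le> real (r div 2) powr (- a)"
            using a r elim(1) unfolding position_def by (intro powr_mono2') (auto intro: less_imp_le)
          moreover have "\<bar>weight r\<bar> \<le> c0 + c1" using c0 c1 by (simp add: weight_def)
          ultimately show ?thesis
            using c0 c1 by (auto simp: jump_def abs_mult intro!: mult_mono)
        qed
        then have "(\<Sum>i<count r \<omega>. \<bar>jump (prod_encode (r, i)) \<omega>\<bar>) \<le> (\<Sum>i<count r \<omega>. (c0 + c1) * real (r div 2) powr (- a))"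
          by (intro sum_mono)
        then show "norm (\<Sum>i<count r \<omega>. \<bar>jump (prod_encode (r, i)) \<omega>\<bar>) \<le> real (count r \<omega>) * ((c0 + c1) * real (r div 2) powr (- a))"
          by (simp add: sum_nonneg)
      qed
    qed (auto simp: jump_def)
  qed
qed

definition good :: "'b \<Rightarrow> bool" where
  "good \<omega> \<longleftrightarrow> summable (\<lambda>y. \<bar>jump y \<omega>\<bar>) \<and> inj (\<lambda>y. time y \<omega>) \<and>
    (\<forall>y. 0 < time y \<omega> \<and> time y \<omega> < 1) \<and> (\<forall>y. 0 < mark y \<omega> \<and> mark y \<omega> \<le> 1)"

lemma AE_good: "AE \<omega> in P. good \<omega>"
proof -
  have "AE \<omega> in P. \<forall>y z. y \<noteq> z \<longrightarrow> time y \<omega> \<noteq> time z \<omega>"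
    using AE_times_distinct by (auto simp: AE_all_countable)
  moreover have "AE \<omega> in P. \<forall>y. 0 < time y \<omega> \<and> time y \<omega> < 1"
    using AE_time_01 by (simp add: AE_all_countable)
  moreover have "AE \<omega> in P. \<forall>y. 0 < mark y \<omega> \<and> mark y \<omega> \<le> 1"
    using AE_mark_01 by (simp add: AE_all_countable)
  ultimately show ?thesis using AE_summable_jumps
    by eventually_elim (auto simp: good_def inj_def)
qed

text \<open>The exponential formula, with the time interval acting as a thinning: block
  \<open>r\<close> contributes the factor \<open>exp (- (t - s) * I r)\<close>. Summed over the even
  and over the odd blocks, the \<open>I r\<close> give the exponents of the positive and of the
  negative jumps.\<close>

lemma expectation_exp_increment:
  assumes st: "0 \<le> s" "s < t" "t \<le> 1"
  shows "(\<integral>\<omega>. exp (\<i> * of_real (\<theta> * (\<Sum>y. jump y \<omega> * of_bool (s < time y \<omega> \<and> time y \<omega> \<le> t)))) \<partial>P)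
    = exp (- of_real (t - s) * (stable_exponent a (\<i> * of_real (- \<theta> * c0)) + stable_exponent a (\<i> * of_real (\<theta> * c1))))"
proof -
  let ?b = "\<lambda>u. of_bool (s < u \<and> u \<le> t)"
  \<comment> \<open>The sign makes \<open>exp (- (z r * x))\<close> equal to
    \<open>exp (\<i> * \<theta> * weight r * x)\<close>. Being purely imaginary, \<open>z r\<close>
    lies on the boundary of the half-plane.\<close>
  define z where "z r = \<i> * of_real (- \<theta> * weight r)" for r
  define X where "X y \<omega> = jump y \<omega> * ?b (time y \<omega>)" for y \<omega>
  define G where "G r u v = exp (\<i> * of_real (\<theta> * (weight r * (real (r div 2) + u) powr (- a) * ?b v)))" for r u v
  define I where "I r = (\<integral>u. stable_integrand a (z r) (real (r div 2) + u) \<partial>unif)" for r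
  have G_eq: "G r u v = 1 - ?b v * stable_integrand a (z r) (real (r div 2) + u)" for r u v
    by (simp add: G_def stable_integrand_def z_def mult.assoc)
  have G_meas: "(\<lambda>p. G r (fst p) (snd p)) \<in> borel_measurable (borel \<Otimes>\<^sub>M borel)" for r
    unfolding G_def by measurable
  have G_norm: "norm (G r u v) \<le> 1" for r u v unfolding G_def by simp
  have Re_z: "0 \<le> Re (z r)" for r by (simp add: z_def)
  have EG: "(\<integral>\<omega>. G r (mark (prod_encode (r, i)) \<omega>) (time (prod_encode (r, i)) \<omega>) \<partial>P) = 1 - of_real (t - s) * I r" for r i
  proof -
    let ?f = "\<lambda>\<omega>. ?b (time (prod_encode (r, i)) \<omega>) * stable_integrand a (z r) (real (r div 2) + mark (prod_encode (r, i)) \<omega>)"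
    have int: "integrable P ?f"
      using norm_stable_integrand_le(1)[OF Re_z] by (intro integrable_const_bound[where B = 2]) (auto simp: norm_mult)
    have "(\<integral>\<omega>. ?f \<omega> \<partial>P) = integral\<^sup>L unif ?b * (\<integral>u. stable_integrand a (z r) (real (r div 2) + u) \<partial>unif)"
      unfolding time_def mark_def
      by (rule expectation_product[where C = 2]) (auto simp: prod_encode_eq norm_stable_integrand_le(1)[OF Re_z])
    moreover have "integral\<^sup>L unif ?b = complex_of_real (\<integral>u. ?b u \<partial>unif)"
      by (subst integral_complex_of_real[symmetric], rule Bochner_Integration.integral_cong) auto
    ultimately have "(\<integral>\<omega>. ?f \<omega> \<partial>P) = of_real (t - s) * I r"
      using st by (simp add: integral_unif_of_bool I_def)
    then show ?thesis unfolding G_eq using int by (simp add: prob_space)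
  qed
  have prod_G: "(\<Prod>r<R. \<Prod>i<count r \<omega>. G r (mark (prod_encode (r, i)) \<omega>) (time (prod_encode (r, i)) \<omega>)) =
    exp (\<i> * of_real (\<theta> * (\<Sum>r<R. \<Sum>i<count r \<omega>. X (prod_encode (r, i)) \<omega>)))" for R \<omega>
  proof -
    have "G r (mark (prod_encode (r, i)) \<omega>) (time (prod_encode (r, i)) \<omega>) = exp (\<i> * of_real (\<theta> * X (prod_encode (r, i)) \<omega>))"
      if "i < count r \<omega>" for r i
      using that by (simp add: G_def X_def jump_def present_def position_def)
    then show ?thesis by (simp add: exp_sum[symmetric] sum_distrib_left)
  qed
  \<comment> \<open>An even number of blocks keeps the two signs of each position interval
    together.\<close>
  have partial: "(\<integral>\<omega>. exp (\<i> * of_real (\<theta> * (\<Sum>r<2 * R. \<Sum>i<count r \<omega>. X (prod_encode (r, i)) \<omega>))) \<partial>P)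
    = exp (- of_real (t - s) * (\<Sum>r<2 * R. I r))" for R
  proof -
    have "(\<Sum>r<2 * R. 1 - of_real (t - s) * I r - 1) = (\<Sum>r<2 * R. - of_real (t - s) * I r)"
      by (intro sum.cong) (simp_all add: algebra_simps)
    also have "\<dots> = - of_real (t - s) * (\<Sum>r<2 * R. I r)" by (rule sum_distrib_left[symmetric])
    finally show ?thesis
      using expectation_blocks[of G "\<lambda>r. 1 - of_real (t - s) * I r" "2 * R", OF G_meas G_norm EG]
      unfolding prod_G by (simp only:)
  qed
  have "(\<lambda>R. \<integral>\<omega>. exp (\<i> * of_real (\<theta> * (\<Sum>r<2 * R. \<Sum>i<count r \<omega>. X (prod_encode (r, i)) \<omega>))) \<partial>P)
    \<longlonglongrightarrow> (\<integral>\<omega>. exp (\<i> * of_real (\<theta> * (\<Sum>y. X y \<omega>))) \<partial>P)"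
  proof (rule integral_dominated_convergence[where w = "\<lambda>_. 1"])
    have X_meas[measurable]: "X y \<in> borel_measurable P" for y unfolding X_def by measurable
    have "(\<lambda>\<omega>. \<Sum>i<count r \<omega>. X (prod_encode (r, i)) \<omega>) \<in> borel_measurable P" for r
      by (rule measurable_compose_countable[OF _ count_measurable]) measurable
    then show "(\<lambda>\<omega>. exp (\<i> * of_real (\<theta> * (\<Sum>r<2 * R. \<Sum>i<count r \<omega>. X (prod_encode (r, i)) \<omega>)))) \<in> borel_measurable P" for R
      by measurable
    show "(\<lambda>\<omega>. exp (\<i> * of_real (\<theta> * (\<Sum>y. X y \<omega>)))) \<in> borel_measurable P"
      by measurable
    show "AE \<omega> in P. (\<lambda>R. exp (\<i> * of_real (\<theta> * (\<Sum>r<2 * R. \<Sum>i<count r \<omega>. X (prod_encode (r, i)) \<omega>))))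
      \<longlonglongrightarrow> exp (\<i> * of_real (\<theta> * (\<Sum>y. X y \<omega>)))"
      using AE_good
    proof eventually_elim
      case (elim \<omega>)
      have "summable (\<lambda>y. \<bar>X y \<omega>\<bar>)"
        by (rule summable_comparison_test'[of "\<lambda>y. \<bar>jump y \<omega>\<bar>" 0]) (use elim in \<open>auto simp: good_def X_def\<close>)
      then have "(\<lambda>R. \<Sum>r<R. \<Sum>i<count r \<omega>. X (prod_encode (r, i)) \<omega>) \<longlonglongrightarrow> (\<Sum>y. X y \<omega>)"
        by (intro sum_blocks_tendsto) (auto simp: X_def jump_def)
      then have "(\<lambda>R. \<Sum>r<2 * R. \<Sum>i<count r \<omega>. X (prod_encode (r, i)) \<omega>) \<longlonglongrightarrow> (\<Sum>y. X y \<omega>)"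
        by (rule filterlim_compose) (auto intro!: filterlim_subseq simp: strict_mono_def)
      then show ?case by (intro tendsto_intros)
    qed
  qed auto
  moreover have "(\<lambda>R. exp (- of_real (t - s) * (\<Sum>r<2 * R. I r))) \<longlonglongrightarrow>
    exp (- of_real (t - s) * (stable_exponent a (z 0) + stable_exponent a (z 1)))"
  proof -
    have half: "(\<lambda>m. \<integral>u. stable_integrand a w (real m + u) \<partial>unif) sums stable_exponent a w" if "0 \<le> Re w" for w
    proof -
      have "(\<lambda>u. stable_integrand a w (real m + u)) \<in> borel_measurable borel" for m by measurable
      then show ?thesis
        using sums_unit_interval_integrals[OF integrable_stable_integrand[OF a that] stable_integrand_measurable]
        by (simp add: integral_unif stable_exponent_def)
    qed
    have "(\<Sum>r<2 * R. I r) = (\<Sum>m<R. \<integral>u. stable_integrand a (z 0) (real m + u) \<partial>unif)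
      + (\<Sum>m<R. \<integral>u. stable_integrand a (z 1) (real m + u) \<partial>unif)" for R
      by (simp add: sum_pairs I_def z_def weight_def sum.distrib)
    then show ?thesis
      using half[OF Re_z[of 0]] half[OF Re_z[of 1]] unfolding sums_def by (auto intro!: tendsto_intros)
  qed
  ultimately have "(\<integral>\<omega>. exp (\<i> * of_real (\<theta> * (\<Sum>y. X y \<omega>))) \<partial>P) =
    exp (- of_real (t - s) * (stable_exponent a (z 0) + stable_exponent a (z 1)))"
    unfolding partial by (rule LIMSEQ_unique)
  then show ?thesis by (simp add: X_def z_def weight_def)
qed

end

section \<open>Rounding the Poisson points to an array of cells\<close>

text \<open>Inverts the jump size: a jump of size \<open>g powr (- a)\<close> is rounded down to \<open>jump_level a n g\<close>
  units of size \<open>n powr (- a)\<close>.\<close>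

definition jump_level :: "real \<Rightarrow> nat \<Rightarrow> real \<Rightarrow> nat" where
  "jump_level a n g = nat \<lfloor>(real n / g) powr a\<rfloor>"

text \<open>Mean number of points in a cell of level \<open>l\<close>: the positions rounded to
  \<open>l div 2 + 1\<close> units have length \<open>n * intensity a l\<close>, and a time cell has
  length \<open>1 / n\<close>.\<close>

definition intensity :: "real \<Rightarrow> nat \<Rightarrow> real" where
  "intensity a l = real (Suc (l div 2)) powr (- 1 / a) - real (Suc (Suc (l div 2))) powr (- 1 / a)"

text \<open>Probability that a Poisson variable of mean \<open>intensity a l\<close> is not
  0.\<close>

definition occupation :: "real \<Rightarrow> nat \<Rightarrow> real" where
  "occupation a l = 1 - exp (- intensity a l)"

lemma jump_level_measurable [measurable]: "jump_level a n \<in> borel \<rightarrow>\<^sub>M count_space UNIV"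
  unfolding jump_level_def by measurable

lemma jump_level_eq_iff:
  assumes a: "1 < a" and n: "0 < n" and g: "0 < g" and k: "0 < k"
  shows "jump_level a n g = k \<longleftrightarrow> real n * real (Suc k) powr (- 1 / a) < g \<and> g \<le> real n * real k powr (- 1 / a)"
proof -
  have inv: "real j = (real j powr (1 / a)) powr a" for j using a by (simp add: powr_powr)
  have le: "real j \<le> (real n / g) powr a \<longleftrightarrow> g \<le> real n * real j powr (- 1 / a)" if "0 < j" for j
  proof -
    have "real j \<le> (real n / g) powr a \<longleftrightarrow> real j powr (1 / a) \<le> real n / g"
      by (subst inv, rule powr_le_powr_iff) (use a g in auto)
    also have "\<dots> \<longleftrightarrow> g * real j powr (1 / a) \<le> real n" using g by (simp add: field_simps)
    also have "\<dots> \<longleftrightarrow> g \<le> real n / real j powr (1 / a)" using that by (simp add: field_simps)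
    also have "real n / real j powr (1 / a) = real n * real j powr (- 1 / a)"
      by (simp add: powr_minus divide_inverse)
    finally show ?thesis .
  qed
  have "jump_level a n g = k \<longleftrightarrow> real k \<le> (real n / g) powr a \<and> \<not> real (Suc k) \<le> (real n / g) powr a"
    unfolding jump_level_def by (subst nat_floor_eq_iff) auto
  then show ?thesis using le[of k] le[of "Suc k"] k by (auto simp: not_le)
qed

lemma intensity_nonneg: "1 < a \<Longrightarrow> 0 \<le> intensity a l"
  unfolding intensity_def by (auto intro!: powr_mono2')

lemma occupation_bounds: "1 < a \<Longrightarrow> 0 \<le> occupation a l \<and> occupation a l \<le> 1"
  using intensity_nonneg[of a l] by (simp add: occupation_def)

lemma integral_jump_level:
  assumes a: "1 < a" and n: "0 < n"
  shows "(\<integral>g. indicator {0<..} g *\<^sub>R (of_bool (jump_level a n g = Suc (l div 2)) :: complex) \<partial>lborel)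
      = of_real (real n * intensity a l)"
    and "integrable lborel (\<lambda>g. indicator {0<..} g *\<^sub>R (of_bool (jump_level a n g = Suc (l div 2)) :: complex))"
proof -
  define u where "u = real n * real (Suc (Suc (l div 2))) powr (- 1 / a)"
  define v where "v = real n * real (Suc (l div 2)) powr (- 1 / a)"
  have uv: "0 \<le> u" "u \<le> v" unfolding u_def v_def using a by (auto intro!: mult_left_mono powr_mono2')
  have eq: "indicator {0<..} g *\<^sub>R (of_bool (jump_level a n g = Suc (l div 2)) :: complex) = of_real (indicator {u<..v} g)" for g
  proof (cases "0 < g")
    case True
    then show ?thesis using jump_level_eq_iff[OF a n True, of "Suc (l div 2)"]
      by (simp add: u_def v_def indicator_def)
  next
    case False
    then show ?thesis using uv by (simp add: indicator_def)
  qed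
  have m: "measure lborel {u<..v} = real n * intensity a l"
    using uv by (simp add: u_def v_def intensity_def right_diff_distrib)
  show "(\<integral>g. indicator {0<..} g *\<^sub>R (of_bool (jump_level a n g = Suc (l div 2)) :: complex) \<partial>lborel)
      = of_real (real n * intensity a l)"
    unfolding eq integral_complex_of_real using m by simp
  show "integrable lborel (\<lambda>g. indicator {0<..} g *\<^sub>R (of_bool (jump_level a n g = Suc (l div 2)) :: complex))"
    unfolding eq using uv by (intro integrable_of_real integrable_real_indicator) auto
qed

text \<open>Void probabilities determine the law of the array. With \<open>V c\<close> the event
  that \<open>c\<close> is void, requiring \<open>d\<close> to be occupied is the difference of two
  patterns with one occupied cell less, so the product formula propagates by induction on the
  occupied set.\<close>

lemma (in prob_space) prob_pattern_of_void_probabilities: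
  assumes V: "\<And>c. c \<in> R \<Longrightarrow> V c \<in> sets M"
    and void: "\<And>S. finite S \<Longrightarrow> S \<subseteq> R \<Longrightarrow> prob {x \<in> space M. \<forall>c\<in>S. x \<in> V c} = (\<Prod>c\<in>S. v c)"
    and "finite S" "finite S0" "S \<subseteq> R" "S0 \<subseteq> R" "S \<inter> S0 = {}"
  shows "prob {x \<in> space M. (\<forall>c\<in>S0. x \<in> V c) \<and> (\<forall>c\<in>S. x \<notin> V c)} = (\<Prod>c\<in>S0. v c) * (\<Prod>c\<in>S. 1 - v c)"
  using assms(3-)
proof (induction S arbitrary: S0 rule: finite_induct)
  case empty
  then show ?case using void[of S0] by simp
next
  case (insert d S)
  let ?E = "\<lambda>S S0. {x \<in> space M. (\<forall>c\<in>S0. x \<in> V c) \<and> (\<forall>c\<in>S. x \<notin> V c)}"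
  have E: "?E S' S0' \<in> sets M" if "finite S'" "finite S0'" "S' \<subseteq> R" "S0' \<subseteq> R" for S' S0'
  proof (rule sets.sets_Collect_conj)
    show "{x \<in> space M. \<forall>c\<in>S0'. x \<in> V c} \<in> sets M"
    proof (rule sets.sets_Collect_finite_All[OF _ that(2)])
      fix c assume "c \<in> S0'"
      then have "V c \<in> sets M" using that V by auto
      moreover from sets.sets_into_space[OF this] have "{x \<in> space M. x \<in> V c} = V c" by auto
      ultimately show "{x \<in> space M. x \<in> V c} \<in> sets M" by simp
    qed
    show "{x \<in> space M. \<forall>c\<in>S'. x \<notin> V c} \<in> sets M"
    proof (rule sets.sets_Collect_finite_All[OF _ that(1)])
      fix c assume "c \<in> S'"
      then have "space M - V c \<in> sets M" using that V by auto
      then show "{x \<in> space M. x \<notin> V c} \<in> sets M" by (simp add: set_diff_eq)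
    qed
  qed
  have "?E (insert d S) S0 = ?E S S0 - ?E S (insert d S0)" by auto
  moreover have "?E S (insert d S0) \<subseteq> ?E S S0" by auto
  ultimately have "prob (?E (insert d S) S0) = prob (?E S S0) - prob (?E S (insert d S0))"
    using finite_measure_Diff[OF E[of S S0] E[of S "insert d S0"]] insert.prems insert.hyps by simp
  also have "prob (?E S S0) = (\<Prod>c\<in>S0. v c) * (\<Prod>c\<in>S. 1 - v c)"
    using insert.prems insert.hyps by (intro insert.IH) auto
  also have "prob (?E S (insert d S0)) = (\<Prod>c\<in>insert d S0. v c) * (\<Prod>c\<in>S. 1 - v c)"
    using insert.prems insert.hyps by (intro insert.IH) auto
  also have "(\<Prod>c\<in>insert d S0. v c) = v d * (\<Prod>c\<in>S0. v c)"
    using insert.prems by (subst prod.insert) auto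
  finally show ?case using insert.hyps by (simp add: algebra_simps)
qed

text \<open>A level is \<open>2 * (k - 1)\<close> plus a sign bit, where \<open>k\<close> is the
  number of units and the bit is the parity of the block. Points rounded to 0 units belong to no
  cell.\<close>

definition in_cell :: "real \<Rightarrow> nat \<Rightarrow> nat \<times> nat \<Rightarrow> nat \<Rightarrow> real \<Rightarrow> real \<Rightarrow> bool" where
  "in_cell a n c r u t \<longleftrightarrow> r mod 2 = fst c mod 2 \<and> jump_level a n (real (r div 2) + u) = Suc (fst c div 2) \<and>
    nat \<lfloor>real n * t\<rfloor> = snd c"

lemma in_cell_unique:
  assumes "in_cell a n c r u t" "in_cell a n c' r u t"
  shows "c = c'"
proof -
  have "fst c mod 2 = fst c' mod 2" "fst c div 2 = fst c' div 2"
    using assms by (auto simp: in_cell_def)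
  then have "fst c = fst c'" by (metis div_mult_mod_eq)
  then show ?thesis using assms by (auto simp: in_cell_def prod_eq_iff)
qed

lemma in_cell_measurable [measurable]:
  assumes [measurable]: "f \<in> borel_measurable N" "g \<in> borel_measurable N"
  shows "Measurable.pred N (\<lambda>x. in_cell a n c r (f x) (g x))"
  unfolding in_cell_def by measurable

lemma integral_unif_time_cell:
  assumes "j < n"
  shows "(\<integral>t. of_bool (nat \<lfloor>real n * t\<rfloor> = j) \<partial>unif) = (1 / real n :: real)"
proof -
  have eq: "indicat_real {0<..1} t *\<^sub>R of_bool (nat \<lfloor>real n * t\<rfloor> = j)
    = indicat_real {0<..1} t *\<^sub>R (of_bool (real j / real n \<le> t \<and> t < real (Suc j) / real n) :: real)" for t
  proof (cases "0 < t")
    case True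
    have "nat \<lfloor>real n * t\<rfloor> = j \<longleftrightarrow> real j \<le> real n * t \<and> real n * t < real j + 1"
      using True by (intro nat_floor_eq_iff) auto
    also have "\<dots> \<longleftrightarrow> real j / real n \<le> t \<and> t < real (Suc j) / real n"
      using assms by (simp add: field_simps)
    finally show ?thesis by simp
  qed (simp add: indicator_def)
  have "(\<integral>t. of_bool (nat \<lfloor>real n * t\<rfloor> = j) \<partial>unif) = (\<integral>t. (of_bool (real j / real n \<le> t \<and> t < real (Suc j) / real n) :: real) \<partial>unif)"
  proof -
    have l: "(\<integral>t. (of_bool (nat \<lfloor>real n * t\<rfloor> = j) :: real) \<partial>unif) = (\<integral>t. indicat_real {0<..1} t *\<^sub>R of_bool (nat \<lfloor>real n * t\<rfloor> = j) \<partial>lborel)"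
      by (rule integral_unif) measurable
    have r: "(\<integral>t. (of_bool (real j / real n \<le> t \<and> t < real (Suc j) / real n) :: real) \<partial>unif)
      = (\<integral>t. indicat_real {0<..1} t *\<^sub>R of_bool (real j / real n \<le> t \<and> t < real (Suc j) / real n) \<partial>lborel)"
      by (rule integral_unif) measurable
    show ?thesis by (simp only: l r eq)
  qed
  also have "\<dots> = real (Suc j) / real n - real j / real n"
    using assms by (intro integral_unif_of_bool) (auto simp: divide_simps)
  also have "\<dots> = 1 / real n" using assms by (simp add: field_simps)
  finally show ?thesis .
qed

context stable_jumps begin

definition occupied :: "nat \<Rightarrow> nat \<times> nat \<Rightarrow> 'b \<Rightarrow> bool" where
  "occupied n c \<omega> \<longleftrightarrow> (\<exists>y. present y \<omega> \<and> in_cell a n c (fst (prod_decode y)) (mark y \<omega>) (time y \<omega>))"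

lemma occupied_measurable [measurable]: "Measurable.pred P (occupied n c)"
  unfolding occupied_def by measurable

text \<open>A point lies in at most one cell, so its void indicator is 1 minus a sum over
  \<open>S\<close>, and the mean is linear in the cells. The exponential formula then yields
  \<open>exp\<close> of minus the sum of the intensities, a product over \<open>S\<close>.\<close>

lemma prob_unoccupied:
  assumes n: "0 < n" and S: "finite S" and Sn: "\<And>c. c \<in> S \<Longrightarrow> snd c < n"
  shows "prob {\<omega> \<in> space P. \<forall>c\<in>S. \<not> occupied n c \<omega>} = (\<Prod>c\<in>S. exp (- intensity a (fst c)))"
proof -
  define G where "G r u t = (of_bool (\<forall>c\<in>S. \<not> in_cell a n c r u t) :: complex)" for r u t
  \<comment> \<open>Share of the \<open>m\<close>-th pair of blocks in the mean number of points in
    cell \<open>c\<close>, before the factor \<open>1 / n\<close> from the time.\<close>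
  define A where "A c m = (\<integral>u. of_bool (jump_level a n (real m + u) = Suc (fst c div 2)) \<partial>unif :: complex)" for c :: "nat \<times> nat" and m :: nat
  have G_eq: "G r u t = 1 - (\<Sum>c\<in>S. of_bool (nat \<lfloor>real n * t\<rfloor> = snd c) *
    (of_bool (r mod 2 = fst c mod 2) * of_bool (jump_level a n (real (r div 2) + u) = Suc (fst c div 2))))" for r u t
  proof -
    have "(\<Sum>c\<in>S. of_bool (in_cell a n c r u t)) = (of_bool (\<exists>c\<in>S. in_cell a n c r u t) :: complex)"
    proof (cases "\<exists>c\<in>S. in_cell a n c r u t")
      case True
      then obtain c0 where c0: "c0 \<in> S" "in_cell a n c0 r u t" by blast
      have "(\<Sum>c\<in>S. of_bool (in_cell a n c r u t)) = (\<Sum>c\<in>S. if c = c0 then 1 else 0 :: complex)"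
      proof (rule sum.cong[OF refl])
        show "of_bool (in_cell a n c r u t) = (if c = c0 then 1 else 0 :: complex)" for c
          using c0(2) in_cell_unique[of a n c r u t c0] by (cases "c = c0") auto
      qed
      also have "\<dots> = 1" using c0(1) S by simp
      finally show ?thesis using c0 by auto
    qed auto
    moreover have "of_bool (in_cell a n c r u t) = (of_bool (nat \<lfloor>real n * t\<rfloor> = snd c) *
      (of_bool (r mod 2 = fst c mod 2) * of_bool (jump_level a n (real (r div 2) + u) = Suc (fst c div 2))) :: complex)" for c
      by (auto simp: in_cell_def)
    moreover have "G r u t = 1 - of_bool (\<exists>c\<in>S. in_cell a n c r u t)" by (simp add: G_def)
    ultimately show ?thesis by (simp only:)
  qed
  have G_meas: "(\<lambda>p. G r (fst p) (snd p)) \<in> borel_measurable (borel \<Otimes>\<^sub>M borel)" for r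
    unfolding G_def using S by measurable
  have G_norm: "norm (G r u t) \<le> 1" for r u t by (simp add: G_def)
  have EG: "(\<integral>\<omega>. G r (mark (prod_encode (r, i)) \<omega>) (time (prod_encode (r, i)) \<omega>) \<partial>P) =
    1 - (\<Sum>c\<in>S. 1 / of_nat n * (of_bool (r mod 2 = fst c mod 2) * A c (r div 2)))" for r i
  proof -
    let ?f = "\<lambda>c \<omega>. of_bool (nat \<lfloor>real n * time (prod_encode (r, i)) \<omega>\<rfloor> = snd c) * (of_bool (r mod 2 = fst c mod 2) *
      of_bool (jump_level a n (real (r div 2) + mark (prod_encode (r, i)) \<omega>) = Suc (fst c div 2))) :: complex"
    have f_int: "integrable P (?f c)" for c
      by (rule integrable_const_bound[where B = 1]) (auto simp: norm_mult)
    have Ef: "(\<integral>\<omega>. ?f c \<omega> \<partial>P) = 1 / of_nat n * (of_bool (r mod 2 = fst c mod 2) * A c (r div 2))" if "c \<in> S" for c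
    proof -
      have "(\<integral>\<omega>. ?f c \<omega> \<partial>P) = (\<integral>t. of_bool (nat \<lfloor>real n * t\<rfloor> = snd c) \<partial>unif) *
        (\<integral>u. of_bool (r mod 2 = fst c mod 2) * of_bool (jump_level a n (real (r div 2) + u) = Suc (fst c div 2)) \<partial>unif)"
        unfolding time_def mark_def
        by (rule expectation_product[where C = 1]) (auto simp: prod_encode_eq norm_mult)
      moreover have "(\<integral>t. of_bool (nat \<lfloor>real n * t\<rfloor> = snd c) \<partial>unif) = complex_of_real (\<integral>t. of_bool (nat \<lfloor>real n * t\<rfloor> = snd c) \<partial>unif)"
        by (subst integral_complex_of_real[symmetric], rule Bochner_Integration.integral_cong) auto
      ultimately show ?thesis
        using Sn[OF that] by (simp add: integral_unif_time_cell A_def)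
    qed
    have "(\<integral>\<omega>. G r (mark (prod_encode (r, i)) \<omega>) (time (prod_encode (r, i)) \<omega>) \<partial>P) = 1 - (\<Sum>c\<in>S. \<integral>\<omega>. ?f c \<omega> \<partial>P)"
      unfolding G_eq using f_int by (subst Bochner_Integration.integral_diff) (auto simp: prob_space Bochner_Integration.integral_sum)
    then show ?thesis by (simp add: Ef)
  qed
  have prod_G: "(\<Prod>r<R. \<Prod>i<count r \<omega>. G r (mark (prod_encode (r, i)) \<omega>) (time (prod_encode (r, i)) \<omega>)) =
    of_bool (\<forall>r<R. \<forall>i<count r \<omega>. \<forall>c\<in>S. \<not> in_cell a n c r (mark (prod_encode (r, i)) \<omega>) (time (prod_encode (r, i)) \<omega>))" for R \<omega>
    unfolding G_def by (simp add: prod_of_bool) blast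
  let ?V = "{\<omega> \<in> space P. \<forall>c\<in>S. \<not> occupied n c \<omega>}"
  have V: "?V \<in> sets P" by (rule sets.sets_Collect_finite_All[OF _ S]) measurable
  then have [measurable]: "Measurable.pred P (\<lambda>\<omega>. \<forall>c\<in>S. \<not> occupied n c \<omega>)" unfolding pred_def .
  have lim1: "(\<lambda>R. \<integral>\<omega>. (\<Prod>r<2 * R. \<Prod>i<count r \<omega>. G r (mark (prod_encode (r, i)) \<omega>) (time (prod_encode (r, i)) \<omega>)) \<partial>P)
    \<longlonglongrightarrow> (\<integral>\<omega>. of_bool (\<forall>c\<in>S. \<not> occupied n c \<omega>) \<partial>P)"
  proof (rule integral_dominated_convergence[where w = "\<lambda>_. 1"])
    show "AE \<omega> in P. (\<lambda>R. \<Prod>r<2 * R. \<Prod>i<count r \<omega>. G r (mark (prod_encode (r, i)) \<omega>) (time (prod_encode (r, i)) \<omega>))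
      \<longlonglongrightarrow> of_bool (\<forall>c\<in>S. \<not> occupied n c \<omega>)"
    proof (rule AE_I2)
      fix \<omega>
      have "\<forall>\<^sub>F R in sequentially. (\<forall>r<2 * R. \<forall>i<count r \<omega>. \<forall>c\<in>S. \<not> in_cell a n c r (mark (prod_encode (r, i)) \<omega>) (time (prod_encode (r, i)) \<omega>))
        \<longleftrightarrow> (\<forall>c\<in>S. \<not> occupied n c \<omega>)"
      proof (cases "\<forall>c\<in>S. \<not> occupied n c \<omega>")
        case True
        have "\<not> in_cell a n c r (mark (prod_encode (r, i)) \<omega>) (time (prod_encode (r, i)) \<omega>)" if "i < count r \<omega>" "c \<in> S" for r i c
          using True that unfolding occupied_def
          by (auto dest!: bspec[of _ _ c] spec[of _ "prod_encode (r, i)"] simp: present_def)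
        then show ?thesis using True by auto
      next
        case False
        then obtain c y where cy: "c \<in> S" "present y \<omega>" "in_cell a n c (fst (prod_decode y)) (mark y \<omega>) (time y \<omega>)"
          unfolding occupied_def by blast
        have "\<forall>\<^sub>F R in sequentially. fst (prod_decode y) < R" by (rule eventually_gt_at_top)
        then show ?thesis
        proof eventually_elim
          case (elim R)
          obtain r i where ri: "prod_decode y = (r, i)" by (cases "prod_decode y")
          then have y: "y = prod_encode (r, i)" by (metis prod_decode_inverse)
          have "r < 2 * R" "i < count r \<omega>" "in_cell a n c r (mark (prod_encode (r, i)) \<omega>) (time (prod_encode (r, i)) \<omega>)"
            using cy(2,3) elim ri unfolding present_def y by auto
          then show ?case using cy(1) False by blast
        qed
      qed
      then show "(\<lambda>R. \<Prod>r<2 * R. \<Prod>i<count r \<omega>. G r (mark (prod_encode (r, i)) \<omega>) (time (prod_encode (r, i)) \<omega>))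
        \<longlonglongrightarrow> of_bool (\<forall>c\<in>S. \<not> occupied n c \<omega>)"
        unfolding prod_G by (intro tendsto_eventually) (auto elim: eventually_mono)
    qed
    show "(\<lambda>\<omega>. \<Prod>r<2 * R. \<Prod>i<count r \<omega>. G r (mark (prod_encode (r, i)) \<omega>) (time (prod_encode (r, i)) \<omega>)) \<in> borel_measurable P" for R
    proof (rule borel_measurable_prod)
      fix r
      have G_meas': "(\<lambda>\<omega>. G r (mark (prod_encode (r, i)) \<omega>) (time (prod_encode (r, i)) \<omega>)) \<in> borel_measurable P" for i
        using S unfolding G_def by measurable
      show "(\<lambda>\<omega>. \<Prod>i<count r \<omega>. G r (mark (prod_encode (r, i)) \<omega>) (time (prod_encode (r, i)) \<omega>)) \<in> borel_measurable P"
        by (rule measurable_compose_countable[OF _ count_measurable], rule borel_measurable_prod, rule G_meas')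
    qed
    show "(\<lambda>\<omega>. of_bool (\<forall>c\<in>S. \<not> occupied n c \<omega>)) \<in> borel_measurable P" by measurable
    show "AE \<omega> in P. norm (\<Prod>r<2 * R. \<Prod>i<count r \<omega>. G r (mark (prod_encode (r, i)) \<omega>) (time (prod_encode (r, i)) \<omega>)) \<le> 1" for R
      unfolding prod_G by simp
  qed simp
  have partial: "(\<integral>\<omega>. (\<Prod>r<2 * R. \<Prod>i<count r \<omega>. G r (mark (prod_encode (r, i)) \<omega>) (time (prod_encode (r, i)) \<omega>)) \<partial>P)
    = exp (- (\<Sum>c\<in>S. 1 / of_nat n * (\<Sum>m<R. A c m)))" for R
  proof -
    \<comment> \<open>Of the blocks \<open>2 * m\<close> and \<open>2 * m + 1\<close> exactly one
      has the parity of the level.\<close>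
    have par: "(\<Sum>r<2 * R. of_bool (r mod 2 = fst c mod 2) * A c (r div 2)) = (\<Sum>m<R. A c m)" for c :: "nat \<times> nat"
      unfolding sum_pairs
    proof (rule sum.cong[OF refl])
      fix m
      have "fst c mod 2 = 0 \<or> fst c mod 2 = 1" by presburger
      then show "of_bool (2 * m mod 2 = fst c mod 2) * A c (2 * m div 2) + of_bool (Suc (2 * m) mod 2 = fst c mod 2) * A c (Suc (2 * m) div 2) = A c m"
        by (elim disjE) simp_all
    qed
    have "(\<Sum>r<2 * R. (1 - (\<Sum>c\<in>S. 1 / of_nat n * (of_bool (r mod 2 = fst c mod 2) * A c (r div 2)))) - 1)
      = - (\<Sum>c\<in>S. 1 / of_nat n * (\<Sum>r<2 * R. of_bool (r mod 2 = fst c mod 2) * A c (r div 2)))"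
    proof -
      have cancel: "(\<Sum>r<2 * R. (1 - Y r) - 1) = - (\<Sum>r<2 * R. Y r)" for Y :: "nat \<Rightarrow> complex"
        by (simp add: sum_negf)
      have "(\<Sum>r<2 * R. (1 - (\<Sum>c\<in>S. 1 / of_nat n * (of_bool (r mod 2 = fst c mod 2) * A c (r div 2)))) - 1)
        = - (\<Sum>r<2 * R. \<Sum>c\<in>S. 1 / of_nat n * (of_bool (r mod 2 = fst c mod 2) * A c (r div 2)))"
        by (rule cancel)
      also have "(\<Sum>r<2 * R. \<Sum>c\<in>S. 1 / of_nat n * (of_bool (r mod 2 = fst c mod 2) * A c (r div 2)))
        = (\<Sum>c\<in>S. \<Sum>r<2 * R. 1 / of_nat n * (of_bool (r mod 2 = fst c mod 2) * A c (r div 2)))"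
        by (rule sum.swap)
      finally show ?thesis unfolding sum_distrib_left .
    qed
    then show ?thesis
      unfolding expectation_blocks[of G, OF G_meas G_norm EG] par by simp
  qed
  have lim2: "(\<lambda>R. exp (- (\<Sum>c\<in>S. 1 / of_nat n * (\<Sum>m<R. A c m)))) \<longlonglongrightarrow>
    exp (- (\<Sum>c\<in>S. 1 / of_nat n * of_real (real n * intensity a (fst c))))"
  proof -
    have "(\<lambda>m. A c m) sums of_real (real n * intensity a (fst c))" for c
    proof -
      have "(\<lambda>u. of_bool (jump_level a n (real m + u) = Suc (fst c div 2)) :: complex) \<in> borel_measurable borel" for m by measurable
      then show ?thesis
        using sums_unit_interval_integrals[OF integral_jump_level(2)[OF a n, of "fst c"]]
        unfolding A_def integral_jump_level(1)[OF a n] by (simp add: integral_unif)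
    qed
    then show ?thesis unfolding sums_def by (intro tendsto_intros)
  qed
  have "(\<integral>\<omega>. (of_bool (\<forall>c\<in>S. \<not> occupied n c \<omega>) :: complex) \<partial>P) =
    exp (- (\<Sum>c\<in>S. 1 / of_nat n * of_real (real n * intensity a (fst c))))"
    by (rule LIMSEQ_unique[OF lim1[unfolded partial] lim2])
  also have "\<dots> = complex_of_real (exp (- (\<Sum>c\<in>S. intensity a (fst c))))"
    using n by (simp add: exp_of_real[symmetric])
  also have "exp (- (\<Sum>c\<in>S. intensity a (fst c))) = (\<Prod>c\<in>S. exp (- intensity a (fst c)))"
    using S by (simp add: exp_sum sum_negf[symmetric])
  also have "(\<integral>\<omega>. of_bool (\<forall>c\<in>S. \<not> occupied n c \<omega>) \<partial>P) = complex_of_real (prob ?V)"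
  proof -
    have "(\<integral>\<omega>. of_bool (\<forall>c\<in>S. \<not> occupied n c \<omega>) \<partial>P) = (\<integral>\<omega>. complex_of_real (indicator ?V \<omega>) \<partial>P)"
      by (intro Bochner_Integration.integral_cong) (auto simp: indicator_def)
    with V show ?thesis by (simp add: less_top[symmetric] del: of_real_indicator)
  qed
  finally show ?thesis by (simp only: of_real_eq_iff)
qed

definition occupied_cells :: "nat \<Rightarrow> (nat \<times> nat) set \<Rightarrow> 'b \<Rightarrow> (nat \<times> nat) set" where
  "occupied_cells n R \<omega> = {c \<in> R. occupied n c \<omega>}"

lemma prob_occupied_cells:
  assumes n: "0 < n" and R: "finite R" and Rn: "\<And>c. c \<in> R \<Longrightarrow> snd c < n" and S: "S \<subseteq> R"
  shows "prob {\<omega> \<in> space P. occupied_cells n R \<omega> = S} = bernoulli_weight (occupation a) R S"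
proof -
  let ?V = "\<lambda>c. {\<omega> \<in> space P. \<not> occupied n c \<omega>}"
  have finS: "finite S" using R S finite_subset by blast
  have "{\<omega> \<in> space P. occupied_cells n R \<omega> = S} = {\<omega> \<in> space P. (\<forall>c\<in>R - S. \<omega> \<in> ?V c) \<and> (\<forall>c\<in>S. \<omega> \<notin> ?V c)}"
    using S by (auto simp: occupied_cells_def)
  also have "prob \<dots> = (\<Prod>c\<in>R - S. exp (- intensity a (fst c))) * (\<Prod>c\<in>S. 1 - exp (- intensity a (fst c)))"
  proof (rule prob_pattern_of_void_probabilities[where R = R])
    show "prob {\<omega> \<in> space P. \<forall>c\<in>S'. \<omega> \<in> ?V c} = (\<Prod>c\<in>S'. exp (- intensity a (fst c)))" if "finite S'" "S' \<subseteq> R" for S'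
    proof -
      have "{\<omega> \<in> space P. \<forall>c\<in>S'. \<omega> \<in> ?V c} = {\<omega> \<in> space P. \<forall>c\<in>S'. \<not> occupied n c \<omega>}" by auto
      moreover have "prob {\<omega> \<in> space P. \<forall>c\<in>S'. \<not> occupied n c \<omega>} = (\<Prod>c\<in>S'. exp (- intensity a (fst c)))"
        by (rule prob_unoccupied[OF n that(1)]) (use that(2) Rn in blast)
      ultimately show ?thesis by simp
    qed
  qed (use R S finS in auto)
  also have "\<dots> = bernoulli_weight (occupation a) R S"
    unfolding bernoulli_weight_def occupation_def using R S
    by (simp add: prod.If_cases Int_absorb1 Diff_eq mult.commute)
  finally show ?thesis .
qed

end

section \<open>Independence in the limit, and the paths of the array\<close>

lemma (in prob_space) indep_vars_limit:
  fixes X :: "nat \<Rightarrow> 'i \<Rightarrow> 'a \<Rightarrow> real"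
  assumes I: "finite I" and ind: "\<And>n. indep_vars (\<lambda>_. borel) (X n) I"
    and Y: "\<And>i. i \<in> I \<Longrightarrow> Y i \<in> borel_measurable M"
    and lim: "\<And>i. i \<in> I \<Longrightarrow> AE x in M. (\<lambda>n. X n i x) \<longlonglongrightarrow> Y i x"
  shows "indep_vars (\<lambda>_. borel) Y I"
proof (cases "I = {}")
  case True
  then show ?thesis by (simp add: indep_vars_def2 indep_sets_def)
next
  case False
  \<comment> \<open>\<open>UNIV\<close> is added because the finite criterion for independence wants
    the whole space in the generator.\<close>
  define E where "E = insert UNIV (range (\<lambda>b::real. {..b}))"
  have sets_E: "sets borel = sigma_sets UNIV E"
  proof -
    have "sets borel = sigma_sets UNIV (range (\<lambda>b::real. {..b}))"
      unfolding borel_eq_atMost by (rule sets_measure_of) auto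
    moreover have "sigma_sets UNIV E = sigma_sets UNIV (range (\<lambda>b::real. {..b}))"
      by (rule sigma_sets_eqI) (auto simp: E_def intro: sigma_sets_top)
    ultimately show ?thesis by simp
  qed
  text \<open>Continuous approximations from above to the indicators of sets in \<open>E\<close>.\<close>
  have approx: "\<exists>h :: nat \<Rightarrow> real \<Rightarrow> real. (\<forall>m. continuous_on UNIV (h m)) \<and> (\<forall>m u. 0 \<le> h m u \<and> h m u \<le> 1) \<and>
    (\<forall>u. (\<lambda>m. h m u) \<longlonglongrightarrow> indicator A u)" if "A \<in> E" for A
  proof (cases "A = UNIV")
    case True
    then show ?thesis by (intro exI[of _ "\<lambda>_ _. 1"]) auto
  next
    case False
    then have "\<exists>b. A = {..b}" using that by (auto simp: E_def)
    then obtain b where A: "A = {..b}" ..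
    define h where "h m u = max 0 (min 1 (1 - real m * (u - b)))" for m :: nat and u
    have "(\<lambda>m. h m u) \<longlonglongrightarrow> indicator A u" for u
    proof (cases "u \<le> b")
      case True
      then have "h m u = 1" for m
        unfolding h_def by (auto simp: min_def max_def mult_nonneg_nonpos)
      then show ?thesis using True A by simp
    next
      case False
      then have "filterlim (\<lambda>m. real m * (u - b)) at_top sequentially"
        by (intro filterlim_at_top_mult_tendsto_pos[OF tendsto_const _ filterlim_real_sequentially, of "u - b", simplified mult.commute]) auto
      then have "\<forall>\<^sub>F m in sequentially. 1 \<le> real m * (u - b)" by (simp add: filterlim_at_top)
      then have "\<forall>\<^sub>F m in sequentially. h m u = indicator A u"
        by eventually_elim (use False A in \<open>auto simp: h_def\<close>)
      then show ?thesis by (rule tendsto_eventually)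
    qed
    moreover have "continuous_on UNIV (h m)" for m unfolding h_def by (intro continuous_intros)
    moreover have "0 \<le> h m u \<and> h m u \<le> 1" for m u by (simp add: h_def)
    ultimately show ?thesis by blast
  qed
  have X_meas[measurable]: "X n i \<in> borel_measurable M" if "i \<in> I" for n i
    using ind[of n] that by (auto simp: indep_vars_def)
  \<comment> \<open>Expectations of products of bounded continuous functions still factor after the
    almost sure limit. Indicators of half-lines, which generate the Borel sets, follow by the
    approximation above.\<close>
  have cont: "(\<integral>x. (\<Prod>i\<in>I. h i (Y i x)) \<partial>M) = (\<Prod>i\<in>I. \<integral>x. h i (Y i x) \<partial>M)"
    if hc: "\<And>i. i \<in> I \<Longrightarrow> continuous_on UNIV (h i)" and hb: "\<And>i u. i \<in> I \<Longrightarrow> 0 \<le> h i u \<and> h i u \<le> (1::real)" for h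
  proof -
    have h_meas: "h i \<in> borel_measurable borel" if "i \<in> I" for i
      by (rule borel_measurable_continuous_onI[OF hc[OF that]])
    have lim_AE: "AE x in M. \<forall>i\<in>I. (\<lambda>n. h i (X n i x)) \<longlonglongrightarrow> h i (Y i x)"
    proof (rule AE_finite_allI[OF I])
      fix i assume i: "i \<in> I"
      then show "AE x in M. (\<lambda>n. h i (X n i x)) \<longlonglongrightarrow> h i (Y i x)"
        using lim[OF i] hc[OF i] by (auto elim!: eventually_mono intro: continuous_on_tendsto_compose)
    qed
    have lim1: "(\<lambda>n. \<integral>x. (\<Prod>i\<in>I. h i (X n i x)) \<partial>M) \<longlonglongrightarrow> (\<integral>x. (\<Prod>i\<in>I. h i (Y i x)) \<partial>M)"
    proof (rule integral_dominated_convergence[where w = "\<lambda>_. 1"])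
      show "(\<lambda>x. \<Prod>i\<in>I. h i (Y i x)) \<in> borel_measurable M"
        by (intro borel_measurable_prod measurable_compose[OF Y h_meas])
      show "(\<lambda>x. \<Prod>i\<in>I. h i (X n i x)) \<in> borel_measurable M" for n
        by (intro borel_measurable_prod measurable_compose[OF X_meas h_meas])
      show "AE x in M. (\<lambda>n. \<Prod>i\<in>I. h i (X n i x)) \<longlonglongrightarrow> (\<Prod>i\<in>I. h i (Y i x))"
        using lim_AE by eventually_elim (intro tendsto_prod, auto)
      show "AE x in M. norm (\<Prod>i\<in>I. h i (X n i x)) \<le> 1" for n
        using hb by (intro AE_I2) (auto simp: abs_prod intro!: prod_le_1)
    qed simp
    have lim2: "(\<lambda>n. \<Prod>i\<in>I. \<integral>x. h i (X n i x) \<partial>M) \<longlonglongrightarrow> (\<Prod>i\<in>I. \<integral>x. h i (Y i x) \<partial>M)"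
    proof (intro tendsto_prod integral_dominated_convergence[where w = "\<lambda>_. 1"])
      fix i assume i: "i \<in> I"
      show "(\<lambda>x. h i (Y i x)) \<in> borel_measurable M" by (rule measurable_compose[OF Y[OF i] h_meas[OF i]])
      show "(\<lambda>x. h i (X n i x)) \<in> borel_measurable M" for n by (rule measurable_compose[OF X_meas[OF i] h_meas[OF i]])
      show "AE x in M. (\<lambda>n. h i (X n i x)) \<longlonglongrightarrow> h i (Y i x)" using lim_AE i by (auto elim: eventually_mono)
      show "AE x in M. norm (h i (X n i x)) \<le> 1" for n using hb[OF i] by (intro AE_I2) auto
    qed simp
    have eq: "(\<integral>x. (\<Prod>i\<in>I. h i (X n i x)) \<partial>M) = (\<Prod>i\<in>I. \<integral>x. h i (X n i x) \<partial>M)" for n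
    proof (rule indep_vars_lebesgue_integral[OF I])
      show "indep_vars (\<lambda>_. borel) (\<lambda>i x. h i (X n i x)) I"
        by (rule indep_vars_compose2[OF ind]) (rule h_meas)
      show "integrable M (\<lambda>x. h i (X n i x))" if "i \<in> I" for i
        using hb[OF that] measurable_compose[OF X_meas[OF that] h_meas[OF that]]
        by (intro integrable_const_bound[where B = 1]) auto
    qed
    show ?thesis by (rule LIMSEQ_unique[OF lim1[unfolded eq] lim2])
  qed
  show ?thesis
  proof (subst indep_vars_finite[where E = "\<lambda>_. E"])
    show "Int_stable E"
    proof (rule Int_stableI)
      fix a b assume "a \<in> E" "b \<in> E"
      moreover have "{..x} \<inter> {..y} = {..min x y}" for x y :: real by auto
      ultimately show "a \<inter> b \<in> E" by (auto simp: E_def)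
    qed
    show "\<forall>A\<in>I \<rightarrow> E. prob (\<Inter>j\<in>I. Y j -` A j \<inter> space M) = (\<Prod>j\<in>I. prob (Y j -` A j \<inter> space M))"
    proof
      fix A assume A: "A \<in> I \<rightarrow> E"
      then have "\<forall>i\<in>I. \<exists>h :: nat \<Rightarrow> real \<Rightarrow> real. (\<forall>m. continuous_on UNIV (h m)) \<and> (\<forall>m u. 0 \<le> h m u \<and> h m u \<le> 1) \<and>
        (\<forall>u. (\<lambda>m. h m u) \<longlonglongrightarrow> indicator (A i) u)" using approx by blast
      then obtain h :: "'i \<Rightarrow> nat \<Rightarrow> real \<Rightarrow> real" where hc: "\<And>i m. i \<in> I \<Longrightarrow> continuous_on UNIV (h i m)"
        and hb: "\<And>i m u. i \<in> I \<Longrightarrow> 0 \<le> h i m u \<and> h i m u \<le> 1"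
        and hl: "\<And>i u. i \<in> I \<Longrightarrow> (\<lambda>m. h i m u) \<longlonglongrightarrow> indicator (A i) u" by metis
      have h_meas: "(\<lambda>x. h i m (Y i x)) \<in> borel_measurable M" if "i \<in> I" for i m
        by (rule measurable_compose[OF Y[OF that] borel_measurable_continuous_onI[OF hc[OF that]]])
      have A_sets: "A i \<in> sets borel" if "i \<in> I" for i
        using A that unfolding sets_E by (intro sigma_sets.Basic) auto
      have ind_meas: "(\<lambda>x. indicat_real (A i) (Y i x)) \<in> borel_measurable M" if "i \<in> I" for i
        by (rule measurable_compose[OF Y[OF that] borel_measurable_indicator[OF A_sets[OF that]]])
      have lim1: "(\<lambda>m. \<integral>x. (\<Prod>i\<in>I. h i m (Y i x)) \<partial>M) \<longlonglongrightarrow> (\<integral>x. (\<Prod>i\<in>I. indicator (A i) (Y i x)) \<partial>M)"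
      proof (rule integral_dominated_convergence[where w = "\<lambda>_. 1"])
        show "(\<lambda>x. \<Prod>i\<in>I. indicat_real (A i) (Y i x)) \<in> borel_measurable M"
          by (intro borel_measurable_prod ind_meas)
        show "(\<lambda>x. \<Prod>i\<in>I. h i m (Y i x)) \<in> borel_measurable M" for m
          by (intro borel_measurable_prod h_meas)
        show "AE x in M. (\<lambda>m. \<Prod>i\<in>I. h i m (Y i x)) \<longlonglongrightarrow> (\<Prod>i\<in>I. indicator (A i) (Y i x))"
          by (intro AE_I2 tendsto_prod hl)
        show "AE x in M. norm (\<Prod>i\<in>I. h i m (Y i x)) \<le> 1" for m
          using hb by (intro AE_I2) (auto simp: abs_prod intro!: prod_le_1)
      qed simp
      have lim2: "(\<lambda>m. \<Prod>i\<in>I. \<integral>x. h i m (Y i x) \<partial>M) \<longlonglongrightarrow> (\<Prod>i\<in>I. \<integral>x. indicator (A i) (Y i x) \<partial>M)"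
      proof (intro tendsto_prod integral_dominated_convergence[where w = "\<lambda>_. 1"])
        fix i assume i: "i \<in> I"
        show "(\<lambda>x. indicat_real (A i) (Y i x)) \<in> borel_measurable M" by (rule ind_meas[OF i])
        show "(\<lambda>x. h i m (Y i x)) \<in> borel_measurable M" for m by (rule h_meas[OF i])
        show "AE x in M. (\<lambda>m. h i m (Y i x)) \<longlonglongrightarrow> indicator (A i) (Y i x)" by (intro AE_I2 hl i)
        show "AE x in M. norm (h i m (Y i x)) \<le> 1" for m using hb[OF i] by (intro AE_I2) auto
      qed simp
      have eq: "(\<integral>x. (\<Prod>i\<in>I. h i m (Y i x)) \<partial>M) = (\<Prod>i\<in>I. \<integral>x. h i m (Y i x) \<partial>M)" for m
        by (rule cont[OF hc hb])
      have "(\<integral>x. (\<Prod>i\<in>I. indicat_real (A i) (Y i x)) \<partial>M) = (\<Prod>i\<in>I. \<integral>x. indicat_real (A i) (Y i x) \<partial>M)"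
        by (rule LIMSEQ_unique[OF lim1[unfolded eq] lim2])
      moreover have "(\<integral>x. indicat_real (A i) (Y i x) \<partial>M) = prob (Y i -` A i \<inter> space M)" if "i \<in> I" for i
      proof -
        have "(\<integral>x. indicat_real (A i) (Y i x) \<partial>M) = (\<integral>x. indicat_real (Y i -` A i \<inter> space M) x \<partial>M)"
          by (intro Bochner_Integration.integral_cong) (auto simp: indicator_def)
        then show ?thesis by simp
      qed
      moreover have "(\<integral>x. (\<Prod>i\<in>I. indicat_real (A i) (Y i x)) \<partial>M) = prob (\<Inter>j\<in>I. Y j -` A j \<inter> space M)"
      proof -
        have "(\<integral>x. (\<Prod>i\<in>I. indicat_real (A i) (Y i x)) \<partial>M) = (\<integral>x. indicat_real (\<Inter>j\<in>I. Y j -` A j \<inter> space M) x \<partial>M)"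
        proof (intro Bochner_Integration.integral_cong refl)
          fix x assume "x \<in> space M"
          have "(\<Prod>i\<in>I. indicat_real (A i) (Y i x)) = (\<Prod>i\<in>I. of_bool (Y i x \<in> A i))"
            by (intro prod.cong) (auto simp: indicator_def)
          also have "\<dots> = indicat_real (\<Inter>j\<in>I. Y j -` A j \<inter> space M) x"
            using I \<open>x \<in> space M\<close> by (auto simp: prod_of_bool indicator_def)
          finally show "(\<Prod>i\<in>I. indicat_real (A i) (Y i x)) = indicat_real (\<Inter>j\<in>I. Y j -` A j \<inter> space M) x" .
        qed
        moreover have "(\<Inter>j\<in>I. Y j -` A j \<inter> space M) \<in> sets M"
          using False I Y A_sets by (intro sets.finite_INT measurable_sets[of _ M borel]) auto
        ultimately show ?thesis by (simp add: Int_absorb2 sets.sets_into_space)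
      qed
      ultimately show "prob (\<Inter>j\<in>I. Y j -` A j \<inter> space M) = (\<Prod>j\<in>I. prob (Y j -` A j \<inter> space M))"
        by simp
    qed
  qed (use False I Y sets_E in \<open>auto simp: E_def\<close>)
qed

lemma (in prob_space) indep_vars_of_bool:
  assumes E: "\<And>i. i \<in> I \<Longrightarrow> Measurable.pred M (Q i)"
    and ind: "indep_events (\<lambda>i. {x \<in> space M. Q i x}) I"
  shows "indep_vars (\<lambda>_. borel) (\<lambda>i x. of_bool (Q i x) :: real) I"
  unfolding indep_vars_def2
proof
  show "\<forall>i\<in>I. (\<lambda>x. of_bool (Q i x) :: real) \<in> borel_measurable M"
  proof
    fix i assume "i \<in> I"
    from E[OF this] have [measurable]: "Measurable.pred M (Q i)" .
    show "(\<lambda>x. of_bool (Q i x) :: real) \<in> borel_measurable M" by measurable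
  qed
  have "indep_sets (\<lambda>i. sigma_sets (space M) {{x \<in> space M. Q i x}}) I"
    using ind unfolding indep_events_def_alt by (rule indep_sets_sigma) (auto simp: Int_stable_def)
  then show "indep_sets (\<lambda>i. {(\<lambda>x. of_bool (Q i x) :: real) -` A \<inter> space M |A. A \<in> sets borel}) I"
  proof (rule indep_sets_mono_sets)
    fix i
    let ?E = "{x \<in> space M. Q i x}"
    show "{(\<lambda>x. of_bool (Q i x) :: real) -` A \<inter> space M |A. A \<in> sets borel} \<subseteq> sigma_sets (space M) {?E}"
    proof safe
      fix A :: "real set"
      have sg: "?E \<in> sigma_sets (space M) {?E}" "space M - ?E \<in> sigma_sets (space M) {?E}"
        "{} \<in> sigma_sets (space M) {?E}" "space M \<in> sigma_sets (space M) {?E}"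
        by (auto intro: sigma_sets.intros sigma_sets_top)
      have "(\<lambda>x. of_bool (Q i x) :: real) -` A \<inter> space M = (if 1 \<in> A then if 0 \<in> A then space M else ?E
        else if 0 \<in> A then space M - ?E else {})"
        by (auto simp: of_bool_def split: if_splits)
      then show "(\<lambda>x. of_bool (Q i x) :: real) -` A \<inter> space M \<in> sigma_sets (space M) {?E}"
        using sg by (simp split: if_splits)
    qed
  qed
qed

text \<open>Mirrors \<open>partial_sum_process\<close>: a Birkhoff sum of length \<open>m\<close>
  runs over \<open>j < m\<close>, so a cell with time \<open>j\<close> enters only at
  \<open>t = (j + 1) / n\<close>. The set \<open>S\<close> will be the occupied cells of the array
  or the itinerary of a point.\<close>

definition cell_path :: "(nat \<Rightarrow> real) \<Rightarrow> real \<Rightarrow> nat \<Rightarrow> (nat \<times> nat) set \<Rightarrow> real \<Rightarrow> real" where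
  "cell_path v a n S t = real n powr (- a) * (\<Sum>c\<in>S. v (fst c) * of_bool (snd c < nat \<lfloor>real n * t\<rfloor>))"

context stable_jumps begin

text \<open>Signed size of level \<open>l\<close> in multiples of \<open>n powr (- a)\<close>. As
  \<open>weight\<close> looks at parity alone, it reads the sign bit of a level just like that of a
  block.\<close>

definition jump_value :: "nat \<Rightarrow> real" where
  "jump_value l = weight l * real (Suc (l div 2))"

lemma indep_occupied:
  assumes n: "0 < n" and R: "finite R" and Rn: "\<And>c. c \<in> R \<Longrightarrow> snd c < n"
  shows "indep_vars (\<lambda>_. borel) (\<lambda>c \<omega>. of_bool (occupied n c \<omega>) :: real) R"
proof (rule indep_vars_of_bool)
  let ?V = "\<lambda>c. {\<omega> \<in> space P. \<not> occupied n c \<omega>}"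
  have J: "prob {\<omega> \<in> space P. \<forall>c\<in>J. occupied n c \<omega>} = (\<Prod>c\<in>J. 1 - exp (- intensity a (fst c)))" if "finite J" "J \<subseteq> R" for J
  proof -
    have "prob {\<omega> \<in> space P. (\<forall>c\<in>({} :: (nat \<times> nat) set). \<omega> \<in> ?V c) \<and> (\<forall>c\<in>J. \<omega> \<notin> ?V c)} =
      (\<Prod>c\<in>({} :: (nat \<times> nat) set). exp (- intensity a (fst c))) * (\<Prod>c\<in>J. 1 - exp (- intensity a (fst c)))"
    proof (rule prob_pattern_of_void_probabilities[where R = R])
      show "prob {\<omega> \<in> space P. \<forall>c\<in>S'. \<omega> \<in> ?V c} = (\<Prod>c\<in>S'. exp (- intensity a (fst c)))" if "finite S'" "S' \<subseteq> R" for S'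
      proof -
        have "prob {\<omega> \<in> space P. \<forall>c\<in>S'. \<not> occupied n c \<omega>} = (\<Prod>c\<in>S'. exp (- intensity a (fst c)))"
          by (rule prob_unoccupied[OF n that(1)]) (use that(2) Rn in blast)
        moreover have "{\<omega> \<in> space P. \<forall>c\<in>S'. \<omega> \<in> ?V c} = {\<omega> \<in> space P. \<forall>c\<in>S'. \<not> occupied n c \<omega>}" by auto
        ultimately show ?thesis by simp
      qed
    qed (use that in auto)
    moreover have "{\<omega> \<in> space P. (\<forall>c\<in>({} :: (nat \<times> nat) set). \<omega> \<in> ?V c) \<and> (\<forall>c\<in>J. \<omega> \<notin> ?V c)} = {\<omega> \<in> space P. \<forall>c\<in>J. occupied n c \<omega>}" by auto
    ultimately show ?thesis by simp
  qed
  show "indep_events (\<lambda>c. {\<omega> \<in> space P. occupied n c \<omega>}) R"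
    unfolding indep_events_def
  proof (intro conjI allI impI)
    fix K assume K: "K \<subseteq> R" "K \<noteq> {}" "finite K"
    have "(\<Inter>c\<in>K. {\<omega> \<in> space P. occupied n c \<omega>}) = {\<omega> \<in> space P. \<forall>c\<in>K. occupied n c \<omega>}" using K(2) by auto
    moreover have "prob {\<omega> \<in> space P. occupied n c \<omega>} = 1 - exp (- intensity a (fst c))" if "c \<in> K" for c
      using J[of "{c}"] that K by auto
    ultimately show "prob (\<Inter>c\<in>K. {\<omega> \<in> space P. occupied n c \<omega>}) = (\<Prod>c\<in>K. prob {\<omega> \<in> space P. occupied n c \<omega>})"
      using J[OF K(3,1)] by simp
  qed auto
qed measurable

text \<open>Increments over disjoint time intervals read disjoint sets of columns of the independent
  array.\<close>

lemma indep_cell_path_increments: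
  assumes n: "0 < n" and R: "finite R" and Rn: "\<And>c. c \<in> R \<Longrightarrow> snd c < n"
    and s: "\<And>i. i < k \<Longrightarrow> s i \<le> s (Suc i)"
  shows "indep_vars (\<lambda>_. borel) (\<lambda>i \<omega>. cell_path jump_value a n (occupied_cells n R \<omega>) (s (Suc i))
    - cell_path jump_value a n (occupied_cells n R \<omega>) (s i)) {..<k}"
proof -
  define K where "K i = {c \<in> R. nat \<lfloor>real n * s i\<rfloor> \<le> snd c \<and> snd c < nat \<lfloor>real n * s (Suc i)\<rfloor>}" for i
  define F where "F i v = real n powr (- a) * (\<Sum>c\<in>K i. jump_value (fst c) * v c)" for i and v :: "nat \<times> nat \<Rightarrow> real"
  have mono: "nat \<lfloor>real n * s i\<rfloor> \<le> nat \<lfloor>real n * s j\<rfloor>" if "i \<le> j" "j \<le> k" for i j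
    using that
  proof (induction j rule: dec_induct)
    case (step j)
    have "real n * s j \<le> real n * s (Suc j)" using s[of j] step.prems by (intro mult_left_mono) auto
    then show ?case using step by (intro order_trans[OF step.IH] nat_mono floor_mono) auto
  qed simp
  have disj: "disjoint_family_on K {..<k}"
    unfolding disjoint_family_on_def
  proof (intro ballI impI)
    have "K i \<inter> K j = {}" if "i < j" "j < k" for i j
      using mono[of "Suc i" j] that by (auto simp: K_def)
    then show "K i \<inter> K j = {}" if "i \<in> {..<k}" "j \<in> {..<k}" "i \<noteq> j" for i j
      using that by (metis Int_commute lessThan_iff linorder_neqE_nat)
  qed
  have "indep_vars (\<lambda>_. borel) (\<lambda>i \<omega>. F i (restrict (\<lambda>c. of_bool (occupied n c \<omega>)) (K i))) {..<k}"
  proof (rule indep_vars_compose2[OF indep_vars_restrict[OF indep_occupied[OF n R Rn] _ disj]])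
    show "F i \<in> PiM (K i) (\<lambda>_. borel) \<rightarrow>\<^sub>M borel" for i
      unfolding F_def by (intro borel_measurable_times borel_measurable_const borel_measurable_sum measurable_component_singleton) auto
  qed (auto simp: K_def)
  moreover have "F i (restrict (\<lambda>c. of_bool (occupied n c \<omega>)) (K i)) = cell_path jump_value a n (occupied_cells n R \<omega>) (s (Suc i))
    - cell_path jump_value a n (occupied_cells n R \<omega>) (s i)" if "i < k" for i \<omega>
  proof -
    have part: "(\<Sum>c\<in>occupied_cells n R \<omega>. jump_value (fst c) * of_bool (snd c < m)) =
      (\<Sum>c\<in>R. jump_value (fst c) * of_bool (occupied n c \<omega>) * of_bool (snd c < m))" for m
      unfolding occupied_cells_def by (subst sum.inter_filter[OF R], rule sum.cong) auto
    have "(\<Sum>c\<in>R. jump_value (fst c) * of_bool (occupied n c \<omega>) * of_bool (snd c < nat \<lfloor>real n * s (Suc i)\<rfloor>)) -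
      (\<Sum>c\<in>R. jump_value (fst c) * of_bool (occupied n c \<omega>) * of_bool (snd c < nat \<lfloor>real n * s i\<rfloor>)) =
      (\<Sum>c\<in>R. if c \<in> K i then jump_value (fst c) * of_bool (occupied n c \<omega>) else 0)"
      unfolding sum_subtractf[symmetric] using mono[of i "Suc i"] that
      by (intro sum.cong) (auto simp: K_def)
    also have "\<dots> = (\<Sum>c\<in>K i. jump_value (fst c) * of_bool (occupied n c \<omega>))"
      by (subst sum.inter_restrict[OF R, symmetric], rule sum.cong) (auto simp: K_def)
    finally show ?thesis
      by (simp add: F_def cell_path_def part right_diff_distrib[symmetric])
  qed
  ultimately show ?thesis by (subst indep_vars_cong[OF refl _ refl]) auto
qed

end

lemma in_cell_own:
  assumes "1 \<le> jump_level a n (real (r div 2) + u)"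
  shows "in_cell a n (2 * (jump_level a n (real (r div 2) + u) - 1) + r mod 2, nat \<lfloor>real n * t\<rfloor>) r u t"
proof -
  have "(2 * m + r mod 2) div 2 = m" "(2 * m + r mod 2) mod 2 = r mod 2" for m by presburger+
  then show ?thesis using assms by (simp add: in_cell_def)
qed

lemma filterlim_powr_sequentially:
  assumes p: "0 < p"
  shows "filterlim (\<lambda>n. real n powr p) at_top sequentially"
  unfolding filterlim_at_top_gt[of _ _ 0]
proof (intro allI impI)
  fix Z :: real assume "0 < Z"
  show "\<forall>\<^sub>F n in sequentially. Z \<le> real n powr p"
    using eventually_ge_at_top[of "nat \<lceil>Z powr (1 / p)\<rceil>"]
  proof eventually_elim
    case (elim n)
    have "Z = (Z powr (1 / p)) powr p" using \<open>0 < Z\<close> p by (simp add: powr_powr)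
    also have "\<dots> \<le> real n powr p"
      using elim p by (intro powr_mono2) (auto simp: nat_le_iff ceiling_le_iff)
    finally show ?case .
  qed
qed

lemma nat_floor_bounds: "0 \<le> x \<Longrightarrow> real (nat \<lfloor>x\<rfloor>) \<le> x" "x < real (nat \<lfloor>x\<rfloor>) + 1"
  by linarith+

lemma sum_eq_suminf:
  fixes g :: "nat \<Rightarrow> real"
  assumes "finite A" "\<And>y. y \<notin> A \<Longrightarrow> g y = 0"
  shows "suminf g = sum g A"
  using assms by (rule suminf_finite)

context stable_jumps begin

definition path :: "'b \<Rightarrow> real \<Rightarrow> real" where
  "path \<omega> = jump_path (\<lambda>y. jump y \<omega>) (\<lambda>y. time y \<omega>)"

text \<open>Below level \<open>n\<close> the itineraries are not controlled over \<open>n\<close>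
  times; the cut-off \<open>B n\<close> makes the set of cells finite.\<close>

definition window :: "(nat \<Rightarrow> nat) \<Rightarrow> nat \<Rightarrow> (nat \<times> nat) set" where
  "window B n = {n..<B n} \<times> {..<n}"

text \<open>The path of the array is itself a jump series over the same indices \<open>y\<close>,
  dominated by the jumps of the limit and converging to them term by term, as
  \<open>jump_path_J1_approximation\<close> asks. Each occupied cell is credited to one of its
  points, since the array counts a cell once even if it holds several.\<close>

lemma discretised_jumps:
  assumes good: "good \<omega>" and B: "filterlim (\<lambda>n. real (B n) / real n powr a) at_top sequentially"
  shows "\<exists>x' \<tau>'. (\<forall>n y. \<bar>x' n y\<bar> \<le> \<bar>jump y \<omega>\<bar>) \<and> (\<forall>y. (\<lambda>n. x' n y) \<longlonglongrightarrow> jump y \<omega>) \<and>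
    (\<forall>y. (\<lambda>n. \<tau>' n y) \<longlonglongrightarrow> time y \<omega>) \<and>
    (\<forall>n>0. \<forall>t\<in>{0..1}. cell_path jump_value a n (occupied_cells n (window B n) \<omega>) t = jump_path (x' n) (\<tau>' n) t)"
proof -
  define L where "L n y = jump_level a n (position y \<omega>)" for n y
  define cellof where "cellof n y = (2 * (L n y - 1) + fst (prod_decode y) mod 2, nat \<lfloor>real n * time y \<omega>\<rfloor>)" for n y
  define hit where "hit n y \<longleftrightarrow> present y \<omega> \<and> 1 \<le> L n y" for n y
  \<comment> \<open>The least index in a cell represents it. Against a given \<open>y\<close> only
    finitely many smaller indices compete, and their distinct times separate them from
    \<open>y\<close> once \<open>n\<close> is large.\<close>
  define rep where "rep n y \<longleftrightarrow> hit n y \<and> cellof n y \<in> window B n \<and> (\<forall>z<y. \<not> (hit n z \<and> cellof n z = cellof n y))" for n y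
  define x' where "x' n y = (if rep n y then real n powr (- a) * jump_value (fst (cellof n y)) else 0)" for n y
  \<comment> \<open>End of the time cell, where \<open>cell_path\<close> lets it enter.\<close>
  define \<tau>' where "\<tau>' n y = real (Suc (nat \<lfloor>real n * time y \<omega>\<rfloor>)) / real n" for n y
  have pos: "0 < position y \<omega>" for y
    using good unfolding good_def position_def by (auto intro: add_nonneg_pos)
  have time01: "0 < time y \<omega>" "time y \<omega> < 1" for y using good by (auto simp: good_def)
  define Gm where "Gm y = position y \<omega> powr a" for y
  have Gm: "0 < Gm y" for y using pos[of y] by (simp add: Gm_def)
  have Gm_inv: "position y \<omega> powr (- a) = 1 / Gm y" for y by (simp add: Gm_def powr_minus divide_inverse)
  have L_bounds: "real (L n y) \<le> real n powr a / Gm y" "real n powr a / Gm y < real (L n y) + 1" for n y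
  proof -
    have "(real n / position y \<omega>) powr a = real n powr a / Gm y"
      unfolding Gm_def by (rule powr_divide)
    then show "real (L n y) \<le> real n powr a / Gm y" "real n powr a / Gm y < real (L n y) + 1"
      using nat_floor_bounds[of "real n powr a / Gm y"] Gm[of y] by (simp_all add: L_def jump_level_def)
  qed
  have scaled_L: "real n powr (- a) * real (L n y) \<le> 1 / Gm y" for n y
  proof (cases "n = 0")
    case False
    have "real n powr (- a) * real (L n y) \<le> real n powr (- a) * (real n powr a / Gm y)"
      by (rule mult_left_mono[OF L_bounds(1)]) simp
    also have "\<dots> = 1 / Gm y" using False by (simp add: powr_minus)
    finally show ?thesis .
  qed (use Gm[of y] in \<open>auto intro: less_imp_le\<close>)
  have cell_value: "jump_value (fst (cellof n y)) = weight (fst (prod_decode y)) * real (L n y)" if "hit n y" for n y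
  proof -
    have "(2 * m + r mod 2) div 2 = m" "even (2 * m + r mod 2) = even r" for m r :: nat by presburger+
    then show ?thesis using that by (simp add: jump_value_def weight_def cellof_def hit_def)
  qed
  have le: "\<bar>x' n y\<bar> \<le> \<bar>jump y \<omega>\<bar>" for n y
  proof (cases "rep n y")
    case True
    then have h: "hit n y" "present y \<omega>" by (auto simp: rep_def hit_def)
    have "\<bar>x' n y\<bar> = \<bar>weight (fst (prod_decode y))\<bar> * (real n powr (- a) * real (L n y))"
      using True by (simp add: x'_def cell_value[OF h(1)] abs_mult)
    also have "\<dots> \<le> \<bar>weight (fst (prod_decode y))\<bar> * (1 / Gm y)"
      by (intro mult_left_mono scaled_L) simp
    also have "\<dots> = \<bar>jump y \<omega>\<bar>" using h(2) Gm[of y] by (simp add: jump_def abs_mult Gm_inv)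
    finally show ?thesis .
  qed (simp add: x'_def)
  have lim_\<tau>: "(\<lambda>n. \<tau>' n y) \<longlonglongrightarrow> time y \<omega>" for y
  proof (rule tendsto_sandwich)
    have b: "time y \<omega> \<le> \<tau>' n y \<and> \<tau>' n y \<le> time y \<omega> + 1 / real n" if "0 < n" for n
    proof -
      have "real (nat \<lfloor>real n * time y \<omega>\<rfloor>) \<le> real n * time y \<omega>" "real n * time y \<omega> < real (nat \<lfloor>real n * time y \<omega>\<rfloor>) + 1"
        using nat_floor_bounds[of "real n * time y \<omega>"] time01[of y] by simp_all
      then show ?thesis using that by (simp add: \<tau>'_def field_simps)
    qed
    show "\<forall>\<^sub>F n in sequentially. time y \<omega> \<le> \<tau>' n y" "\<forall>\<^sub>F n in sequentially. \<tau>' n y \<le> time y \<omega> + 1 / real n"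
      using b by (auto intro!: eventually_mono[OF eventually_gt_at_top[of 0]])
    have "(\<lambda>n. time y \<omega> + 1 / real n) \<longlonglongrightarrow> time y \<omega> + 0" by (intro tendsto_intros lim_1_over_n)
    then show "(\<lambda>n. time y \<omega> + 1 / real n) \<longlonglongrightarrow> time y \<omega>" by simp
  qed simp
  have lim: "(\<lambda>n. x' n y) \<longlonglongrightarrow> jump y \<omega>" for y
  proof (cases "present y \<omega>")
    case False
    then show ?thesis by (simp add: x'_def rep_def hit_def jump_def)
  next
    case True
    have "filterlim (\<lambda>n. real n powr (a - 1)) at_top sequentially"
      using a by (intro filterlim_powr_sequentially) simp
    \<comment> \<open>\<open>L n y\<close> is of order \<open>n powr a / Gm y\<close>.
      \<open>ev1\<close> lifts it to \<open>3 * n\<close>, with ample room above the lower edge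
      \<open>n\<close> of the window; \<open>ev2\<close> keeps the level below \<open>B n\<close>,
      which is why \<open>B n\<close> has to outgrow \<open>n powr a\<close>.\<close>
    then have ev1: "\<forall>\<^sub>F n in sequentially. 3 * Gm y \<le> real n powr (a - 1)" by (simp add: filterlim_at_top)
    have ev2: "\<forall>\<^sub>F n in sequentially. 2 / Gm y \<le> real (B n) / real n powr a" using B by (simp add: filterlim_at_top)
    have ev3: "\<forall>\<^sub>F n in sequentially. \<forall>z\<in>{..<y}. nat \<lfloor>real n * time z \<omega>\<rfloor> \<noteq> nat \<lfloor>real n * time y \<omega>\<rfloor>"
    proof (rule eventually_ball_finite, simp, intro ballI)
      fix z assume "z \<in> {..<y}"
      then have ne: "time z \<omega> \<noteq> time y \<omega>" using good by (auto simp: good_def inj_def)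
      have "filterlim (\<lambda>n. \<bar>time z \<omega> - time y \<omega>\<bar> * real n) at_top sequentially"
        using ne by (intro filterlim_tendsto_pos_mult_at_top[OF tendsto_const _ filterlim_real_sequentially]) simp
      then have "\<forall>\<^sub>F n in sequentially. 1 \<le> \<bar>time z \<omega> - time y \<omega>\<bar> * real n" by (simp add: filterlim_at_top)
      then show "\<forall>\<^sub>F n in sequentially. nat \<lfloor>real n * time z \<omega>\<rfloor> \<noteq> nat \<lfloor>real n * time y \<omega>\<rfloor>"
      proof eventually_elim
        case (elim n)
        have "\<bar>time z \<omega> - time y \<omega>\<bar> * real n = \<bar>real n * time z \<omega> - real n * time y \<omega>\<bar>"
        proof -
          have "real n * time z \<omega> - real n * time y \<omega> = (time z \<omega> - time y \<omega>) * real n" by (simp add: algebra_simps)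
          then show ?thesis by (simp only: abs_mult abs_of_nat)
        qed
        then show ?case
          using elim nat_floor_bounds[of "real n * time z \<omega>"] nat_floor_bounds[of "real n * time y \<omega>"]
            mult_nonneg_nonneg[of "real n" "time y \<omega>"] mult_nonneg_nonneg[of "real n" "time z \<omega>"] time01[of y] time01[of z]
          by (intro notI) linarith
      qed
    qed
    have "\<forall>\<^sub>F n in sequentially. rep n y"
      using ev1 ev2 ev3 eventually_gt_at_top[of 0]
    proof eventually_elim
      case (elim n)
      have "real n powr a = real n * real n powr (a - 1)"
        using elim(4) powr_add[of "real n" 1 "a - 1"] by simp
      then have "real n * (3 * Gm y) \<le> real n powr a"
        using elim(1) by (simp add: mult_left_mono)
      then have "3 * real n \<le> real n powr a / Gm y" using Gm[of y] by (simp add: pos_le_divide_eq mult_ac)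
      then have L3: "3 * real n < real (L n y) + 1" using L_bounds(2)[of n y] by linarith
      then have L1: "3 * n \<le> L n y" by linarith
      have h: "hit n y" using True L1 elim(4) by (simp add: hit_def)
      have up: "2 * L n y \<le> B n"
      proof -
        have "2 * real (L n y) \<le> 2 * (real n powr a / Gm y)" using L_bounds(1)[of n y] by simp
        also have "\<dots> = 2 / Gm y * real n powr a" by simp
        also have "\<dots> \<le> real (B n)" using elim(2,4) by (simp add: pos_le_divide_eq)
        finally show ?thesis by linarith
      qed
      have t: "nat \<lfloor>real n * time y \<omega>\<rfloor> < n"
      proof -
        have "real n * time y \<omega> < real n" using time01[of y] elim(4) by simp
        then show ?thesis using time01[of y] by (simp add: floor_less_iff nat_less_iff)
      qed
      have "n \<le> 2 * (L n y - 1) + fst (prod_decode y) mod 2" "2 * (L n y - 1) + fst (prod_decode y) mod 2 < B n"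
      proof -
        have "fst (prod_decode y) mod 2 < 2" by simp
        then show "n \<le> 2 * (L n y - 1) + fst (prod_decode y) mod 2" "2 * (L n y - 1) + fst (prod_decode y) mod 2 < B n"
          using L1 up elim(4) by linarith+
      qed
      then have "cellof n y \<in> window B n" using t by (simp add: window_def cellof_def)
      moreover have "cellof n z \<noteq> cellof n y" if "z < y" for z
        using elim(3) that by (auto simp: cellof_def)
      ultimately show ?case using h by (auto simp: rep_def)
    qed
    then have ev: "\<forall>\<^sub>F n in sequentially. weight (fst (prod_decode y)) * (real n powr (- a) * real (L n y)) = x' n y"
      by eventually_elim (simp add: x'_def cell_value rep_def)
    have "(\<lambda>n. real n powr (- a) * real (L n y)) \<longlonglongrightarrow> 1 / Gm y"
    proof (rule tendsto_sandwich)
      show "\<forall>\<^sub>F n in sequentially. 1 / Gm y - real n powr (- a) \<le> real n powr (- a) * real (L n y)"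
        using eventually_gt_at_top[of 0]
      proof eventually_elim
        case (elim n)
        have "real n powr (- a) * (real n powr a / Gm y) \<le> real n powr (- a) * (real (L n y) + 1)"
          using L_bounds(2)[of n y] by (intro mult_left_mono) auto
        moreover have "real n powr (- a) * (real n powr a / Gm y) = 1 / Gm y" using elim by (simp add: powr_minus)
        ultimately have "1 / Gm y \<le> real n powr (- a) * (real (L n y) + 1)" by (simp only:)
        then show ?case by (simp add: distrib_left)
      qed
      have "(\<lambda>n. 1 / Gm y - real n powr (- a)) \<longlonglongrightarrow> 1 / Gm y - 0"
        using a by (intro tendsto_intros tendsto_neg_powr filterlim_real_sequentially) auto
      then show "(\<lambda>n. 1 / Gm y - real n powr (- a)) \<longlonglongrightarrow> 1 / Gm y" by simp
    qed (use scaled_L in auto)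
    then have "(\<lambda>n. weight (fst (prod_decode y)) * (real n powr (- a) * real (L n y))) \<longlonglongrightarrow> weight (fst (prod_decode y)) * (1 / Gm y)"
      by (intro tendsto_intros)
    moreover have "weight (fst (prod_decode y)) * (1 / Gm y) = jump y \<omega>" using True by (simp add: jump_def Gm_inv)
    ultimately show ?thesis using tendsto_cong[OF ev] by simp
  qed
  have occ: "occupied n c \<omega> \<longleftrightarrow> (\<exists>y. hit n y \<and> cellof n y = c)" for n c
  proof -
    have own: "in_cell a n (cellof n y) (fst (prod_decode y)) (mark y \<omega>) (time y \<omega>)" if "hit n y" for y
      using that in_cell_own[of a n "fst (prod_decode y)" "mark y \<omega>" "time y \<omega>"]
      by (simp add: hit_def cellof_def L_def position_def)
    have "hit n y" if "present y \<omega>" "in_cell a n c (fst (prod_decode y)) (mark y \<omega>) (time y \<omega>)" for y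
      using that by (simp add: hit_def L_def position_def in_cell_def)
    moreover have "present y \<omega>" if "hit n y" for y using that by (simp add: hit_def)
    ultimately show ?thesis using own in_cell_unique unfolding occupied_def by metis
  qed
  have cells: "occupied_cells n (window B n) \<omega> = cellof n ` {y. rep n y}" for n
  proof
    show "occupied_cells n (window B n) \<omega> \<subseteq> cellof n ` {y. rep n y}"
    proof
      fix c assume c: "c \<in> occupied_cells n (window B n) \<omega>"
      define y where "y = (LEAST y. hit n y \<and> cellof n y = c)"
      have "\<exists>y. hit n y \<and> cellof n y = c" using c occ by (simp add: occupied_cells_def)
      then have y: "hit n y \<and> cellof n y = c" unfolding y_def by (rule LeastI_ex)
      moreover have "\<not> (hit n z \<and> cellof n z = c)" if "z < y" for z using that unfolding y_def by (rule not_less_Least)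
      ultimately have "rep n y" using c by (auto simp: rep_def occupied_cells_def)
      then show "c \<in> cellof n ` {y. rep n y}" using y by blast
    qed
    show "cellof n ` {y. rep n y} \<subseteq> occupied_cells n (window B n) \<omega>"
      using occ by (auto simp: rep_def occupied_cells_def)
  qed
  have inj: "inj_on (cellof n) {y. rep n y}" for n
  proof (rule inj_onI)
    fix y z assume "y \<in> {y. rep n y}" "z \<in> {y. rep n y}" and eq: "cellof n y = cellof n z"
    then have "rep n y" "rep n z" by auto
    then have "\<not> z < y" "\<not> y < z" using eq by (auto simp: rep_def)
    then show "y = z" by simp
  qed
  have fin: "finite {y. rep n y}" for n
  proof (rule finite_imageD[OF _ inj])
    show "finite (cellof n ` {y. rep n y})"
      by (rule finite_subset[of _ "window B n"]) (auto simp: rep_def window_def)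
  qed
  have path_eq: "cell_path jump_value a n (occupied_cells n (window B n) \<omega>) t = jump_path (x' n) (\<tau>' n) t"
    if n: "0 < n" and t: "t \<in> {0..1}" for n t
  proof -
    have before: "nat \<lfloor>real n * time y \<omega>\<rfloor> < nat \<lfloor>real n * t\<rfloor> \<longleftrightarrow> \<tau>' n y \<le> t" for y
    proof -
      have "nat \<lfloor>real n * time y \<omega>\<rfloor> < nat \<lfloor>real n * t\<rfloor> \<longleftrightarrow> Suc (nat \<lfloor>real n * time y \<omega>\<rfloor>) \<le> nat \<lfloor>real n * t\<rfloor>"
        by (rule Suc_le_eq[symmetric])
      also have "\<dots> \<longleftrightarrow> real (Suc (nat \<lfloor>real n * time y \<omega>\<rfloor>)) \<le> real n * t"
      proof -
        have "0 \<le> real n * t" using t by simp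
        then have "k \<le> nat \<lfloor>real n * t\<rfloor> \<longleftrightarrow> real k \<le> real n * t" for k
          using nat_floor_bounds[of "real n * t"] by linarith
        then show ?thesis by blast
      qed
      also have "\<dots> \<longleftrightarrow> \<tau>' n y \<le> t" 
        using n by (simp only: \<tau>'_def pos_divide_le_eq[of "real n"] of_nat_0_less_iff mult.commute[of t])
      finally show ?thesis .
    qed
    have "cell_path jump_value a n (occupied_cells n (window B n) \<omega>) t =
      (\<Sum>y\<in>{y. rep n y}. real n powr (- a) * (jump_value (fst (cellof n y)) * of_bool (snd (cellof n y) < nat \<lfloor>real n * t\<rfloor>)))"
      unfolding cell_path_def cells sum.reindex[OF inj] o_def sum_distrib_left by (rule refl)
    also have "\<dots> = (\<Sum>y\<in>{y. rep n y}. x' n y * of_bool (\<tau>' n y \<le> t))"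
    proof (rule sum.cong[OF refl])
      fix y assume "y \<in> {y. rep n y}"
      then have "rep n y" by simp
      have "snd (cellof n y) < nat \<lfloor>real n * t\<rfloor> \<longleftrightarrow> \<tau>' n y \<le> t"
        unfolding cellof_def snd_conv by (rule before)
      with \<open>rep n y\<close> show "real n powr (- a) * (jump_value (fst (cellof n y)) * of_bool (snd (cellof n y) < nat \<lfloor>real n * t\<rfloor>)) =
        x' n y * of_bool (\<tau>' n y \<le> t)"
        by (simp only: x'_def if_True mult.assoc)
    qed
    also have "\<dots> = jump_path (x' n) (\<tau>' n) t"
      unfolding jump_path_def by (rule sum_eq_suminf[OF fin, symmetric]) (simp add: x'_def)
    finally show ?thesis .
  qed
  show ?thesis
    by (intro exI[of _ x'] exI[of _ \<tau>'] conjI allI impI ballI le lim lim_\<tau> path_eq)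
qed

lemma path_J1_approximation:
  assumes good: "good \<omega>" and B: "filterlim (\<lambda>n. real (B n) / real n powr a) at_top sequentially" and e: "0 < e"
  shows "\<forall>\<^sub>F n in sequentially. \<forall>z.
    (\<forall>t\<in>{0..1}. \<bar>z t - cell_path jump_value a n (occupied_cells n (window B n) \<omega>) t\<bar> \<le> e) \<longrightarrow> J1_dist (path \<omega>) z \<le> 4 * e"
proof -
  obtain x' \<tau>' where H: "\<forall>n y. \<bar>x' n y\<bar> \<le> \<bar>jump y \<omega>\<bar>" "\<forall>y. (\<lambda>n. x' n y) \<longlonglongrightarrow> jump y \<omega>"
    "\<forall>y. (\<lambda>n. \<tau>' n y) \<longlonglongrightarrow> time y \<omega>"
    "\<forall>n>0. \<forall>t\<in>{0..1}. cell_path jump_value a n (occupied_cells n (window B n) \<omega>) t = jump_path (x' n) (\<tau>' n) t"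
    using discretised_jumps[OF good B] by (elim exE conjE) (rule that)
  note * = H[rule_format]
  have "\<forall>\<^sub>F n in sequentially. \<forall>z. (\<forall>t\<in>{0..1}. \<bar>z t - jump_path (x' n) (\<tau>' n) t\<bar> \<le> e) \<longrightarrow> J1_dist (path \<omega>) z \<le> 4 * e"
    unfolding path_def
  proof (rule jump_path_J1_approximation[OF _ _ _ *(1) *(2) *(3) e])
    show "inj_on (\<lambda>y. time y \<omega>) {y. jump y \<omega> \<noteq> 0}" using good by (auto simp: good_def inj_def inj_on_def)
  qed (use good in \<open>auto simp: good_def\<close>)
  with eventually_gt_at_top[of 0] show ?thesis
  proof eventually_elim
    case (elim n)
    then show ?case using *(4)[of n] by simp
  qed
qed

text \<open>J1 convergence does not control the value at a given time. If \<open>t\<close> is not a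
  jump time, however, every indicator settles and Tannery's theorem applies. This feeds the
  independence of the increments.\<close>

lemma cell_path_tendsto:
  assumes good: "good \<omega>" and B: "filterlim (\<lambda>n. real (B n) / real n powr a) at_top sequentially"
    and t: "t \<in> {0..1}" and ne: "\<And>y. time y \<omega> \<noteq> t"
  shows "(\<lambda>n. cell_path jump_value a n (occupied_cells n (window B n) \<omega>) t) \<longlonglongrightarrow> path \<omega> t"
proof -
  obtain x' \<tau>' where H: "\<forall>n y. \<bar>x' n y\<bar> \<le> \<bar>jump y \<omega>\<bar>" "\<forall>y. (\<lambda>n. x' n y) \<longlonglongrightarrow> jump y \<omega>"
    "\<forall>y. (\<lambda>n. \<tau>' n y) \<longlonglongrightarrow> time y \<omega>"
    "\<forall>n>0. \<forall>t\<in>{0..1}. cell_path jump_value a n (occupied_cells n (window B n) \<omega>) t = jump_path (x' n) (\<tau>' n) t"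
    using discretised_jumps[OF good B] by (elim exE conjE) (rule that)
  note * = H[rule_format]
  have "(\<lambda>n. x' n y * of_bool (\<tau>' n y \<le> t)) \<longlonglongrightarrow> jump y \<omega> * of_bool (time y \<omega> \<le> t)" for y
  proof -
    have "\<forall>\<^sub>F n in sequentially. (\<tau>' n y \<le> t) = (time y \<omega> \<le> t)"
    proof (cases "time y \<omega> < t")
      case True
      then have "\<forall>\<^sub>F n in sequentially. \<tau>' n y < t" by (rule order_tendstoD(2)[OF *(3)])
      then show ?thesis using True by (auto elim: eventually_mono)
    next
      case False
      then have "t < time y \<omega>" using ne[of y] by simp
      then have "\<forall>\<^sub>F n in sequentially. t < \<tau>' n y" by (rule order_tendstoD(1)[OF *(3)])
      then show ?thesis using \<open>t < time y \<omega>\<close> by (auto elim: eventually_mono)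
    qed
    then have "(\<lambda>n. of_bool (\<tau>' n y \<le> t) :: real) \<longlonglongrightarrow> of_bool (time y \<omega> \<le> t)"
      by (intro tendsto_eventually) (auto elim: eventually_mono)
    then show ?thesis by (intro tendsto_mult *(2))
  qed
  moreover have "\<forall>\<^sub>F (y, n) in at_top \<times>\<^sub>F sequentially. norm (x' n y * of_bool (\<tau>' n y \<le> t)) \<le> \<bar>jump y \<omega>\<bar>"
    using *(1) by (intro always_eventually) (auto simp: abs_mult)
  moreover have "summable (\<lambda>y. \<bar>jump y \<omega>\<bar>)" using good by (simp add: good_def)
  ultimately have "(\<lambda>n. jump_path (x' n) (\<tau>' n) t) \<longlonglongrightarrow> path \<omega> t"
    unfolding jump_path_def path_def
    using tannerys_theorem[of "\<lambda>y n. x' n y * of_bool (\<tau>' n y \<le> t)" "\<lambda>y. jump y \<omega> * of_bool (time y \<omega> \<le> t)" sequentially "\<lambda>y. \<bar>jump y \<omega>\<bar>"]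
    by simp
  moreover have "\<forall>\<^sub>F n in sequentially. jump_path (x' n) (\<tau>' n) t = cell_path jump_value a n (occupied_cells n (window B n) \<omega>) t"
    using eventually_gt_at_top[of 0] by eventually_elim (simp add: *(4)[OF _ t])
  ultimately show ?thesis using tendsto_cong by fastforce
qed

end

section \<open>Identification of the stable law\<close>

lemma stable_exponent_scaled_imaginary:
  assumes a: "1 < a" and c: "0 \<le> c"
  shows "stable_exponent a (\<i> * of_real (\<theta> * c)) = of_real (stable_const a * \<bar>\<theta>\<bar> powr (1 / a) * c powr (1 / a)) *
    (of_real (cos (pi / (2 * a))) + \<i> * of_real (sgn \<theta> * sin (pi / (2 * a))))"
proof (cases "c = 0")
  case True
  then show ?thesis unfolding stable_exponent_imaginary[OF a] using a by simp
next
  case False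
  then have "\<bar>\<theta> * c\<bar> powr (1 / a) = \<bar>\<theta>\<bar> powr (1 / a) * c powr (1 / a)" "sgn (\<theta> * c) = sgn \<theta>"
    using c by (simp_all add: abs_mult powr_mult sgn_mult)
  then show ?thesis unfolding stable_exponent_imaginary[OF a] by (simp only: mult.assoc)
qed

text \<open>The two exponents are conjugate up to the factors \<open>1 + \<beta>\<close> and
  \<open>1 - \<beta>\<close>. Their real parts add to a multiple of the cosine, their imaginary
  parts leave \<beta> times the sine, and factoring out the cosine produces the tangent.\<close>

lemma stable_char_eq:
  assumes a: "1 < a" and c: "0 \<le> c0" "0 \<le> c1"
    and c0: "c0 powr (1 / a) = \<kappa> * (1 + \<beta>)" and c1: "c1 powr (1 / a) = \<kappa> * (1 - \<beta>)"
    and \<sigma>: "0 < \<sigma>" "2 * \<kappa> * stable_const a * cos (pi / (2 * a)) = \<sigma> powr (1 / a)" and T: "0 < T"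
  shows "exp (- of_real T * (stable_exponent a (\<i> * of_real (- \<theta> * c0)) + stable_exponent a (\<i> * of_real (\<theta> * c1))))
    = stable_char (1 / a) (\<sigma> * T powr (1 / (1 / a))) \<beta> 0 \<theta>"
proof -
  define A where "A = stable_const a * \<bar>\<theta>\<bar> powr (1 / a)"
  define C where "C = cos (pi / (2 * a))"
  define S where "S = sgn \<theta> * sin (pi / (2 * a))"
  have C0: "C \<noteq> 0"
  proof -
    have "pi / (2 * a) < pi / 2" using a by (simp add: field_simps)
    then have "0 < C" unfolding C_def using a by (intro cos_gt_zero_pi) (auto intro: order.strict_trans[of _ 0])
    then show ?thesis by simp
  qed
  have e0: "stable_exponent a (\<i> * of_real (- \<theta> * c0)) = of_real (A * (\<kappa> * (1 + \<beta>))) * (of_real C - \<i> * of_real S)"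
    using stable_exponent_scaled_imaginary[OF a c(1), of "- \<theta>"] by (simp add: A_def C_def S_def c0 sgn_minus)
  have e1: "stable_exponent a (\<i> * of_real (\<theta> * c1)) = of_real (A * (\<kappa> * (1 - \<beta>))) * (of_real C + \<i> * of_real S)"
    using stable_exponent_scaled_imaginary[OF a c(2), of \<theta>] by (simp add: A_def C_def S_def c1)
  have "of_real (A * (\<kappa> * (1 + \<beta>))) * (of_real C - \<i> * of_real S) + of_real (A * (\<kappa> * (1 - \<beta>))) * (of_real C + \<i> * of_real S)
    = of_real (2 * \<kappa> * A) * (of_real C - \<i> * of_real (\<beta> * S))"
    by (simp add: complex_eq_iff algebra_simps)
  also have "\<dots> = of_real (2 * \<kappa> * A * C) * (1 - \<i> * of_real (\<beta> * (S / C)))"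
    using C0 by (simp add: complex_eq_iff)
  also have "2 * \<kappa> * A * C = \<sigma> powr (1 / a) * \<bar>\<theta>\<bar> powr (1 / a)"
    unfolding A_def C_def \<sigma>(2)[symmetric] by (simp add: mult_ac)
  also have "\<beta> * (S / C) = \<beta> * sgn \<theta> * tan (pi * (1 / a) / 2)"
    by (simp add: S_def C_def tan_def mult_ac)
  finally have sum: "stable_exponent a (\<i> * of_real (- \<theta> * c0)) + stable_exponent a (\<i> * of_real (\<theta> * c1)) =
    of_real (\<sigma> powr (1 / a) * \<bar>\<theta>\<bar> powr (1 / a)) * (1 - \<i> * of_real (\<beta> * sgn \<theta> * tan (pi * (1 / a) / 2)))"
    unfolding e0 e1 .
  have "(\<sigma> * T powr (1 / (1 / a))) powr (1 / a) = \<sigma> powr (1 / a) * T"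
    using \<sigma>(1) T a by (simp add: powr_mult powr_powr)
  moreover have "1 / a \<noteq> 1" using a by simp
  ultimately show ?thesis
    unfolding stable_char_def sum by (simp add: mult_ac)
qed

context stable_jumps begin

lemma path_measurable [measurable]: "(\<lambda>\<omega>. path \<omega> t) \<in> borel_measurable P"
  unfolding path_def jump_path_def by measurable

text \<open>On the null set \<open>N\<close> the path is replaced by 0, as every sample path has to
  lie in \<open>D01\<close> and start at 0. The increments are independent as almost sure limits of
  increments of the arrays, and their law is read off the characteristic function.\<close>

lemma stable_levy_motion_path:
  assumes w0: "c0 powr (1 / a) = \<kappa> * (1 + \<beta>)" and w1: "c1 powr (1 / a) = \<kappa> * (1 - \<beta>)"
    and \<sigma>: "0 < \<sigma>" "2 * \<kappa> * stable_const a * cos (pi / (2 * a)) = \<sigma> powr (1 / a)"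
    and N: "N \<in> null_sets P" "{\<omega> \<in> space P. \<not> good \<omega>} \<subseteq> N"
  shows "stable_levy_motion (1 / a) \<sigma> \<beta> P (\<lambda>\<omega> t. if \<omega> \<in> N then 0 else path \<omega> t)"
proof -
  let ?W = "\<lambda>\<omega> t. if \<omega> \<in> N then 0 else path \<omega> t"
  have [measurable]: "N \<in> sets P" using N(1) by auto
  have W_meas[measurable]: "(\<lambda>\<omega>. ?W \<omega> t) \<in> borel_measurable P" for t by measurable
  have AE_N: "AE \<omega> in P. \<omega> \<notin> N" using N(1) by (rule AE_not_in)
  have goodN: "good \<omega>" if "\<omega> \<in> space P" "\<omega> \<notin> N" for \<omega> using N(2) that by blast
  have W_D: "?W \<omega> \<in> D01 \<and> ?W \<omega> 0 = 0" if "\<omega> \<in> space P" for \<omega>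
  proof (cases "\<omega> \<in> N")
    case True
    have "jump_path (\<lambda>_. 0) (\<lambda>_. 0) \<in> D01" by (rule jump_path_in_D01) simp
    moreover have "jump_path (\<lambda>_. 0) (\<lambda>_. 0) = (\<lambda>_. 0)" by (simp add: jump_path_def fun_eq_iff)
    ultimately show ?thesis using True by simp
  next
    case False
    then have g: "good \<omega>" using goodN that by blast
    then have "path \<omega> \<in> D01" unfolding path_def by (intro jump_path_in_D01) (simp add: good_def)
    moreover have "jump y \<omega> * of_bool (time y \<omega> \<le> 0) = 0" for y
    proof -
      have "0 < time y \<omega>" using g by (simp add: good_def)
      then show ?thesis by simp
    qed
    then have "path \<omega> 0 = 0" unfolding path_def jump_path_def by (simp only: suminf_zero)
    ultimately show ?thesis using False by simp
  qed
  have indep: "indep_vars (\<lambda>_. borel) (\<lambda>i \<omega>. ?W \<omega> (s (Suc i)) - ?W \<omega> (s i)) {..<k}"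
    if s: "0 \<le> s 0" "s k \<le> 1" "\<forall>i<k. s i < s (Suc i)" for k :: nat and s :: "nat \<Rightarrow> real"
  proof -
    \<comment> \<open>Any cut-off of larger order than \<open>n powr a\<close> would serve
      here.\<close>
    define B where "B n = nat \<lceil>real n powr (a + 1)\<rceil>" for n :: nat
    have B: "filterlim (\<lambda>n. real (B n) / real n powr a) at_top sequentially"
    proof (rule filterlim_at_top_mono[OF filterlim_real_sequentially])
      show "\<forall>\<^sub>F n in sequentially. real n \<le> real (B n) / real n powr a"
        using eventually_gt_at_top[of 0]
      proof eventually_elim
        case (elim n)
        have "real n * real n powr a = real n powr (a + 1)" using elim by (simp add: powr_add)
        also have "\<dots> \<le> real (B n)" unfolding B_def by linarith
        finally show ?case using elim by (simp add: pos_le_divide_eq)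
      qed
    qed
    have s01: "s i \<in> {0..1}" if "i \<le> k" for i
    proof -
      have lo: "0 \<le> s i" if "i \<le> k" for i using that
      proof (induction i)
        case (Suc i)
        then show ?case using s(3)[rule_format, of i] by simp
      qed (use s(1) in simp)
      have hi: "s i \<le> s k" using that
      proof (induction i rule: inc_induct)
        case (step i)
        then show ?case using s(3)[rule_format, of i] by simp
      qed simp
      show ?thesis using lo[OF that] hi s(2) by simp
    qed
    \<comment> \<open>Shifted by \<open>Suc\<close> because the array is independent only for a
      positive number of time cells.\<close>
    let ?X = "\<lambda>n t \<omega>. cell_path jump_value a (Suc n) (occupied_cells (Suc n) (window B (Suc n)) \<omega>) t"
    have lim: "AE \<omega> in P. (\<lambda>n. ?X n t \<omega>) \<longlonglongrightarrow> ?W \<omega> t" if t: "t \<in> {0..1}" for t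
    proof -
      have "AE \<omega> in P. \<forall>y. time y \<omega> \<noteq> t" using AE_time_neq by (simp add: AE_all_countable)
      with AE_good AE_N show ?thesis
      proof eventually_elim
        case (elim \<omega>)
        have "(\<lambda>n. cell_path jump_value a n (occupied_cells n (window B n) \<omega>) t) \<longlonglongrightarrow> path \<omega> t"
          using elim by (intro cell_path_tendsto B t) auto
        from LIMSEQ_Suc[OF this] show ?case using elim by simp
      qed
    qed
    show ?thesis
    proof (rule indep_vars_limit)
      show "indep_vars (\<lambda>_. borel) (\<lambda>i \<omega>. ?X n (s (Suc i)) \<omega> - ?X n (s i) \<omega>) {..<k}" for n
        by (rule indep_cell_path_increments) (use s in \<open>auto simp: window_def intro: less_imp_le\<close>)
      fix i assume i: "i \<in> {..<k}"
      show "(\<lambda>\<omega>. ?W \<omega> (s (Suc i)) - ?W \<omega> (s i)) \<in> borel_measurable P" by measurable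
      have "AE \<omega> in P. (\<lambda>n. ?X n (s (Suc i)) \<omega>) \<longlonglongrightarrow> ?W \<omega> (s (Suc i))" by (rule lim, rule s01) (use i in simp)
      moreover have "AE \<omega> in P. (\<lambda>n. ?X n (s i) \<omega>) \<longlonglongrightarrow> ?W \<omega> (s i)" by (rule lim, rule s01) (use i in simp)
      ultimately show "AE \<omega> in P. (\<lambda>n. ?X n (s (Suc i)) \<omega> - ?X n (s i) \<omega>) \<longlonglongrightarrow> ?W \<omega> (s (Suc i)) - ?W \<omega> (s i)"
        by eventually_elim (rule tendsto_diff)
    qed simp
  qed
  have law: "stable_law (1 / a) (\<sigma> * (t - s) powr (1 / (1 / a))) \<beta> 0 (distr P borel (\<lambda>\<omega>. ?W \<omega> t - ?W \<omega> s))"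
    if st: "0 \<le> s" "s < t" "t \<le> 1" for s t
    unfolding stable_law_def
  proof (intro conjI allI)
    let ?Z = "\<lambda>\<omega>. ?W \<omega> t - ?W \<omega> s"
    have [measurable]: "?Z \<in> borel_measurable P" by measurable
    interpret Z: prob_space "distr P borel ?Z" by (rule prob_space_distr) measurable
    show "real_distribution (distr P borel ?Z)"
      by (intro real_distribution.intro real_distribution_axioms.intro Z.prob_space_axioms) auto
    fix \<theta>
    have "char (distr P borel ?Z) \<theta> = (\<integral>\<omega>. exp (\<i> * of_real (\<theta> * ?Z \<omega>)) \<partial>P)"
      unfolding char_def by (subst integral_distr) auto
    also have "\<dots> = (\<integral>\<omega>. exp (\<i> * of_real (\<theta> * (\<Sum>y. jump y \<omega> * of_bool (s < time y \<omega> \<and> time y \<omega> \<le> t)))) \<partial>P)"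
    proof (rule integral_cong_AE)
      show "AE \<omega> in P. exp (\<i> * of_real (\<theta> * ?Z \<omega>)) = exp (\<i> * of_real (\<theta> * (\<Sum>y. jump y \<omega> * of_bool (s < time y \<omega> \<and> time y \<omega> \<le> t))))"
        using AE_good AE_N
      proof eventually_elim
        case (elim \<omega>)
        have sj: "summable (\<lambda>y. \<bar>jump y \<omega>\<bar>)" using elim by (simp add: good_def)
        have "path \<omega> t - path \<omega> s = (\<Sum>y. jump y \<omega> * of_bool (time y \<omega> \<le> t) - jump y \<omega> * of_bool (time y \<omega> \<le> s))"
          unfolding path_def jump_path_def by (rule suminf_diff[OF summable_jumps[OF sj] summable_jumps[OF sj]])
        also have "\<dots> = (\<Sum>y. jump y \<omega> * of_bool (s < time y \<omega> \<and> time y \<omega> \<le> t))"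
          using st by (intro suminf_cong) auto
        finally show ?case using elim by simp
      qed
    qed measurable
    also have "\<dots> = stable_char (1 / a) (\<sigma> * (t - s) powr (1 / (1 / a))) \<beta> 0 \<theta>"
      unfolding expectation_exp_increment[OF st]
      by (rule stable_char_eq[OF a c0 c1 w0 w1 \<sigma>]) (use st in simp)
    finally show "char (distr P borel ?Z) \<theta> = stable_char (1 / a) (\<sigma> * (t - s) powr (1 / (1 / a))) \<beta> 0 \<theta>" .
  qed
  show ?thesis
    unfolding stable_levy_motion_def
    using prob_space_axioms W_meas W_D indep law by blast
qed

end

section \<open>Functionals of finitely valued paths\<close>

lemma
  fixes H :: "'s \<Rightarrow> real"
  assumes "finite_measure M" and fin: "finite \<S>" and Z: "\<And>x. x \<in> space M \<Longrightarrow> Z x \<in> \<S>"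
    and sets: "\<And>S. S \<in> \<S> \<Longrightarrow> {x \<in> space M. Z x = S} \<in> sets M"
  shows measurable_finite_valued: "(\<lambda>x. H (Z x)) \<in> borel_measurable M"
    and integral_finite_valued: "(\<integral>x. H (Z x) \<partial>M) = (\<Sum>S\<in>\<S>. H S * measure M {x \<in> space M. Z x = S})"
proof -
  interpret finite_measure M by fact
  \<comment> \<open>A finite combination of indicators, hence measurable for an arbitrary
    \<open>H\<close>; this is how \<open>g\<close> applied to a path becomes measurable.\<close>
  have eq: "H (Z x) = (\<Sum>S\<in>\<S>. H S * indicator {x \<in> space M. Z x = S} x)" if "x \<in> space M" for x
  proof -
    have "(\<Sum>S\<in>\<S>. H S * indicator {x \<in> space M. Z x = S} x) = (\<Sum>S\<in>\<S>. if S = Z x then H (Z x) else 0)"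
      using that by (intro sum.cong) (auto simp: indicator_def)
    then show ?thesis using fin Z[OF that] by simp
  qed
  have "(\<lambda>x. \<Sum>S\<in>\<S>. H S * indicator {x \<in> space M. Z x = S} x) \<in> borel_measurable M"
    using sets by (intro borel_measurable_sum borel_measurable_times borel_measurable_const borel_measurable_indicator)
  then show "(\<lambda>x. H (Z x)) \<in> borel_measurable M"
    by (subst measurable_cong[OF eq])
  have "(\<integral>x. H (Z x) \<partial>M) = (\<integral>x. (\<Sum>S\<in>\<S>. H S * indicator {x \<in> space M. Z x = S} x) \<partial>M)"
    by (rule Bochner_Integration.integral_cong[OF refl eq])
  also have "\<dots> = (\<Sum>S\<in>\<S>. \<integral>x. H S * indicator {x \<in> space M. Z x = S} x \<partial>M)"
    using sets by (intro Bochner_Integration.integral_sum integrable_mult_right integrable_real_indicator) (auto simp: less_top[symmetric])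
  also have "\<dots> = (\<Sum>S\<in>\<S>. H S * measure M {x \<in> space M. Z x = S})"
    using sets by (intro sum.cong) auto
  finally show "(\<integral>x. H (Z x) \<partial>M) = (\<Sum>S\<in>\<S>. H S * measure M {x \<in> space M. Z x = S})" .
qed

lemma step_function_in_D01: "(\<lambda>t. h (nat \<lfloor>real n * t\<rfloor>)) \<in> D01"
proof (cases "n = 0")
  case True
  then show ?thesis by (auto simp: D01_def)
next
  case False
  then have n: "0 < real n" by simp
  have "((\<lambda>t. h (nat \<lfloor>real n * t\<rfloor>)) \<longlongrightarrow> h (nat \<lfloor>real n * t\<rfloor>)) (at_right t)" for t
  proof (rule tendsto_eventually)
    have "t < (of_int \<lfloor>real n * t\<rfloor> + 1) / real n" using n by (simp add: pos_less_divide_eq mult.commute)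
    then have "\<forall>\<^sub>F s in at_right t. s < (of_int \<lfloor>real n * t\<rfloor> + 1) / real n"
      by (rule order_tendstoD(2)[OF tendsto_ident_at])
    moreover have "\<forall>\<^sub>F s in at_right t. t < s" by (simp add: eventually_at_filter)
    ultimately show "\<forall>\<^sub>F s in at_right t. h (nat \<lfloor>real n * s\<rfloor>) = h (nat \<lfloor>real n * t\<rfloor>)"
    proof eventually_elim
      case (elim s)
      have "real n * t < real n * s" using elim n by simp
      moreover have "real n * s < of_int \<lfloor>real n * t\<rfloor> + 1" using elim n by (simp add: pos_less_divide_eq mult.commute)
      ultimately have "\<lfloor>real n * s\<rfloor> = \<lfloor>real n * t\<rfloor>" by linarith
      then show ?case by simp
    qed
  qed
  \<comment> \<open>Just to the left of \<open>t\<close> the floor equals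
    \<open>\<lceil>real n * t\<rceil> - 1\<close>, whether or not \<open>t\<close> is a grid
    point.\<close>
  moreover have "((\<lambda>t. h (nat \<lfloor>real n * t\<rfloor>)) \<longlongrightarrow> h (nat (\<lceil>real n * t\<rceil> - 1))) (at_left t)" for t
  proof (rule tendsto_eventually)
    have "(of_int \<lceil>real n * t\<rceil> - 1) / real n < t" using n by (simp add: pos_divide_less_eq mult.commute) linarith
    then have "\<forall>\<^sub>F s in at_left t. (of_int \<lceil>real n * t\<rceil> - 1) / real n < s"
      by (rule order_tendstoD(1)[OF tendsto_ident_at])
    moreover have "\<forall>\<^sub>F s in at_left t. s < t" by (simp add: eventually_at_filter)
    ultimately show "\<forall>\<^sub>F s in at_left t. h (nat \<lfloor>real n * s\<rfloor>) = h (nat (\<lceil>real n * t\<rceil> - 1))"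
    proof eventually_elim
      case (elim s)
      have "real n * s < real n * t" using elim n by simp
      moreover have "of_int \<lceil>real n * t\<rceil> - 1 < real n * s" using elim n by (simp add: pos_divide_less_eq mult.commute)
      ultimately have "\<lfloor>real n * s\<rfloor> = \<lceil>real n * t\<rceil> - 1" by linarith
      then show ?case by simp
    qed
  qed
  ultimately show ?thesis unfolding D01_def by blast
qed

lemma cell_path_in_D01: "cell_path v a n S \<in> D01"
proof -
  have "cell_path v a n S = (\<lambda>t. (\<lambda>m. real n powr (- a) * (\<Sum>c\<in>S. v (fst c) * of_bool (snd c < m))) (nat \<lfloor>real n * t\<rfloor>))"
    by (simp add: fun_eq_iff cell_path_def)
  then show ?thesis
    by (metis (no_types) step_function_in_D01[of "\<lambda>m. real n powr (- a) * (\<Sum>c\<in>S. v (fst c) * of_bool (snd c < m))" n])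
qed

lemma partial_sum_process_in_D01: "partial_sum_process \<alpha> T f n x \<in> D01"
proof -
  have "partial_sum_process \<alpha> T f n x = (\<lambda>t. (\<lambda>m. real n powr (- 1 / \<alpha>) * birkhoff_sum T f m x) (nat \<lfloor>real n * t\<rfloor>))"
    by (simp add: fun_eq_iff partial_sum_process_def)
  then show ?thesis
    by (metis (no_types) step_function_in_D01[of "\<lambda>m. real n powr (- 1 / \<alpha>) * birkhoff_sum T f m x" n])
qed

text \<open>Paths are functions on all of \<open>real\<close>, but \<open>J1_dist\<close>, and with
  it \<open>g\<close>, does not see their values outside \<open>{0..1}\<close>.\<close>

lemma J1_continuous_cong:
  assumes g: "J1_continuous_on_D g" and "x \<in> D01" "y \<in> D01" and eq: "\<And>t. t \<in> {0..1} \<Longrightarrow> x t = y t"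
  shows "g x = g y"
proof -
  have "J1_dist x y \<le> 0"
    by (rule J1_dist_le[of "\<lambda>t. t"]) (auto simp: time_changes_def eq strict_mono_on_def)
  then have "\<bar>g y - g x\<bar> < e" if "0 < e" for e
    using g assms(2,3) that unfolding J1_continuous_on_D_def by (meson le_less_trans)
  then show ?thesis using dense[of 0 "\<bar>g y - g x\<bar>"] by fastforce
qed

section \<open>Estimates for the levels\<close>

lemma sum_powr_le:
  assumes b: "0 < b" "b < 1"
  shows "(\<Sum>l<n. real (Suc l) powr (- b)) \<le> real n powr (1 - b) / (1 - b)"
proof (induction n)
  case (Suc n)
  have "(1 - b) * real (Suc n) powr (- b) \<le> real (Suc n) powr (1 - b) - real n powr (1 - b)"
  proof (cases "n = 0")
    case False
    have "\<exists>z. real n < z \<and> z < real (Suc n) \<and>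
      real (Suc n) powr (1 - b) - real n powr (1 - b) = (real (Suc n) - real n) * ((1 - b) * z powr (1 - b - 1))"
    proof (rule MVT2)
      show "((\<lambda>z. z powr (1 - b)) has_real_derivative (1 - b) * z powr (1 - b - 1)) (at z)" if "real n \<le> z" for z
        by (rule has_real_derivative_powr) (use that False in linarith)
    qed simp
    then obtain z where z: "real n < z" "z < real (Suc n)"
      "real (Suc n) powr (1 - b) - real n powr (1 - b) = (1 - b) * z powr (- b)" by auto
    have "real (Suc n) powr (- b) \<le> z powr (- b)" using z b by (intro powr_mono2') auto
    then show ?thesis using z(3) b by (simp add: mult_left_mono)
  qed (use b in simp)
  then have "real (Suc n) powr (- b) \<le> (real (Suc n) powr (1 - b) - real n powr (1 - b)) / (1 - b)"
    using b by (simp add: pos_le_divide_eq mult.commute)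
  then show ?case using Suc by (simp add: diff_divide_distrib)
qed (use b in simp)

text \<open>Bounds the mean number of units in a cell: the difference of two consecutive powers
  gains a factor \<open>1 / k\<close>, which the number \<open>k\<close> of units takes
  back.\<close>

lemma level_intensity_le:
  assumes a: "1 < a"
  shows "real (Suc (l div 2)) * intensity a l \<le> 2 * real (Suc l) powr (- 1 / a)"
proof -
  define k where "k = real (Suc (l div 2))"
  define b where "b = 1 / a"
  have b: "0 < b" "b < 1" using a by (auto simp: b_def)
  have k: "0 < k" by (simp add: k_def)
  have int: "intensity a l = k powr (- b) - (k + 1) powr (- b)" by (simp add: intensity_def k_def b_def)
  \<comment> \<open>A base in (0, 1) gives a larger power when the exponent drops from 1 to
    \<open>b\<close>.\<close>
  have "k / (k + 1) \<le> (k / (k + 1)) powr b"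
    using powr_mono'[of b 1 "k / (k + 1)"] b k by simp
  then have "1 - (k / (k + 1)) powr b \<le> 1 / (k + 1)" using k by (simp add: field_simps)
  also have "\<dots> \<le> 1 / k" using k by (simp add: field_simps)
  finally have "1 - (k / (k + 1)) powr b \<le> 1 / k" .
  then have "k powr (- b) * (1 - (k / (k + 1)) powr b) \<le> k powr (- b) * (1 / k)" by (intro mult_left_mono) auto
  moreover have "k powr (- b) * (1 - (k / (k + 1)) powr b) = intensity a l"
    using k unfolding int by (simp add: powr_divide powr_minus field_simps)
  ultimately have "intensity a l \<le> k powr (- b) / k" by (simp only:) simp
  then have "k * intensity a l \<le> k powr (- b)" using k by (simp only: pos_le_divide_eq mult.commute)
  also have "\<dots> \<le> (real (Suc l) / 2) powr (- b)"
  proof (rule powr_mono2')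
    have "Suc l \<le> 2 * Suc (l div 2)" by presburger
    then have "real (Suc l) \<le> real (2 * Suc (l div 2))" by (simp only: of_nat_le_iff)
    then show "real (Suc l) / 2 \<le> k" unfolding k_def by simp
  qed (use b in auto)
  also have "\<dots> = 2 powr b * real (Suc l) powr (- b)" by (simp add: powr_divide powr_minus field_simps)
  also have "\<dots> \<le> 2 * real (Suc l) powr (- b)"
    using powr_mono[of b 1 2] b by (intro mult_right_mono) auto
  finally show ?thesis by (simp add: k_def b_def)
qed

text \<open>The differences telescope, once for each sign, hence the bound 2.\<close>

lemma summable_intensity:
  assumes a: "1 < a"
  shows "summable (intensity a)"
proof (rule summableI_nonneg_bounded)
  define w where "w m = real (Suc m) powr (- 1 / a)" for m
  have "(\<Sum>l<2 * N. intensity a l) = (\<Sum>m<N. 2 * (w m - w (Suc m)))" for N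
    unfolding sum_pairs by (intro sum.cong) (auto simp: intensity_def w_def)
  also have "\<dots> N = 2 * (w 0 - w N)" for N
    unfolding sum_distrib_left[symmetric] by (simp add: sum_lessThan_telescope')
  finally have even: "(\<Sum>l<2 * N. intensity a l) \<le> 2" for N by (simp add: w_def)
  show "(\<Sum>l<n. intensity a l) \<le> 2" for n
    using intensity_nonneg[OF a] by (intro order_trans[OF sum_mono2 even[of n]]) auto
qed (rule intensity_nonneg[OF a])

context aperiodic_ergodic_system begin

text \<open>By Borel-Cantelli almost every point is in finitely many of the sets. Removing the
  exceptional null set from each of them makes this true everywhere, so the series for
  \<open>f\<close> is a finite sum at every point. The itineraries change only on a null set because
  \<open>T\<close> preserves the measure.\<close>

lemma exists_locally_finite_nearly_independent_sets:
  fixes p e :: "nat \<Rightarrow> real"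
  assumes p: "\<And>l. 0 \<le> p l \<and> p l \<le> 1" and e: "\<And>l. 0 < e l" and sum: "summable (\<lambda>l. p l + e l)"
  shows "\<exists>F. (\<forall>l. F l \<in> sets M) \<and> (\<forall>l. prob (F l) \<le> p l + e l) \<and> (\<forall>x\<in>space M. finite {l. x \<in> F l}) \<and>
    (\<forall>a b n. n \<le> Suc a \<longrightarrow>
      (\<Sum>S\<in>Pow ({a..<b} \<times> {..<n}). \<bar>prob {x \<in> space M. names T F ({a..<b} \<times> {..<n}) x = S}
         - bernoulli_weight p ({a..<b} \<times> {..<n}) S\<bar>) \<le> (\<Sum>l\<in>{a..<b}. e l))"
proof -
  obtain G where G: "\<forall>l. G l \<in> sets M" "\<forall>l. prob (G l) \<le> p l + e l"
    "\<forall>a b n. n \<le> Suc a \<longrightarrow>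
      (\<Sum>S\<in>Pow ({a..<b} \<times> {..<n}). \<bar>prob {x \<in> space M. names T G ({a..<b} \<times> {..<n}) x = S}
         - bernoulli_weight p ({a..<b} \<times> {..<n}) S\<bar>) \<le> (\<Sum>l\<in>{a..<b}. e l)"
    using exists_nearly_independent_sets[of p e, OF p e] by (elim exE conjE) (rule that)
  have [measurable]: "G l \<in> sets M" for l using G(1) by simp
  have "summable (\<lambda>l. prob (G l))"
    by (rule summable_comparison_test'[OF sum, of 0]) (use G(2) in auto)
  then have "AE x in M. \<forall>\<^sub>F l in sequentially. x \<in> space M - G l"
    by (intro borel_cantelli_AE1) (auto simp: less_top[symmetric])
  then obtain N where N: "N \<in> null_sets M" "{x \<in> space M. \<not> (\<forall>\<^sub>F l in sequentially. x \<in> space M - G l)} \<subseteq> N"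
    unfolding eventually_ae_filter by (elim bexE) (rule that)
  have [measurable]: "N \<in> sets M" using N(1) by auto
  define F where "F l = G l - N" for l
  have [measurable]: "F l \<in> sets M" for l unfolding F_def by measurable
  have "prob (F l) \<le> p l + e l" for l
    using G(2)[rule_format, of l] finite_measure_mono[of "F l" "G l"] by (auto simp: F_def)
  moreover have "finite {l. x \<in> F l}" if "x \<in> space M" for x
  proof (cases "x \<in> N")
    case False
    then have "\<forall>\<^sub>F l in sequentially. x \<in> space M - G l" using N(2) that by blast
    then obtain L where "\<forall>l\<ge>L. x \<in> space M - G l" unfolding eventually_sequentially by blast
    then have "{l. x \<in> F l} \<subseteq> {..<L}" by (auto simp: F_def not_le[symmetric])
    then show ?thesis by (rule finite_subset) simp
  qed (simp add: F_def)
  moreover have "prob {x \<in> space M. names T F R x = S} = prob {x \<in> space M. names T G R x = S}" if "finite R" for R S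
  proof (rule finite_measure_eq_AE)
    have "AE x in M. (T ^^ j) x \<notin> N" for j
    proof -
      have "prob {x \<in> space M. (T ^^ j) x \<in> N} = 0"
        using N(1) by (simp add: prob_T_iter measure_eq_0_null_sets)
      moreover have "{x \<in> space M. (T ^^ j) x \<in> N} \<in> sets M" by measurable
      ultimately have "AE x in M. x \<notin> {x \<in> space M. (T ^^ j) x \<in> N}" by (simp add: prob_eq_0)
      with AE_space show ?thesis by eventually_elim auto
    qed
    then have "AE x in M. \<forall>j. (T ^^ j) x \<notin> N" by (simp add: AE_all_countable)
    then show "AE x in M. (x \<in> {x \<in> space M. names T F R x = S}) = (x \<in> {x \<in> space M. names T G R x = S})"
      by eventually_elim (simp add: names_def F_def)
  qed (use that in \<open>auto intro: names_sets\<close>)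
  ultimately show ?thesis
    using G(3) by (intro exI[of _ F] conjI allI ballI) simp_all
qed

end

section \<open>Transfer to the dynamical system\<close>

text \<open>Without a uniform modulus of continuity for \<open>g\<close>, the effect of a uniform
  perturbation is measured by the local oscillation. It depends on the centre \<open>z\<close>
  alone, so it can be carried from one probability space to the other together with the
  path.\<close>

definition path_oscillation :: "((real \<Rightarrow> real) \<Rightarrow> real) \<Rightarrow> real \<Rightarrow> (real \<Rightarrow> real) \<Rightarrow> real" where
  "path_oscillation g e z = (SUP y\<in>{y \<in> D01. \<forall>t\<in>{0..1}. \<bar>y t - z t\<bar> \<le> e}. \<bar>g y - g z\<bar>)"

text \<open>In the last claim \<open>c\<close> will be the value of \<open>g\<close> at the limit
  path, to which the values of \<open>g\<close> on the whole ball are eventually close.\<close>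

lemma
  assumes bd: "\<And>y. y \<in> D01 \<Longrightarrow> \<bar>g y\<bar> \<le> Bd" and z: "z \<in> D01" and e: "0 \<le> e"
  shows path_oscillation_upper: "y \<in> D01 \<Longrightarrow> (\<And>t. t \<in> {0..1} \<Longrightarrow> \<bar>y t - z t\<bar> \<le> e) \<Longrightarrow> \<bar>g y - g z\<bar> \<le> path_oscillation g e z"
    and path_oscillation_nonneg: "0 \<le> path_oscillation g e z"
    and path_oscillation_le: "path_oscillation g e z \<le> 2 * Bd"
    and path_oscillation_le_of_centre:
      "(\<And>y. y \<in> D01 \<Longrightarrow> \<forall>t\<in>{0..1}. \<bar>y t - z t\<bar> \<le> e \<Longrightarrow> \<bar>g y - c\<bar> \<le> d) \<Longrightarrow> path_oscillation g e z \<le> 2 * d"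
proof -
  let ?Y = "{y \<in> D01. \<forall>t\<in>{0..1}. \<bar>y t - z t\<bar> \<le> e}"
  have zY: "z \<in> ?Y" using z e by simp
  have le: "\<bar>g y - g z\<bar> \<le> 2 * Bd" if "y \<in> ?Y" for y
  proof -
    have "\<bar>g y\<bar> \<le> Bd" using bd[of y] that by simp
    then show ?thesis using bd[OF z] by linarith
  qed
  have bdd: "bdd_above ((\<lambda>y. \<bar>g y - g z\<bar>) ` ?Y)" by (rule bdd_aboveI2[OF le])
  show upper: "\<bar>g y - g z\<bar> \<le> path_oscillation g e z"
    if "y \<in> D01" "\<And>t. t \<in> {0..1} \<Longrightarrow> \<bar>y t - z t\<bar> \<le> e" for y
    unfolding path_oscillation_def by (rule cSUP_upper[OF _ bdd]) (use that in simp)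
  show "0 \<le> path_oscillation g e z" using upper[OF z] e by simp
  show "path_oscillation g e z \<le> 2 * Bd"
    unfolding path_oscillation_def by (rule cSUP_least) (use zY le in auto)
  show "path_oscillation g e z \<le> 2 * d"
    if d: "\<And>y. y \<in> D01 \<Longrightarrow> \<forall>t\<in>{0..1}. \<bar>y t - z t\<bar> \<le> e \<Longrightarrow> \<bar>g y - c\<bar> \<le> d"
    unfolding path_oscillation_def
  proof (rule cSUP_least)
    fix y assume y: "y \<in> ?Y"
    have "\<bar>g y - c\<bar> \<le> d" by (rule d) (use y in auto)
    moreover have "\<bar>g z - c\<bar> \<le> d" by (rule d) (use zY in auto)
    ultimately show "\<bar>g y - g z\<bar> \<le> 2 * d" by linarith
  qed (use zY in blast)
qed

text \<open>Total variation bound for two finitely valued variables on different spaces.\<close>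

lemma abs_integral_finite_valued_diff_le:
  fixes H :: "'s \<Rightarrow> real"
  assumes M: "finite_measure M" and P: "finite_measure P" and fin: "finite \<S>"
    and Z: "\<And>x. x \<in> space M \<Longrightarrow> Z x \<in> \<S>" "\<And>S. S \<in> \<S> \<Longrightarrow> {x \<in> space M. Z x = S} \<in> sets M"
    and Y: "\<And>x. x \<in> space P \<Longrightarrow> Y x \<in> \<S>" "\<And>S. S \<in> \<S> \<Longrightarrow> {x \<in> space P. Y x = S} \<in> sets P"
    and H: "\<And>S. S \<in> \<S> \<Longrightarrow> \<bar>H S\<bar> \<le> C"
  shows "\<bar>(\<integral>x. H (Z x) \<partial>M) - (\<integral>x. H (Y x) \<partial>P)\<bar> \<le>
    C * (\<Sum>S\<in>\<S>. \<bar>measure M {x \<in> space M. Z x = S} - measure P {x \<in> space P. Y x = S}\<bar>)"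
proof -
  have "(\<integral>x. H (Z x) \<partial>M) - (\<integral>x. H (Y x) \<partial>P) =
      (\<Sum>S\<in>\<S>. H S * (measure M {x \<in> space M. Z x = S} - measure P {x \<in> space P. Y x = S}))"
  proof -
    have "(\<integral>x. H (Z x) \<partial>M) = (\<Sum>S\<in>\<S>. H S * measure M {x \<in> space M. Z x = S})"
      using M fin Z by (rule integral_finite_valued)
    moreover have "(\<integral>x. H (Y x) \<partial>P) = (\<Sum>S\<in>\<S>. H S * measure P {x \<in> space P. Y x = S})"
      using P fin Y by (rule integral_finite_valued)
    ultimately show ?thesis by (simp add: sum_subtractf right_diff_distrib)
  qed
  also have "\<bar>\<dots>\<bar> \<le> (\<Sum>S\<in>\<S>. \<bar>H S\<bar> * \<bar>measure M {x \<in> space M. Z x = S} - measure P {x \<in> space P. Y x = S}\<bar>)"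
    by (rule order_trans[OF sum_abs]) (simp add: abs_mult)
  also have "\<dots> \<le> (\<Sum>S\<in>\<S>. C * \<bar>measure M {x \<in> space M. Z x = S} - measure P {x \<in> space P. Y x = S}\<bar>)"
    by (intro sum_mono mult_right_mono H) auto
  finally show ?thesis by (simp add: sum_distrib_left)
qed

context stable_jumps begin

lemma occupied_cells_sets:
  assumes "finite R"
  shows "{\<omega> \<in> space P. occupied_cells n R \<omega> = S} \<in> sets P"
proof -
  have "{\<omega> \<in> space P. occupied_cells n R \<omega> = S} = {\<omega> \<in> space P. S \<subseteq> R \<and> (\<forall>c\<in>R. occupied n c \<omega> = (c \<in> S))}"
    by (auto simp: occupied_cells_def)
  also have "\<dots> \<in> sets P"
  proof (intro sets.sets_Collect_conj sets.sets_Collect_finite_All)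
    show "{\<omega> \<in> space P. occupied n c \<omega> = (c \<in> S)} \<in> sets P" for c by measurable
  qed (use assms in auto)
  finally show ?thesis .
qed

text \<open>Both limits follow by dominated convergence from the pathwise statement
  \<open>osc\<close>: on the whole ball of radius \<open>\<eta> n\<close> around the array path,
  \<open>g\<close> is eventually within \<open>d\<close> of its value at the limit.\<close>

lemma
  assumes g: "J1_continuous_on_D g" and bd: "\<And>y. y \<in> D01 \<Longrightarrow> \<bar>g y\<bar> \<le> Bd"
    and B: "filterlim (\<lambda>n. real (B n) / real n powr a) at_top sequentially"
    and N: "N \<in> null_sets P" "{\<omega> \<in> space P. \<not> good \<omega>} \<subseteq> N"
    and \<eta>: "\<And>n. 0 \<le> \<eta> n" "\<eta> \<longlonglongrightarrow> 0"
  shows tendsto_integral_cell_path: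
      "(\<lambda>n. \<integral>\<omega>. g (cell_path jump_value a n (occupied_cells n (window B n) \<omega>)) \<partial>P)
        \<longlonglongrightarrow> (\<integral>\<omega>. g (\<lambda>t. if \<omega> \<in> N then 0 else path \<omega> t) \<partial>P)"
    and tendsto_integral_path_oscillation:
      "(\<lambda>n. \<integral>\<omega>. path_oscillation g (\<eta> n) (cell_path jump_value a n (occupied_cells n (window B n) \<omega>)) \<partial>P) \<longlonglongrightarrow> 0"
proof -
  let ?Y = "\<lambda>n \<omega>. cell_path jump_value a n (occupied_cells n (window B n) \<omega>)"
  let ?W = "\<lambda>\<omega> t. if \<omega> \<in> N then 0 else path \<omega> t"
  have [measurable]: "N \<in> sets P" using N(1) by auto
  have AE_N: "AE \<omega> in P. \<omega> \<notin> N" using N(1) by (rule AE_not_in)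
  have goodN: "good \<omega>" if "\<omega> \<in> space P" "\<omega> \<notin> N" for \<omega> using N(2) that by blast
  have fin: "finite (window B n)" for n by (simp add: window_def)
  have meas: "(\<lambda>\<omega>. H (occupied_cells n (window B n) \<omega>)) \<in> borel_measurable P" for H :: "(nat \<times> nat) set \<Rightarrow> real" and n
  proof (rule measurable_finite_valued[where \<S>="Pow (window B n)" and H=H, OF finite_measure_axioms])
    show "finite (Pow (window B n))" using fin by simp
    show "{\<omega> \<in> space P. occupied_cells n (window B n) \<omega> = S} \<in> sets P" for S
      using fin by (rule occupied_cells_sets)
  qed (auto simp: occupied_cells_def)
  have osc: "\<forall>\<^sub>F n in sequentially. \<forall>y\<in>D01. (\<forall>t\<in>{0..1}. \<bar>y t - ?Y n \<omega> t\<bar> \<le> \<eta> n) \<longrightarrow> \<bar>g y - g (path \<omega>)\<bar> < d"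
    if good: "good \<omega>" and d: "0 < d" for \<omega> d
  proof -
    have "path \<omega> \<in> D01" using good unfolding path_def by (intro jump_path_in_D01) (simp add: good_def)
    then have "\<exists>\<delta>>0. \<forall>y\<in>D01. J1_dist (path \<omega>) y < \<delta> \<longrightarrow> \<bar>g y - g (path \<omega>)\<bar> < d"
      using g d unfolding J1_continuous_on_D_def by blast
    then obtain \<delta> where \<delta>: "0 < \<delta>" "\<forall>y\<in>D01. J1_dist (path \<omega>) y < \<delta> \<longrightarrow> \<bar>g y - g (path \<omega>)\<bar> < d" by blast
    \<comment> \<open>The radius \<delta> / 8 leads to a distance of at most
      \<open>4 * (\<delta> / 8)\<close>, strictly below \<delta>.\<close>
    have "\<forall>\<^sub>F n in sequentially. \<eta> n < \<delta> / 8" using order_tendstoD(2)[OF \<eta>(2), of "\<delta> / 8"] \<delta>(1) by simp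
    moreover have "\<forall>\<^sub>F n in sequentially. \<forall>z. (\<forall>t\<in>{0..1}. \<bar>z t - ?Y n \<omega> t\<bar> \<le> \<delta> / 8) \<longrightarrow> J1_dist (path \<omega>) z \<le> 4 * (\<delta> / 8)"
      by (rule path_J1_approximation[OF good B]) (use \<delta>(1) in simp)
    ultimately show ?thesis
    proof eventually_elim
      case (elim n)
      show ?case
      proof (intro ballI impI)
        fix y assume y: "y \<in> D01" "\<forall>t\<in>{0..1}. \<bar>y t - ?Y n \<omega> t\<bar> \<le> \<eta> n"
        then have "\<forall>t\<in>{0..1}. \<bar>y t - ?Y n \<omega> t\<bar> \<le> \<delta> / 8" using elim(1) by force
        then have "J1_dist (path \<omega>) y \<le> 4 * (\<delta> / 8)" using elim(2) by blast
        then have "J1_dist (path \<omega>) y < \<delta>" using \<delta>(1) by linarith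
        then show "\<bar>g y - g (path \<omega>)\<bar> < d" using \<delta>(2) y(1) by blast
      qed
    qed
  qed
  have lim_g: "(\<lambda>n. g (?Y n \<omega>)) \<longlonglongrightarrow> g (path \<omega>)" if "good \<omega>" for \<omega>
  proof (rule tendstoI)
    fix d :: real assume "0 < d"
    from osc[OF that this] show "\<forall>\<^sub>F n in sequentially. dist (g (?Y n \<omega>)) (g (path \<omega>)) < d"
      by eventually_elim (use cell_path_in_D01 \<eta>(1) in \<open>simp add: dist_real_def\<close>)
  qed
  have lim_osc: "(\<lambda>n. path_oscillation g (\<eta> n) (?Y n \<omega>)) \<longlonglongrightarrow> 0" if "good \<omega>" for \<omega>
  proof (rule tendstoI)
    fix d :: real assume "0 < d"
    then have "0 < d / 4" by simp
    from osc[OF that this] show "\<forall>\<^sub>F n in sequentially. dist (path_oscillation g (\<eta> n) (?Y n \<omega>)) 0 < d"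
    proof eventually_elim
      case (elim n)
      have "path_oscillation g (\<eta> n) (?Y n \<omega>) \<le> 2 * (d / 4)"
      proof (rule path_oscillation_le_of_centre[where g=g, OF bd cell_path_in_D01 \<eta>(1)])
        show "\<bar>g y - g (path \<omega>)\<bar> \<le> d / 4" if "y \<in> D01" "\<forall>t\<in>{0..1}. \<bar>y t - ?Y n \<omega> t\<bar> \<le> \<eta> n" for y
          using elim that by (intro less_imp_le) blast
      qed
      moreover have "0 \<le> path_oscillation g (\<eta> n) (?Y n \<omega>)"
        by (rule path_oscillation_nonneg[where g=g, OF bd cell_path_in_D01 \<eta>(1)])
      ultimately show ?case using \<open>0 < d\<close> by simp
    qed
  qed
  \<comment> \<open>Measurability at the limit path is inherited from finitely valued functionals;
    on \<open>N\<close>, where the array need not converge, they are replaced by a constant.\<close>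
  have measW: "(\<lambda>\<omega>. g (?W \<omega>)) \<in> borel_measurable P"
  proof (rule borel_measurable_LIMSEQ_real)
    show "(\<lambda>\<omega>. if \<omega> \<in> N then g (\<lambda>_. 0) else g (?Y n \<omega>)) \<in> borel_measurable P" for n
      using meas[of "\<lambda>S. g (cell_path jump_value a n S)" n] by measurable
    show "(\<lambda>n. if \<omega> \<in> N then g (\<lambda>_. 0) else g (?Y n \<omega>)) \<longlonglongrightarrow> g (?W \<omega>)" if "\<omega> \<in> space P" for \<omega>
      using lim_g[OF goodN[OF that]] by (cases "\<omega> \<in> N") simp_all
  qed
  show "(\<lambda>n. \<integral>\<omega>. g (?Y n \<omega>) \<partial>P) \<longlonglongrightarrow> (\<integral>\<omega>. g (?W \<omega>) \<partial>P)"
  proof (rule integral_dominated_convergence[where w="\<lambda>_. Bd"])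
    show "AE \<omega> in P. (\<lambda>n. g (?Y n \<omega>)) \<longlonglongrightarrow> g (?W \<omega>)"
      using AE_N AE_space by eventually_elim (use lim_g goodN in simp)
    show "(\<lambda>\<omega>. g (?Y n \<omega>)) \<in> borel_measurable P" for n by (rule meas)
    show "AE \<omega> in P. norm (g (?Y n \<omega>)) \<le> Bd" for n using bd cell_path_in_D01 by simp
  qed (use measW in auto)
  have "(\<lambda>n. \<integral>\<omega>. path_oscillation g (\<eta> n) (?Y n \<omega>) \<partial>P) \<longlonglongrightarrow> (\<integral>\<omega>. 0 \<partial>P)"
  proof (rule integral_dominated_convergence[where w="\<lambda>_. 2 * Bd"])
    show "AE \<omega> in P. (\<lambda>n. path_oscillation g (\<eta> n) (?Y n \<omega>)) \<longlonglongrightarrow> 0"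
      using AE_N AE_space by eventually_elim (use lim_osc goodN in simp)
    show "(\<lambda>\<omega>. path_oscillation g (\<eta> n) (?Y n \<omega>)) \<in> borel_measurable P" for n by (rule meas)
    show "AE \<omega> in P. norm (path_oscillation g (\<eta> n) (?Y n \<omega>)) \<le> 2 * Bd" for n
      using path_oscillation_nonneg[where g=g, OF bd cell_path_in_D01 \<eta>(1)] path_oscillation_le[where g=g, OF bd cell_path_in_D01 \<eta>(1)] by simp
  qed auto
  then show "(\<lambda>n. \<integral>\<omega>. path_oscillation g (\<eta> n) (?Y n \<omega>) \<partial>P) \<longlonglongrightarrow> 0" by simp
qed

end

text \<open>Identifies the path of an itinerary with Birkhoff sums of the function truncated to the
  levels in \<open>L\<close>.\<close>

lemma sum_names:
  fixes v :: "nat \<Rightarrow> real"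
  assumes "finite L" "m \<le> n"
  shows "(\<Sum>c\<in>names T F (L \<times> {..<n}) x. v (fst c) * of_bool (snd c < m))
    = (\<Sum>j<m. \<Sum>l\<in>L. v l * indicator (F l) ((T ^^ j) x))"
proof -
  have "(\<Sum>c\<in>names T F (L \<times> {..<n}) x. v (fst c) * of_bool (snd c < m))
      = (\<Sum>c\<in>L \<times> {..<n}. if (T ^^ snd c) x \<in> F (fst c) then v (fst c) * of_bool (snd c < m) else 0)"
    unfolding names_def using assms by (intro sum.inter_filter) auto
  also have "\<dots> = (\<Sum>(l, j)\<in>L \<times> {..<n}. of_bool (j < m) * (v l * indicator (F l) ((T ^^ j) x)))"
    by (intro sum.cong) (auto simp: indicator_def)
  also have "\<dots> = (\<Sum>j<n. \<Sum>l\<in>L. of_bool (j < m) * (v l * indicator (F l) ((T ^^ j) x)))"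
    unfolding sum.cartesian_product[symmetric] by (rule sum.swap)
  also have "\<dots> = (\<Sum>j<m. \<Sum>l\<in>L. v l * indicator (F l) ((T ^^ j) x))"
    using assms by (intro sum.mono_neutral_cong_right) auto
  finally show ?thesis .
qed

context aperiodic_ergodic_system begin

lemma prob_ge_le:
  assumes Q: "integrable M Q" "\<And>x. 0 \<le> Q x" and \<eta>: "0 < \<eta>"
  shows "prob {x \<in> space M. \<eta> \<le> Q x} \<le> (\<integral>x. Q x \<partial>M) / \<eta>"
proof -
  have [measurable]: "Q \<in> borel_measurable M" using Q(1) by (rule borel_measurable_integrable)
  have "\<eta> * prob {x \<in> space M. \<eta> \<le> Q x} = (\<integral>x. \<eta> * indicator {x \<in> space M. \<eta> \<le> Q x} x \<partial>M)" by simp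
  also have "\<dots> \<le> (\<integral>x. Q x \<partial>M)"
  proof (rule integral_mono_AE)
    show "AE x in M. \<eta> * indicator {x \<in> space M. \<eta> \<le> Q x} x \<le> Q x"
      using Q(2) by (intro AE_I2) (auto simp: indicator_def)
  qed (use Q in \<open>auto simp: less_top[symmetric]\<close>)
  finally show ?thesis using \<eta> by (simp add: pos_le_divide_eq mult.commute)
qed

context
  fixes F :: "nat \<Rightarrow> 'a set" and v :: "nat \<Rightarrow> real" and a :: real and f :: "'a \<Rightarrow> real"
  assumes F_sets [measurable]: "\<And>l. F l \<in> sets M"
    and locally_finite: "\<And>x. x \<in> space M \<Longrightarrow> finite {l. x \<in> F l}"
    and f: "f = (\<lambda>x. \<Sum>l. v l * indicator (F l) x)"
begin

text \<open>If no level from \<open>b\<close> on is met, \<open>f\<close> is a finite sum along the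
  orbit, and the two paths differ only by the levels below \<open>k\<close>. Absolute values and the
  full range \<open>j < n\<close> make the bound uniform in \<open>t\<close>; for
  \<open>k = 0\<close> it is 0.\<close>

lemma partial_sum_process_cell_path_diff_le:
  assumes "k \<le> b" and hit: "\<And>j l. j < n \<Longrightarrow> b \<le> l \<Longrightarrow> (T ^^ j) x \<notin> F l" and t: "t \<in> {0..1}"
  shows "\<bar>partial_sum_process (1 / a) T f n x t - cell_path v a n (names T F ({k..<b} \<times> {..<n}) x) t\<bar>
    \<le> real n powr (- a) * (\<Sum>j<n. \<Sum>l<k. \<bar>v l\<bar> * indicator (F l) ((T ^^ j) x))"
proof -
  define m where "m = nat \<lfloor>real n * t\<rfloor>"
  have m: "m \<le> n"
  proof -
    have "real n * t \<le> real n" using t by (simp add: mult_left_le)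
    then show ?thesis unfolding m_def by linarith
  qed
  have "f ((T ^^ j) x) = (\<Sum>l<k. v l * indicator (F l) ((T ^^ j) x)) + (\<Sum>l\<in>{k..<b}. v l * indicator (F l) ((T ^^ j) x))"
    if "j < m" for j
  proof -
    have "f ((T ^^ j) x) = (\<Sum>l<b. v l * indicator (F l) ((T ^^ j) x))"
      unfolding f using hit[of j] that m by (intro suminf_finite) (auto simp: indicator_def)
    also have "{..<b} = {..<k} \<union> {k..<b}" using \<open>k \<le> b\<close> by auto
    finally show ?thesis by (subst (asm) sum.union_disjoint) auto
  qed
  then have "(\<Sum>j<m. f ((T ^^ j) x)) = (\<Sum>j<m. \<Sum>l<k. v l * indicator (F l) ((T ^^ j) x))
      + (\<Sum>j<m. \<Sum>l\<in>{k..<b}. v l * indicator (F l) ((T ^^ j) x))"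
    by (simp add: sum.distrib)
  then have "partial_sum_process (1 / a) T f n x t - cell_path v a n (names T F ({k..<b} \<times> {..<n}) x) t
      = real n powr (- a) * (\<Sum>j<m. \<Sum>l<k. v l * indicator (F l) ((T ^^ j) x))"
    unfolding partial_sum_process_def birkhoff_sum_def cell_path_def m_def[symmetric] sum_names[OF finite_atLeastLessThan m]
    by (simp add: algebra_simps)
  also have "\<bar>\<dots>\<bar> \<le> real n powr (- a) * (\<Sum>j<m. \<Sum>l<k. \<bar>v l\<bar> * indicator (F l) ((T ^^ j) x))"
    unfolding abs_mult
  proof (rule mult_mono)
    show "\<bar>\<Sum>j<m. \<Sum>l<k. v l * indicator (F l) ((T ^^ j) x)\<bar> \<le> (\<Sum>j<m. \<Sum>l<k. \<bar>v l\<bar> * indicator (F l) ((T ^^ j) x))"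
      by (intro order_trans[OF sum_abs] sum_mono) (auto simp: abs_mult)
  qed auto
  also have "\<dots> \<le> real n powr (- a) * (\<Sum>j<n. \<Sum>l<k. \<bar>v l\<bar> * indicator (F l) ((T ^^ j) x))"
    using m by (intro mult_left_mono sum_mono2) (auto intro!: sum_nonneg)
  finally show ?thesis .
qed

lemma eventually_no_hit:
  assumes x: "x \<in> space M"
  shows "\<forall>\<^sub>F b in sequentially. \<forall>j<n. \<forall>l\<ge>b. (T ^^ j) x \<notin> F l"
proof -
  have "finite (\<Union>j<n. {l. (T ^^ j) x \<in> F l})" using T_iter_space[OF x] locally_finite by blast
  then obtain K where K: "\<forall>l\<in>(\<Union>j<n. {l. (T ^^ j) x \<in> F l}). l < K"
    using finite_nat_set_iff_bounded by blast
  show ?thesis unfolding eventually_sequentially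
  proof (intro exI allI impI)
    fix b j l assume "K \<le> b" "j < n" "b \<le> l"
    then show "(T ^^ j) x \<notin> F l" using K by fastforce
  qed
qed

lemma measurable_cell_path_names:
  fixes H :: "(nat \<times> nat) set \<Rightarrow> real"
  assumes "finite R"
  shows "(\<lambda>x. H (names T F R x)) \<in> borel_measurable M"
proof (rule measurable_finite_valued[where \<S>="Pow R" and H=H, OF finite_measure_axioms])
  show "finite (Pow R)" using assms by simp
  show "{x \<in> space M. names T F R x = S} \<in> sets M" for S using assms by (intro names_sets) auto
qed (auto simp: names_def)

text \<open>A \<open>J1\<close>-continuous \<open>g\<close> need not be measurable on paths, but along finitely valued approximations it is.\<close>

lemma measurable_partial_sum_functional:
  assumes g: "J1_continuous_on_D g"
  shows "(\<lambda>x. g (partial_sum_process (1 / a) T f n x)) \<in> borel_measurable M"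
proof (rule borel_measurable_LIMSEQ_real)
  show "(\<lambda>x. g (cell_path v a n (names T F ({0..<b} \<times> {..<n}) x))) \<in> borel_measurable M" for b
    by (rule measurable_cell_path_names) simp
  show "(\<lambda>b. g (cell_path v a n (names T F ({0..<b} \<times> {..<n}) x))) \<longlonglongrightarrow> g (partial_sum_process (1 / a) T f n x)"
    if "x \<in> space M" for x
  proof (rule tendsto_eventually)
    from eventually_no_hit[OF that, of n]
    show "\<forall>\<^sub>F b in sequentially. g (cell_path v a n (names T F ({0..<b} \<times> {..<n}) x)) = g (partial_sum_process (1 / a) T f n x)"
    proof eventually_elim
      case (elim b)
      have "cell_path v a n (names T F ({0..<b} \<times> {..<n}) x) t = partial_sum_process (1 / a) T f n x t" if "t \<in> {0..1}" for t
        using partial_sum_process_cell_path_diff_le[of 0 b n x t] elim that by simp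
      then show ?case by (intro J1_continuous_cong[OF g cell_path_in_D01 partial_sum_process_in_D01])
    qed
  qed
qed

text \<open>Markov's inequality for the low levels, a union bound for the levels from
  \<open>b\<close> on. By stationarity all \<open>n\<close> times contribute equally, which turns
  \<open>n powr (- a)\<close> into \<open>n powr (1 - a)\<close>.\<close>

lemma prob_bad_le:
  assumes q: "\<And>l. prob (F l) \<le> q l" "summable q" and \<eta>: "0 < \<eta>"
  shows "prob ({x \<in> space M. \<eta> \<le> real n powr (- a) * (\<Sum>j<n. \<Sum>l<k. \<bar>v l\<bar> * indicator (F l) ((T ^^ j) x))}
      \<union> {x \<in> space M. \<exists>j<n. \<exists>l\<ge>b. (T ^^ j) x \<in> F l})
    \<le> real n powr (1 - a) * (\<Sum>l<k. \<bar>v l\<bar> * prob (F l)) / \<eta> + real n * (\<Sum>l. q (l + b))"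
proof -
  let ?Q = "\<lambda>x. real n powr (- a) * (\<Sum>j<n. \<Sum>l<k. \<bar>v l\<bar> * indicator (F l) ((T ^^ j) x))"
  let ?h = "\<lambda>j l. {x \<in> space M. (T ^^ j) x \<in> F l}"
  have h[measurable]: "?h j l \<in> sets M" for j l by measurable
  have Q_eq: "?Q x = real n powr (- a) * (\<Sum>j<n. \<Sum>l<k. \<bar>v l\<bar> * indicator (?h j l) x)" if "x \<in> space M" for x
    using that by (auto simp: indicator_def intro!: arg_cong2[of _ _ _ _ "(*)"] sum.cong)
  have int1: "integrable M (\<lambda>x. \<bar>v l\<bar> * indicator (?h j l) x)" for j l
    by (intro integrable_mult_right integrable_real_indicator) (auto simp: less_top[symmetric])
  have int2: "integrable M (\<lambda>x. \<Sum>l<k. \<bar>v l\<bar> * indicator (?h j l) x)" for j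
    by (rule Bochner_Integration.integrable_sum[OF int1])
  have int: "integrable M (\<lambda>x. real n powr (- a) * (\<Sum>j<n. \<Sum>l<k. \<bar>v l\<bar> * indicator (?h j l) x))"
    by (rule integrable_mult_right, rule Bochner_Integration.integrable_sum[OF int2])
  have "(\<integral>x. ?Q x \<partial>M) = (\<integral>x. real n powr (- a) * (\<Sum>j<n. \<Sum>l<k. \<bar>v l\<bar> * indicator (?h j l) x) \<partial>M)"
    by (rule Bochner_Integration.integral_cong[OF refl Q_eq])
  also have "\<dots> = real n powr (- a) * (\<Sum>j<n. \<Sum>l<k. \<bar>v l\<bar> * prob (?h j l))"
    by (simp only: Bochner_Integration.integral_sum[OF int2] Bochner_Integration.integral_sum[OF int1]
        integral_mult_right_zero Bochner_Integration.integral_indicator) (simp add: Int_absorb2[OF sets.sets_into_space[OF h]])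
  also have "\<dots> = real n powr (- a) * real n * (\<Sum>l<k. \<bar>v l\<bar> * prob (F l))"
    by (simp add: prob_T_iter)
  also have "real n powr (- a) * real n = real n powr (1 - a)"
    by (cases "n = 0") (simp_all add: powr_diff powr_minus field_simps)
  finally have EQ: "(\<integral>x. ?Q x \<partial>M) = real n powr (1 - a) * (\<Sum>l<k. \<bar>v l\<bar> * prob (F l))" .
  have intQ: "integrable M ?Q"
    by (rule iffD2[OF Bochner_Integration.integrable_cong[OF refl Q_eq] int])
  have Q_meas: "?Q \<in> borel_measurable M" using intQ by (rule borel_measurable_integrable)
  have Q0: "0 \<le> ?Q x" for x by (intro mult_nonneg_nonneg sum_nonneg) auto
  have markov: "prob {x \<in> space M. \<eta> \<le> ?Q x} \<le> real n powr (1 - a) * (\<Sum>l<k. \<bar>v l\<bar> * prob (F l)) / \<eta>"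
    unfolding EQ[symmetric] using intQ Q0 \<eta> by (rule prob_ge_le)
  have q0: "0 \<le> q l" for l using q(1)[of l] measure_nonneg[of M "F l"] by linarith
  have "prob {x \<in> space M. \<exists>j<n. \<exists>l\<ge>b. (T ^^ j) x \<in> F l} \<le> real n * (\<Sum>l. q (l + b))"
  proof -
    have sumq: "summable (\<lambda>l. q (l + b))" using q(2) by (simp add: summable_iff_shift)
    have sumF: "summable (\<lambda>l. prob (?h j (l + b)))" for j
      by (rule summable_comparison_test'[OF sumq, of 0]) (use q(1) in \<open>auto simp: prob_T_iter\<close>)
    have "{x \<in> space M. \<exists>j<n. \<exists>l\<ge>b. (T ^^ j) x \<in> F l} = (\<Union>j<n. \<Union>l. ?h j (l + b))"
      by (auto simp: le_iff_add add.commute)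
    also have "prob \<dots> \<le> (\<Sum>j<n. prob (\<Union>l. ?h j (l + b)))"
      by (rule finite_measure_subadditive_finite) auto
    also have "\<dots> \<le> (\<Sum>j<n. \<Sum>l. q (l + b))"
    proof (rule sum_mono)
      fix j
      have "prob (\<Union>l. ?h j (l + b)) \<le> (\<Sum>l. prob (?h j (l + b)))"
        by (rule finite_measure_subadditive_countably) (use sumF in auto)
      also have "\<dots> \<le> (\<Sum>l. q (l + b))"
        by (rule suminf_le[OF _ sumF sumq]) (simp add: prob_T_iter q(1))
      finally show "prob (\<Union>l. ?h j (l + b)) \<le> (\<Sum>l. q (l + b))" .
    qed
    finally show ?thesis by simp
  qed
  moreover have "{x \<in> space M. \<exists>j<n. \<exists>l\<ge>b. (T ^^ j) x \<in> F l} \<in> sets M" by measurable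
  moreover have "{x \<in> space M. \<eta> \<le> Q x} \<in> sets M" if "Q \<in> borel_measurable M" for Q :: "'a \<Rightarrow> real"
    using that by measurable
  note this[OF Q_meas]
  ultimately show ?thesis
    by (intro order_trans[OF measure_Un_le] add_mono markov)
qed

text \<open>Off the bad event the two paths are within \<eta> of each other and the oscillation
  bounds the difference; on it the trivial bound \<open>2 * Bd\<close> is used.\<close>

lemma integral_partial_sum_functional_diff_le:
  assumes g: "J1_continuous_on_D g" and bd: "\<And>y. y \<in> D01 \<Longrightarrow> \<bar>g y\<bar> \<le> Bd"
    and q: "\<And>l. prob (F l) \<le> q l" "summable q" and \<eta>: "0 < \<eta>" and "k \<le> b"
  shows "\<bar>(\<integral>x. g (partial_sum_process (1 / a) T f n x) \<partial>M) - (\<integral>x. g (cell_path v a n (names T F ({k..<b} \<times> {..<n}) x)) \<partial>M)\<bar>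
    \<le> (\<integral>x. path_oscillation g \<eta> (cell_path v a n (names T F ({k..<b} \<times> {..<n}) x)) \<partial>M)
      + 2 * Bd * (real n powr (1 - a) * (\<Sum>l<k. \<bar>v l\<bar> * prob (F l)) / \<eta> + real n * (\<Sum>l. q (l + b)))"
proof -
  let ?X = "partial_sum_process (1 / a) T f n"
  let ?Y = "\<lambda>x. cell_path v a n (names T F ({k..<b} \<times> {..<n}) x)"
  let ?Q = "\<lambda>x. real n powr (- a) * (\<Sum>j<n. \<Sum>l<k. \<bar>v l\<bar> * indicator (F l) ((T ^^ j) x))"
  define A where "A = {x \<in> space M. \<eta> \<le> ?Q x} \<union> {x \<in> space M. \<exists>j<n. \<exists>l\<ge>b. (T ^^ j) x \<in> F l}"
  have [measurable]: "A \<in> sets M" unfolding A_def by measurable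
  have [measurable]: "(\<lambda>x. g (?X x)) \<in> borel_measurable M" by (rule measurable_partial_sum_functional[OF g])
  have [measurable]: "(\<lambda>x. g (?Y x)) \<in> borel_measurable M" "(\<lambda>x. path_oscillation g \<eta> (?Y x)) \<in> borel_measurable M"
    by (rule measurable_cell_path_names, simp)+
  have \<eta>0: "0 \<le> \<eta>" using \<eta> by simp
  note osc = path_oscillation_nonneg[where g=g, OF bd cell_path_in_D01 \<eta>0] path_oscillation_le[where g=g, OF bd cell_path_in_D01 \<eta>0]
  have bd0: "0 \<le> Bd" using order_trans[OF abs_ge_zero bd[OF cell_path_in_D01]] .
  have intX: "integrable M (\<lambda>x. g (?X x))"
    by (rule integrable_const_bound[where B=Bd]) (use bd[OF partial_sum_process_in_D01, of "1 / a" T f n] in auto)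
  have intY: "integrable M (\<lambda>x. g (?Y x))"
    by (rule integrable_const_bound[where B=Bd]) (use bd[OF cell_path_in_D01] in auto)
  have intO: "integrable M (\<lambda>x. path_oscillation g \<eta> (?Y x))"
    by (rule integrable_const_bound[where B="2 * Bd"]) (use osc in auto)
  have pw: "\<bar>g (?X x) - g (?Y x)\<bar> \<le> path_oscillation g \<eta> (?Y x) + 2 * Bd * indicator A x" if x: "x \<in> space M" for x
  proof (cases "x \<in> A")
    case True
    have "\<bar>g (?X x)\<bar> \<le> Bd" "\<bar>g (?Y x)\<bar> \<le> Bd" by (rule bd, rule partial_sum_process_in_D01, rule bd, rule cell_path_in_D01)
    then show ?thesis using True osc(1)[of v a n "names T F ({k..<b} \<times> {..<n}) x"] by simp
  next
    case False
    have "\<bar>?X x t - ?Y x t\<bar> \<le> \<eta>" if "t \<in> {0..1}" for t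
      using partial_sum_process_cell_path_diff_le[OF \<open>k \<le> b\<close> _ that, of n x] False x unfolding A_def by fastforce
    then have "\<bar>g (?X x) - g (?Y x)\<bar> \<le> path_oscillation g \<eta> (?Y x)"
      by (intro path_oscillation_upper[where g=g and Bd=Bd] bd cell_path_in_D01 \<eta>0 partial_sum_process_in_D01)
    then show ?thesis using False by simp
  qed
  have "\<bar>(\<integral>x. g (?X x) \<partial>M) - (\<integral>x. g (?Y x) \<partial>M)\<bar> = \<bar>\<integral>x. g (?X x) - g (?Y x) \<partial>M\<bar>"
    by (simp only: Bochner_Integration.integral_diff[OF intX intY])
  also have "\<dots> \<le> (\<integral>x. \<bar>g (?X x) - g (?Y x)\<bar> \<partial>M)" by (rule integral_abs_bound)
  also have "\<dots> \<le> (\<integral>x. path_oscillation g \<eta> (?Y x) + 2 * Bd * indicator A x \<partial>M)"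
    by (rule integral_mono_AE) (use intX intY intO pw in \<open>auto simp: less_top[symmetric] intro!: Bochner_Integration.integrable_add integrable_abs Bochner_Integration.integrable_diff\<close>)
  also have "\<dots> = (\<integral>x. path_oscillation g \<eta> (?Y x) \<partial>M) + 2 * Bd * prob A"
    using intO by (subst Bochner_Integration.integral_add) (auto simp: less_top[symmetric])
  also have "\<dots> \<le> (\<integral>x. path_oscillation g \<eta> (?Y x) \<partial>M)
      + 2 * Bd * (real n powr (1 - a) * (\<Sum>l<k. \<bar>v l\<bar> * prob (F l)) / \<eta> + real n * (\<Sum>l. q (l + b)))"
    using prob_bad_le[OF q \<eta>, of n k b] bd0 unfolding A_def by (intro add_left_mono mult_left_mono) auto
  finally show ?thesis .
qed

end
end

section \<open>Choice of the parameters and conclusion\<close>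

lemma (in stable_jumps) abs_jump_value_le: "\<bar>jump_value l\<bar> \<le> (c0 + c1) * real (Suc (l div 2))"
proof -
  have "\<bar>weight l\<bar> \<le> c0 + c1" using c0 c1 by (simp add: weight_def)
  then show ?thesis unfolding jump_value_def abs_mult by (simp add: mult_right_mono)
qed

text \<open>With \<open>b = 1 / a\<close> the sum is of order \<open>n powr (1 - b)\<close>, so the
  product has exponent \<open>2 - a - b\<close>, negative because
  \<open>(a - 1) * (a - 1) > 0\<close>. The denominator \<open>real (Suc l)\<close> of the error
  term offsets the growth of \<open>v l\<close>.\<close>

lemma tendsto_small_levels:
  fixes v q :: "nat \<Rightarrow> real"
  assumes a: "1 < a" and C: "0 \<le> C" and v: "\<And>l. \<bar>v l\<bar> \<le> C * real (Suc (l div 2))"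
    and q: "\<And>l. 0 \<le> q l" "\<And>l. q l \<le> intensity a l + (1 / 2) ^ l / real (Suc l)"
  shows "(\<lambda>n. real n powr (1 - a) * (\<Sum>l<n. \<bar>v l\<bar> * q l)) \<longlonglongrightarrow> 0"
proof -
  define b where "b = 1 / a"
  have b: "0 < b" "b < 1" using a by (auto simp: b_def)
  have "\<bar>v l\<bar> * q l \<le> C * (2 * real (Suc l) powr (- b) + (1 / 2) ^ l)" for l
  proof -
    have "\<bar>v l\<bar> * q l \<le> (C * real (Suc (l div 2))) * (intensity a l + (1 / 2) ^ l / real (Suc l))"
      using v q C by (intro mult_mono) auto
    also have "\<dots> = C * (real (Suc (l div 2)) * intensity a l + real (Suc (l div 2)) * ((1 / 2) ^ l / real (Suc l)))"
      by (simp only: distrib_left mult.assoc)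
    also have "\<dots> \<le> C * (2 * real (Suc l) powr (- b) + (1 / 2) ^ l)"
    proof (intro mult_left_mono add_mono C)
      show "real (Suc (l div 2)) * intensity a l \<le> 2 * real (Suc l) powr (- b)"
        using level_intensity_le[OF a, of l] by (simp add: b_def)
      have "real (Suc (l div 2)) * ((1 / 2) ^ l / real (Suc l)) \<le> real (Suc l) * ((1 / 2) ^ l / real (Suc l))"
        by (intro mult_right_mono) auto
      then show "real (Suc (l div 2)) * ((1 / 2) ^ l / real (Suc l)) \<le> (1 / 2) ^ l" by simp
    qed
    finally show ?thesis .
  qed
  then have "(\<Sum>l<n. \<bar>v l\<bar> * q l) \<le> (\<Sum>l<n. C * (2 * real (Suc l) powr (- b) + (1 / 2) ^ l))" for n
    by (rule sum_mono)
  also have "\<dots> n = C * (2 * (\<Sum>l<n. real (Suc l) powr (- b)) + (\<Sum>l<n. (1 / 2) ^ l))" for n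
    by (simp only: sum_distrib_left[symmetric] sum.distrib)
  also have "\<dots> n \<le> C * (2 * (real n powr (1 - b) / (1 - b)) + 2)" for n
  proof (intro mult_left_mono add_mono C sum_powr_le b)
    have "(\<Sum>l<n. (1 / 2 :: real) ^ l) = 2 - 2 * (1 / 2) ^ n" by (simp add: sum_gp_strict)
    then show "(\<Sum>l<n. (1 / 2 :: real) ^ l) \<le> 2" by simp
  qed simp
  finally have bound: "(\<Sum>l<n. \<bar>v l\<bar> * q l) \<le> C * (2 * (real n powr (1 - b) / (1 - b)) + 2)" for n .
  have "2 < a + b"
  proof -
    have "0 < (a - 1) * (a - 1)" using a by simp
    then have "2 * a < a * a + 1" by (simp add: algebra_simps)
    then show ?thesis using a by (simp add: b_def field_simps)
  qed
  then have "(\<lambda>n. real n powr (2 - a - b)) \<longlonglongrightarrow> 0" "(\<lambda>n. real n powr (1 - a)) \<longlonglongrightarrow> 0"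
    using a by (auto intro!: tendsto_neg_powr filterlim_real_sequentially)
  then have "(\<lambda>n. C * (2 / (1 - b) * real n powr (2 - a - b) + 2 * real n powr (1 - a))) \<longlonglongrightarrow> C * (2 / (1 - b) * 0 + 2 * 0)"
    by (intro tendsto_intros)
  then have lim: "(\<lambda>n. C * (2 / (1 - b) * real n powr (2 - a - b) + 2 * real n powr (1 - a))) \<longlonglongrightarrow> 0" by simp
  show ?thesis
  proof (rule tendsto_sandwich[OF always_eventually always_eventually tendsto_const lim]; intro allI)
    fix n
    show "0 \<le> real n powr (1 - a) * (\<Sum>l<n. \<bar>v l\<bar> * q l)"
      using q by (intro mult_nonneg_nonneg sum_nonneg) auto
    have "real n powr (1 - a) * (\<Sum>l<n. \<bar>v l\<bar> * q l) \<le> real n powr (1 - a) * (C * (2 * (real n powr (1 - b) / (1 - b)) + 2))"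
      by (intro mult_left_mono bound) simp
    also have "\<dots> = C * (2 / (1 - b) * (real n powr (1 - a) * real n powr (1 - b)) + 2 * real n powr (1 - a))"
      by (simp add: algebra_simps)
    also have "real n powr (1 - a) * real n powr (1 - b) = real n powr (2 - a - b)"
      unfolding powr_add[symmetric] by (simp add: algebra_simps)
    finally show "real n powr (1 - a) * (\<Sum>l<n. \<bar>v l\<bar> * q l) \<le> C * (2 / (1 - b) * real n powr (2 - a - b) + 2 * real n powr (1 - a))" .
  qed
qed

text \<open>\<open>B n\<close> is so high that, \<open>q\<close> being summable, levels beyond it
  are unlikely to be met within \<open>n\<close> steps, and so high that every jump of the limit
  ends up inside the window.\<close>

lemma exists_truncation_levels:
  fixes q :: "nat \<Rightarrow> real"
  assumes q: "summable q" "\<And>l. 0 \<le> q l"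
  shows "\<exists>B. (\<forall>n. n \<le> B n) \<and> filterlim (\<lambda>n. real (B n) / real n powr a) at_top sequentially \<and>
    (\<lambda>n. real n * (\<Sum>l. q (l + B n))) \<longlonglongrightarrow> 0"
proof -
  have "\<exists>B. n \<le> B \<and> real n powr (a + 1) \<le> real B \<and> real n * (\<Sum>l. q (l + B)) \<le> 1 / real (Suc n)" for n
  proof -
    obtain N where N: "\<forall>k\<ge>N. norm (\<Sum>l. q (l + k)) < 1 / (real (Suc n) * real (Suc n))"
      using suminf_exist_split[OF _ q(1), of "1 / (real (Suc n) * real (Suc n))"] by auto
    define B where "B = max N (max n (nat \<lceil>real n powr (a + 1)\<rceil>))"
    have "real n * (\<Sum>l. q (l + B)) \<le> real (Suc n) * (1 / (real (Suc n) * real (Suc n)))"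
    proof (rule mult_mono)
      have "norm (\<Sum>l. q (l + B)) < 1 / (real (Suc n) * real (Suc n))" using N by (simp add: B_def)
      then show "(\<Sum>l. q (l + B)) \<le> 1 / (real (Suc n) * real (Suc n))" unfolding real_norm_def by linarith
      show "0 \<le> (\<Sum>l. q (l + B))" using q by (intro suminf_nonneg) (simp_all add: summable_iff_shift)
    qed auto
    also have "\<dots> = 1 / real (Suc n)" by (simp del: of_nat_Suc)
    finally have "real n * (\<Sum>l. q (l + B)) \<le> 1 / real (Suc n)" .
    moreover have "real n powr (a + 1) \<le> real B"
    proof -
      have "real n powr (a + 1) \<le> real (nat \<lceil>real n powr (a + 1)\<rceil>)" by (rule real_nat_ceiling_ge)
      also have "\<dots> \<le> real B" unfolding B_def by simp
      finally show ?thesis .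
    qed
    ultimately show ?thesis by (intro exI[of _ B]) (simp add: B_def)
  qed
  then obtain B where B: "\<And>n. n \<le> B n" "\<And>n. real n powr (a + 1) \<le> real (B n)"
    "\<And>n. real n * (\<Sum>l. q (l + B n)) \<le> 1 / real (Suc n)" by metis
  have "filterlim (\<lambda>n. real (B n) / real n powr a) at_top sequentially"
  proof (rule filterlim_at_top_mono[OF filterlim_real_sequentially])
    show "\<forall>\<^sub>F n in sequentially. real n \<le> real (B n) / real n powr a"
      using eventually_gt_at_top[of 0]
    proof eventually_elim
      case (elim n)
      have "real n * real n powr a \<le> real (B n)" using B(2)[of n] elim by (simp add: powr_add mult.commute)
      then show ?case using elim by (simp add: pos_le_divide_eq)
    qed
  qed
  moreover have "(\<lambda>n. real n * (\<Sum>l. q (l + B n))) \<longlonglongrightarrow> 0"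
  proof (rule tendsto_sandwich[OF always_eventually always_eventually tendsto_const LIMSEQ_inverse_real_of_nat]; intro allI)
    show "0 \<le> real n * (\<Sum>l. q (l + B n))" for n
      using q by (intro mult_nonneg_nonneg suminf_nonneg) (simp_all add: summable_iff_shift)
    show "real n * (\<Sum>l. q (l + B n)) \<le> inverse (real (Suc n))" for n
      using B(3)[of n] by (simp add: inverse_eq_divide)
  qed
  ultimately show ?thesis using B(1) by blast
qed

lemma summable_half_power_div: "summable (\<lambda>l. (1 / 2 :: real) ^ l / real (Suc l))"
proof (rule summable_comparison_test')
  show "summable (\<lambda>l. (1 / 2 :: real) ^ l)" by (rule summable_geometric) simp
  have "(1 / 2 :: real) ^ l / real (Suc l) \<le> (1 / 2) ^ l / 1" for l by (intro divide_left_mono) auto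
  then show "norm ((1 / 2 :: real) ^ l / real (Suc l)) \<le> (1 / 2) ^ l" for l by simp
qed

text \<open>The Birkhoff sums are compared with the path of their own itinerary in the window, and
  this path with the array on \<open>P\<close>, whose limit is known. The latter step also moves the
  oscillation of \<open>g\<close> to \<open>P\<close>, where it tends to 0.\<close>

lemma (in aperiodic_ergodic_system) exists_converging_function:
  assumes "stable_jumps P \<zeta> a c0 c1" and N: "N \<in> null_sets P" "{\<omega> \<in> space P. \<not> stable_jumps.good \<zeta> a c0 c1 \<omega>} \<subseteq> N"
  shows "\<exists>f \<in> borel_measurable M. converges_in_distribution_J1 M (partial_sum_process (1 / a) T f) P
    (\<lambda>\<omega> t. if \<omega> \<in> N then 0 else stable_jumps.path \<zeta> a c0 c1 \<omega> t)"
proof -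
  interpret J: stable_jumps P \<zeta> a c0 c1 by fact
  note a = J.a
  define p where "p = occupation a"
  \<comment> \<open>Summable, so that the total variation error over the window tends to 0, and
    still summable when multiplied by the level, as the low levels require.\<close>
  define e :: "nat \<Rightarrow> real" where "e l = (1 / 2) ^ l / real (Suc l)" for l
  define q where "q l = p l + e l" for l
  define v where "v = J.jump_value"
  have p: "0 \<le> p l \<and> p l \<le> 1" for l using occupation_bounds[OF a] by (simp add: p_def)
  have p_le: "p l \<le> intensity a l" for l
    using exp_ge_add_one_self[of "- intensity a l"] by (simp add: p_def occupation_def)
  have e: "0 < e l" for l by (simp add: e_def)
  have sum_e: "summable e" unfolding e_def by (rule summable_half_power_div)
  have "summable p"
    by (rule summable_comparison_test'[OF summable_intensity[OF a], of 0]) (use p p_le in auto)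
  then have sum_q: "summable q" unfolding q_def using sum_e by (rule summable_add)
  have q0: "0 \<le> q l" for l using p e by (simp add: q_def add_nonneg_nonneg less_imp_le)
  obtain F where F: "\<forall>l. F l \<in> sets M" "\<forall>l. prob (F l) \<le> p l + e l" "\<forall>x\<in>space M. finite {l. x \<in> F l}"
    "\<forall>a b n. n \<le> Suc a \<longrightarrow>
      (\<Sum>S\<in>Pow ({a..<b} \<times> {..<n}). \<bar>prob {x \<in> space M. names T F ({a..<b} \<times> {..<n}) x = S}
         - bernoulli_weight p ({a..<b} \<times> {..<n}) S\<bar>) \<le> (\<Sum>l\<in>{a..<b}. e l)"
    using exists_locally_finite_nearly_independent_sets[of p e, OF p e sum_q[unfolded q_def]]
    by (elim exE conjE) (rule that)
  have F_sets[measurable]: "F l \<in> sets M" for l using F(1) by simp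
  have F_q: "prob (F l) \<le> q l" for l using F(2) by (simp add: q_def)
  have F_fin: "finite {l. x \<in> F l}" if "x \<in> space M" for x using F(3) that by simp
  define f where "f = (\<lambda>x. \<Sum>l. v l * indicator (F l) x)"
  have f_meas: "f \<in> borel_measurable M" unfolding f_def by measurable
  obtain B where B: "\<forall>n. n \<le> B n" "filterlim (\<lambda>n. real (B n) / real n powr a) at_top sequentially"
    "(\<lambda>n. real n * (\<Sum>l. q (l + B n))) \<longlonglongrightarrow> 0"
    using exists_truncation_levels[of q a, OF sum_q q0] by (elim exE conjE) (rule that)
  define \<kappa> where "\<kappa> n = real n powr (1 - a) * (\<Sum>l<n. \<bar>v l\<bar> * prob (F l))" for n
  have \<kappa>0: "0 \<le> \<kappa> n" for n unfolding \<kappa>_def by (intro mult_nonneg_nonneg sum_nonneg) auto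
  have \<kappa>_lim: "\<kappa> \<longlonglongrightarrow> 0"
    unfolding \<kappa>_def
  proof (rule tendsto_small_levels[OF a, of "c0 + c1"])
    show "\<bar>v l\<bar> \<le> (c0 + c1) * real (Suc (l div 2))" for l unfolding v_def by (rule J.abs_jump_value_le)
    show "prob (F l) \<le> intensity a l + (1 / 2) ^ l / real (Suc l)" for l
      using F_q[of l] p_le[of l] by (simp add: q_def e_def)
  qed (use J.c0 J.c1 in auto)
  \<comment> \<open>The threshold has to vanish more slowly than \<kappa>: with
    \<open>sqrt (\<kappa> n)\<close> the Markov bound \<open>\<kappa> n / \<eta> n\<close> still
    tends to 0. The second summand keeps it positive when \<open>\<kappa> n = 0\<close>.\<close>
  define \<eta> where "\<eta> n = sqrt (\<kappa> n) + inverse (real (Suc n))" for n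
  have \<eta>_pos: "0 < \<eta> n" for n unfolding \<eta>_def using \<kappa>0[of n] by (intro add_nonneg_pos) auto
  have sqrt_lim: "(\<lambda>n. sqrt (\<kappa> n)) \<longlonglongrightarrow> 0" using tendsto_real_sqrt[OF \<kappa>_lim] by simp
  have \<eta>_lim: "\<eta> \<longlonglongrightarrow> 0"
    using tendsto_add[OF sqrt_lim LIMSEQ_inverse_real_of_nat] by (simp add: \<eta>_def[abs_def])
  have ratio: "\<kappa> n / \<eta> n \<le> sqrt (\<kappa> n)" for n
  proof -
    have "\<kappa> n = sqrt (\<kappa> n) * sqrt (\<kappa> n)" using \<kappa>0[of n] by simp
    also have "\<dots> \<le> sqrt (\<kappa> n) * \<eta> n" using \<kappa>0[of n] by (intro mult_left_mono) (auto simp: \<eta>_def)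
    finally show ?thesis using \<eta>_pos[of n] by (simp add: pos_divide_le_eq)
  qed
  have tails: "(\<lambda>n. \<Sum>l\<in>{n..<B n}. e l) \<longlonglongrightarrow> 0"
  proof -
    have shift: "summable (\<lambda>l. e (l + n))" for n using sum_e by (simp add: summable_iff_shift)
    have "(\<Sum>l\<in>{n..<B n}. e l) \<le> (\<Sum>l. e (l + n))" for n
    proof -
      have "(\<Sum>l\<in>{n..<B n}. e l) = (\<Sum>l<B n - n. e (l + n))"
        using sum.shift_bounds_nat_ivl[of e 0 n "B n - n"] B(1) by (simp add: lessThan_atLeast0)
      also have "\<dots> \<le> (\<Sum>l. e (l + n))"
        by (rule sum_le_suminf[OF shift]) (use e in \<open>auto intro: less_imp_le\<close>)
      finally show ?thesis .
    qed
    moreover have "(\<lambda>n. \<Sum>l. e (l + n)) \<longlonglongrightarrow> 0" by (rule suminf_exist_split2[OF sum_e])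
    moreover have "0 \<le> (\<Sum>l\<in>{n..<B n}. e l)" for n using e by (intro sum_nonneg less_imp_le)
    ultimately show ?thesis
      by (intro tendsto_sandwich[of "\<lambda>_. 0" "\<lambda>n. \<Sum>l\<in>{n..<B n}. e l" sequentially "\<lambda>n. \<Sum>l. e (l + n)"] always_eventually allI tendsto_const)
  qed
  have fin: "finite (J.window B n)" for n by (simp add: J.window_def)
  \<comment> \<open>The window has lowest level \<open>n\<close> and \<open>n\<close> times, so it
    stays within the range where the itineraries are nearly independent.\<close>
  have compare: "\<bar>(\<integral>x. H (names T F (J.window B n) x) \<partial>M) - (\<integral>\<omega>. H (J.occupied_cells n (J.window B n) \<omega>) \<partial>P)\<bar>
      \<le> C * (\<Sum>l\<in>{n..<B n}. e l)" if n: "0 < n" and H: "\<And>S. \<bar>H S\<bar> \<le> C" for H :: "(nat \<times> nat) set \<Rightarrow> real" and C n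
  proof -
    have C0: "0 \<le> C" using order_trans[OF abs_ge_zero H] .
    have "\<bar>(\<integral>x. H (names T F (J.window B n) x) \<partial>M) - (\<integral>\<omega>. H (J.occupied_cells n (J.window B n) \<omega>) \<partial>P)\<bar>
      \<le> C * (\<Sum>S\<in>Pow (J.window B n). \<bar>prob {x \<in> space M. names T F (J.window B n) x = S}
          - J.prob {\<omega> \<in> space P. J.occupied_cells n (J.window B n) \<omega> = S}\<bar>)"
    proof (rule abs_integral_finite_valued_diff_le[OF finite_measure_axioms J.finite_measure_axioms])
      show "finite (Pow (J.window B n))" using fin by simp
      show "{x \<in> space M. names T F (J.window B n) x = S} \<in> sets M" for S using fin by (intro names_sets) auto
      show "{\<omega> \<in> space P. J.occupied_cells n (J.window B n) \<omega> = S} \<in> sets P" for S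
        using fin by (rule J.occupied_cells_sets)
    qed (use H in \<open>auto simp: names_def J.occupied_cells_def\<close>)
    also have "(\<Sum>S\<in>Pow (J.window B n). \<bar>prob {x \<in> space M. names T F (J.window B n) x = S}
          - J.prob {\<omega> \<in> space P. J.occupied_cells n (J.window B n) \<omega> = S}\<bar>)
        = (\<Sum>S\<in>Pow (J.window B n). \<bar>prob {x \<in> space M. names T F (J.window B n) x = S} - bernoulli_weight p (J.window B n) S\<bar>)"
    proof (rule sum.cong[OF refl])
      fix S assume "S \<in> Pow (J.window B n)"
      then have "J.prob {\<omega> \<in> space P. J.occupied_cells n (J.window B n) \<omega> = S} = bernoulli_weight p (J.window B n) S"
        unfolding p_def by (intro J.prob_occupied_cells n fin) (auto simp: J.window_def)
      then show "\<bar>prob {x \<in> space M. names T F (J.window B n) x = S} - J.prob {\<omega> \<in> space P. J.occupied_cells n (J.window B n) \<omega> = S}\<bar>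
        = \<bar>prob {x \<in> space M. names T F (J.window B n) x = S} - bernoulli_weight p (J.window B n) S\<bar>" by (simp only:)
    qed
    also have "C * \<dots> \<le> C * (\<Sum>l\<in>{n..<B n}. e l)"
      using F(4)[rule_format, of n n "B n"] unfolding J.window_def by (intro mult_left_mono C0) simp
    finally show ?thesis .
  qed
  have "(\<lambda>n. \<integral>x. g (partial_sum_process (1 / a) T f n x) \<partial>M) \<longlonglongrightarrow>
      (\<integral>\<omega>. g (\<lambda>t. if \<omega> \<in> N then 0 else J.path \<omega> t) \<partial>P)"
    if g: "J1_continuous_on_D g" and g_bd: "bounded (g ` D01)" for g
  proof -
    obtain Bd where bd: "\<And>y. y \<in> D01 \<Longrightarrow> \<bar>g y\<bar> \<le> Bd"
      using g_bd unfolding bounded_iff by auto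
    let ?X = "\<lambda>n. \<integral>x. g (partial_sum_process (1 / a) T f n x) \<partial>M"
    let ?Y = "\<lambda>n. \<integral>x. g (cell_path v a n (names T F (J.window B n) x)) \<partial>M"
    let ?Y' = "\<lambda>n. \<integral>\<omega>. g (cell_path v a n (J.occupied_cells n (J.window B n) \<omega>)) \<partial>P"
    let ?O = "\<lambda>n. \<integral>x. path_oscillation g (\<eta> n) (cell_path v a n (names T F (J.window B n) x)) \<partial>M"
    let ?O' = "\<lambda>n. \<integral>\<omega>. path_oscillation g (\<eta> n) (cell_path v a n (J.occupied_cells n (J.window B n) \<omega>)) \<partial>P"
    \<comment> \<open>The factor 3 is one \<open>Bd\<close> for moving \<open>g\<close> to the array
      and \<open>2 * Bd\<close> for moving its oscillation.\<close>
    let ?err = "\<lambda>n. ?O' n + 3 * Bd * (\<Sum>l\<in>{n..<B n}. e l) + 2 * Bd * (sqrt (\<kappa> n) + real n * (\<Sum>l. q (l + B n)))"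
    have \<eta>0: "0 \<le> \<eta> n" for n using \<eta>_pos[of n] by simp
    have bd0: "0 \<le> Bd" using order_trans[OF abs_ge_zero bd[OF cell_path_in_D01]] .
    have limY': "?Y' \<longlonglongrightarrow> (\<integral>\<omega>. g (\<lambda>t. if \<omega> \<in> N then 0 else J.path \<omega> t) \<partial>P)"
      unfolding v_def by (rule J.tendsto_integral_cell_path[OF g bd B(2) N \<eta>0 \<eta>_lim])
    have limO': "?O' \<longlonglongrightarrow> 0"
      unfolding v_def by (rule J.tendsto_integral_path_oscillation[OF g bd B(2) N \<eta>0 \<eta>_lim])
    have err: "\<bar>?X n - ?Y' n\<bar> \<le> ?err n" if n: "0 < n" for n
    proof -
      have nB: "n \<le> B n" using B(1) by simp
      have "\<bar>?X n - ?Y n\<bar> \<le> ?O n + 2 * Bd * (\<kappa> n / \<eta> n + real n * (\<Sum>l. q (l + B n)))"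
        using integral_partial_sum_functional_diff_le[OF F_sets F_fin f_def g bd F_q sum_q \<eta>_pos nB, of a n]
        unfolding \<kappa>_def J.window_def .
      also have "\<dots> \<le> ?O n + 2 * Bd * (sqrt (\<kappa> n) + real n * (\<Sum>l. q (l + B n)))"
        using bd0 ratio[of n] by (intro add_left_mono mult_left_mono add_right_mono) auto
      finally have 1: "\<bar>?X n - ?Y n\<bar> \<le> ?O n + 2 * Bd * (sqrt (\<kappa> n) + real n * (\<Sum>l. q (l + B n)))" .
      have 2: "\<bar>?Y n - ?Y' n\<bar> \<le> Bd * (\<Sum>l\<in>{n..<B n}. e l)"
        by (rule compare[OF n]) (rule bd[OF cell_path_in_D01])
      have 3: "\<bar>?O n - ?O' n\<bar> \<le> (2 * Bd) * (\<Sum>l\<in>{n..<B n}. e l)"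
      proof (rule compare[OF n])
        show "\<bar>path_oscillation g (\<eta> n) (cell_path v a n S)\<bar> \<le> 2 * Bd" for S
          using path_oscillation_nonneg[where g=g, OF bd cell_path_in_D01 \<eta>0, of n v a n S]
            path_oscillation_le[where g=g, OF bd cell_path_in_D01 \<eta>0, of n v a n S] by simp
      qed
      have "\<bar>?X n - ?Y' n\<bar> \<le> \<bar>?X n - ?Y n\<bar> + \<bar>?Y n - ?Y' n\<bar>" by linarith
      also have "\<dots> \<le> (?O' n + (2 * Bd) * (\<Sum>l\<in>{n..<B n}. e l) + 2 * Bd * (sqrt (\<kappa> n) + real n * (\<Sum>l. q (l + B n)))) + Bd * (\<Sum>l\<in>{n..<B n}. e l)"
        using 1 2 3 by linarith
      also have "\<dots> = ?err n" by (simp add: algebra_simps)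
      finally show ?thesis .
    qed
    have "?err \<longlonglongrightarrow> 0 + 3 * Bd * 0 + 2 * Bd * (0 + 0)"
      by (intro tendsto_add tendsto_mult tendsto_const limO' tails sqrt_lim B(3))
    then have err_lim: "?err \<longlonglongrightarrow> 0" by simp
    have "(\<lambda>n. ?X n - ?Y' n) \<longlonglongrightarrow> 0"
      by (rule Lim_null_comparison[OF _ err_lim]) (use err in \<open>auto simp: eventually_sequentially intro!: exI[of _ 1]\<close>)
    from tendsto_add[OF this limY'] show ?thesis by simp
  qed
  then have "converges_in_distribution_J1 M (partial_sum_process (1 / a) T f) P (\<lambda>\<omega> t. if \<omega> \<in> N then 0 else J.path \<omega> t)"
    unfolding converges_in_distribution_J1_def by blast
  then show ?thesis using f_meas by blast
qed

theorem mainTheorem1: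
  fixes M :: "'a measure" and T :: "'a \<Rightarrow> 'a"
  assumes "prob_preserving_system M T" and "ergodic M T" and "aperiodic M T"
  shows "\<forall>\<alpha>\<in>{0<..<1}. \<forall>\<sigma>>0. \<forall>\<beta>\<in>{-1..1}.
           \<exists>f \<in> borel_measurable M. \<exists>(P :: (real \<Rightarrow> real) measure) W.
             stable_levy_motion \<alpha> \<sigma> \<beta> P W \<and>
             converges_in_distribution_J1 M (partial_sum_process \<alpha> T f) P W"
proof (intro ballI allI impI)
  fix \<alpha> \<sigma> \<beta> :: real
  assume \<alpha>: "\<alpha> \<in> {0<..<1}" and \<sigma>: "0 < \<sigma>" and \<beta>: "\<beta> \<in> {-1..1}"
  have "prob_space M" using assms(1) by (simp add: prob_preserving_system_def)
  then interpret aperiodic_ergodic_system M T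
    using assms by (intro aperiodic_ergodic_system.intro aperiodic_ergodic_system_axioms.intro)
  define a where "a = 1 / \<alpha>"
  have a: "1 < a" and \<alpha>_eq: "\<alpha> = 1 / a" using \<alpha> by (auto simp: a_def)
  have cos: "0 < cos (pi / (2 * a))" using a by (intro cos_gt_zero) (auto simp: field_simps)
  \<comment> \<open>Solves \<open>scale\<close> for \<kappa>. The factors \<open>1 + \<beta>\<close>
    and \<open>1 - \<beta>\<close> then distribute the jumps over the two signs; one sign is absent
    when \<beta> is 1 or -1.\<close>
  define \<kappa> where "\<kappa> = \<sigma> powr (1 / a) / (2 * stable_const a * cos (pi / (2 * a)))"
  have \<kappa>: "0 < \<kappa>" using stable_const_pos[OF a] cos \<sigma> by (simp add: \<kappa>_def)
  define c0 where "c0 = (\<kappa> * (1 + \<beta>)) powr a"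
  define c1 where "c1 = (\<kappa> * (1 - \<beta>)) powr a"
  have w: "c0 powr (1 / a) = \<kappa> * (1 + \<beta>)" "c1 powr (1 / a) = \<kappa> * (1 - \<beta>)"
    using a \<kappa> \<beta> by (simp_all add: c0_def c1_def powr_powr)
  have scale: "2 * \<kappa> * stable_const a * cos (pi / (2 * a)) = \<sigma> powr (1 / a)"
    using stable_const_pos[OF a] cos by (simp add: \<kappa>_def)
  define D where "D q = (if fst (prod_decode q) = 0 then distr (measure_pmf (poisson_pmf 1)) borel real else unif)" for q
  have D: "prob_space (D q)" "sets (D q) = sets borel" for q
    using prob_space_unif by (auto simp: D_def sets_unif intro!: prob_space.prob_space_distr measure_pmf.prob_space_axioms)
  obtain P :: "(real \<Rightarrow> real) measure" and \<zeta> where P: "prob_space P"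
    "prob_space.indep_vars P (\<lambda>_. borel) \<zeta> (UNIV :: nat set)" "\<forall>q. distr P borel (\<zeta> q) = D q"
    using exists_independent_coordinates[of D, OF D] by (elim exE conjE) (rule that)
  interpret J: stable_jumps P \<zeta> a c0 c1
    using P a by (intro stable_jumps.intro poisson_points.intro poisson_points_axioms.intro stable_jumps_axioms.intro)
      (auto simp: D_def c0_def c1_def)
  obtain N where "{\<omega> \<in> space P. \<not> J.good \<omega>} \<subseteq> N" "N \<in> null_sets P"
    using J.AE_good unfolding eventually_ae_filter by blast
  note N = this(2,1)
  have "stable_levy_motion \<alpha> \<sigma> \<beta> P (\<lambda>\<omega> t. if \<omega> \<in> N then 0 else J.path \<omega> t)"
    unfolding \<alpha>_eq by (rule J.stable_levy_motion_path[OF w \<sigma> scale N])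
  moreover obtain f where "f \<in> borel_measurable M"
    "converges_in_distribution_J1 M (partial_sum_process \<alpha> T f) P (\<lambda>\<omega> t. if \<omega> \<in> N then 0 else J.path \<omega> t)"
    using exists_converging_function[OF J.stable_jumps_axioms N] unfolding \<alpha>_eq by blast
  ultimately show "\<exists>f \<in> borel_measurable M. \<exists>(P :: (real \<Rightarrow> real) measure) W.
    stable_levy_motion \<alpha> \<sigma> \<beta> P W \<and> converges_in_distribution_J1 M (partial_sum_process \<alpha> T f) P W"
    by blast
qed

end
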